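(* For every integer $k\geq 1$, the motivic Galois group $\Gamma_{\rho_k C}$ of the $k$-th prolongation $\rho_k C$ of the Carlitz module is the linear algebraic group over $\mathbb{F}_q(t)$ given by \[ \Gamma_{\rho_k C}(R)=\left\{ \begin{pmatrix} a_0 & a_1 & \cdots & a_k\\ 0 & a_0 & \ddots & \vdots\\ \vdots & \ddots & \ddots & a_1\\ 0&\cdots & 0 & a_0\end{pmatrix} \,\middle|\, a_0\in R^\times,\ a_1,\ldots,a_k\in R\right\}\] for all $\mathbb{F}_q(t)$-algebras $R$.
   Context: Let $\mathbb{F}_q$ be the finite field with $q$ elements, $K=\mathbb{F}_q(\theta)$, $K_\infty=\mathbb{F}_q((1/\theta))$ with $|\theta|=q$, $\mathbb{C}_\infty$ the completion of an algebraic closure of $K_\infty$, and $\overline{K}\subset\mathbb{C}_\infty$ the algebraic closure of $K$. Let $\mathbb{T}=\mathbb{C}_\infty\langle t\rangle$ be the Tate algebra (power series $\sum x_nt^n$ with $|x_n|\to 0$) and $\mathbb{L}$ its fraction field; $\sigma$ acts on $\mathbb{T}$ and $\mathbb{L}$ by $\sum x_nt^n\mapsto \sum x_n^{1/q}t^n$. Hyperderivatives with respect to $t$ are the $\mathbb{C}_\infty$-linear maps $\partial^{(n)}(\sum_i x_it^i)=\sum_i\binom{i}{n}x_it^{i-n}$ (binomial coefficients mod $p=\mathrm{char}\,\mathbb{F}_q$). For $f$ a Laurent series let $\rho_{[k]}(f)$ be the $(k+1)\times(k+1)$ upper triangular matrix whose $(i,j)$-entry is $\partial^{(j-i)}(f)$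 for $j\geq i$ and $0$ otherwise; $\rho_{[k]}$ is a ring homomorphism. Let $\omega(t)=(-\theta)^{1/(q-1)}\prod_{i\geq 0}(1-t/\theta^{q^i})^{-1}\in\mathbb{T}$ be the Anderson–Thakur function (for a fixed $(q-1)$-st root of $-\theta$). The $k$-th prolongation $\rho_kC$ of the Carlitz module ($\mathbb{G}_a$ with $t$ acting by $x\mapsto\theta x+x^q$) is $\mathbb{G}_a^{k+1}$ over $K$ with $t$ acting by $\Phi_t=N+\mathbf{1}_{k+1}\tau$, where $N$ has $\theta$ on the diagonal, $-1$ on the superdiagonal and $0$ elsewhere, and $\tau$ is the $q$-power Frobenius. Its dual $t$-motive admits the rigid analytic trivialization $\Psi=\rho_{[k]}(t-\theta)^{-1}\rho_{[k]}(\omega)^{-1}\in\mathrm{GL}_{k+1}(\mathbb{T})$. The motivic Galois group (in the sense of Papanikolas) is defined as follows: let $\tilde\Psi=(\Psi\otimes 1)^{-1}(1\otimes\Psi)\in\mathrm{GL}_{k+1}(\mathbb{L}\otimes_{\overline{K}(t)}\mathbb{L})$ and let $\mu:\mathbb{F}_q(t)[X_{ij},1/\det X]\to\mathbb{L}\otimes_{\overline{K}(t)}\mathbb{L}$ send $X_{ij}\mapsto\tilde\Psi_{ij}$; then $\Gamma_{\rho_kC}$ is the closed subscheme of $\mathrm{GL}_{k+1}$ over $\mathbb{F}_q(t)$ defined by the ideal $\ker\mu$. *)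

theory Defs
  imports
    Complex_Main
    "HOL-Library.Cardinality"
    "HOL-Library.Poly_Mapping"
    "HOL-Computational_Algebra.Computational_Algebra"
    "HOL-Algebra.Algebra"
    "HOL-Algebra.Algebraic_Closure_Type"
    "Jordan_Normal_Form.Matrix"
    "Jordan_Normal_Form.Gauss_Jordan_Elimination"
begin

section \<open>The fields\<close>

text \<open>
  The finite field \<open>F\<^sub>q\<close> is the type \<^typ>\<open>'a\<close>, so \<open>q = CARD('a)\<close>. The field
  \<open>K\<^sub>\<infinity> = F\<^sub>q((1/\<theta>))\<close> is \<^typ>\<open>'a fls\<close>, whose variable \<^term>\<open>fls_X\<close> is \<open>1/\<theta>\<close>. Its
  algebraic closure is the type \<^typ>\<open>'a fls alg_closure\<close>, and \<open>C\<^sub>\<infinity>\<close> is a field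
  \<^typ>\<open>'c\<close> that is a completion of it with respect to the absolute value \<open>|x| = dist x 0\<close>
  extending the one of \<open>K\<^sub>\<infinity>\<close> with \<open>|\<theta>| = q\<close>. As \<open>K\<^sub>\<infinity>\<close> is complete, this extension to the algebraic
  closure is unique, so the following predicate determines \<open>C\<^sub>\<infinity>\<close> up to isometric isomorphism over
  the algebraic closure of \<open>K\<^sub>\<infinity>\<close>. Completeness is part of the class \<^class>\<open>complete_space\<close>.
\<close>

definition completed_alg_closure ::
    "('a::{field,finite} fls alg_closure \<Rightarrow> 'c::{field,complete_space}) \<Rightarrow> bool" where
  "completed_alg_closure \<iota> \<longleftrightarrow>
     \<iota> 1 = 1 \<and> (\<forall>x y. \<iota> (x + y) = \<iota> x + \<iota> y) \<and> (\<forall>x y. \<iota> (x * y) = \<iota> x * \<iota> y) \<and>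
     (\<forall>x y::'c. dist x y = dist (x - y) 0) \<and>
     (\<forall>x y::'c. dist (x * y) 0 = dist x 0 * dist y 0) \<and>
     (\<forall>x y::'c. dist (x + y) 0 \<le> max (dist x 0) (dist y 0)) \<and>
     (\<forall>f. f \<noteq> 0 \<longrightarrow> dist (\<iota> (to_ac f)) 0 = real CARD('a) powi (- fls_subdegree f)) \<and>
     (\<forall>x. \<forall>e>0. \<exists>a. dist x (\<iota> a) < e)"

definition theta :: "('a::{field,finite} fls alg_closure \<Rightarrow> 'c::{field,complete_space}) \<Rightarrow> 'c" where
  "theta \<iota> = \<iota> (to_ac fls_X_inv)"

definition Fq :: "('a::{field,finite} fls alg_closure \<Rightarrow> 'c::{field,complete_space}) \<Rightarrow> 'c set" where
  "Fq \<iota> = range (\<lambda>a. \<iota> (to_ac (fls_const a)))"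

definition K_theta :: "('a::{field,finite} fls alg_closure \<Rightarrow> 'c::{field,complete_space}) \<Rightarrow> 'c set" where
  "K_theta \<iota> = {poly p (theta \<iota>) / poly q (theta \<iota>) | p q.
            (\<forall>i. coeff p i \<in> Fq \<iota>) \<and> (\<forall>i. coeff q i \<in> Fq \<iota>) \<and> q \<noteq> 0}"

definition K_bar :: "('a::{field,finite} fls alg_closure \<Rightarrow> 'c::{field,complete_space}) \<Rightarrow> 'c set" where
  "K_bar \<iota> = {x. \<exists>p. (\<forall>i. coeff p i \<in> K_theta \<iota>) \<and> p \<noteq> 0 \<and> poly p x = 0}"

text \<open>
  All fields of functions in \<open>t\<close> are realised as subfields of the field \<^typ>\<open>'c fls\<close> of formal
  Laurent series in \<open>t\<close> over \<open>C\<^sub>\<infinity>\<close>; in particular \<open>F(t)\<close> for a subfield \<open>F\<close> of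
  \<open>C\<^sub>\<infinity>\<close>, and the fraction field \<open>L\<close> of the Tate algebra \<open>T\<close>.
\<close>

definition rat_funs :: "'c::field set \<Rightarrow> 'c fls set" where
  "rat_funs F = {fps_to_fls (fps_of_poly p) / fps_to_fls (fps_of_poly q) | p q.
                   (\<forall>i. coeff p i \<in> F) \<and> (\<forall>i. coeff q i \<in> F) \<and> q \<noteq> 0}"

definition Tate_algebra :: "'c::{field,complete_space} fps set" where
  "Tate_algebra = {f. (\<lambda>n. fps_nth f n) \<longlonglongrightarrow> 0}"

definition Tate_frac :: "'c::{field,complete_space} fls set" where
  "Tate_frac = {fps_to_fls f / fps_to_fls g | f g.
                  f \<in> Tate_algebra \<and> g \<in> Tate_algebra \<and> g \<noteq> 0}"

definition Fqt :: "('a::{field,finite} fls alg_closure \<Rightarrow> 'c::{field,complete_space}) \<Rightarrow> 'c fls ring" where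
  "Fqt \<iota> = ring_of_type_algebra \<lparr>carrier := rat_funs (Fq \<iota>)\<rparr>"


section \<open>Hyperderivatives, the Anderson--Thakur function and the matrix \<open>\<Psi>\<close>\<close>

text \<open>
  \<open>\<partial>\<^sup>(\<^sup>n\<^sup>)(\<Sum>\<^sub>i x\<^sub>i t\<^sup>i) = \<Sum>\<^sub>i (i choose n) x\<^sub>i t\<^sup>i\<^sup>-\<^sup>n\<close>. As \<open>i\<close> may be negative, the binomial coefficient is
  \<open>i (i - 1) \<dots> (i - n + 1) / n!\<close>; this is an exact division of integers, and the quotient is then
  read in characteristic \<open>p\<close>.
\<close>

definition int_choose :: "int \<Rightarrow> nat \<Rightarrow> int" where
  "int_choose i n = (\<Prod>l<n. i - int l) div fact n"

lift_definition hyperderiv :: "nat \<Rightarrow> 'c::comm_ring_1 fls \<Rightarrow> 'c fls" is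
  "\<lambda>n f i. of_int (int_choose (i + int n) n) * f (i + int n)"
proof -
  fix n :: nat and f :: "int \<Rightarrow> 'c"
  assume "\<forall>\<^sub>\<infinity>m. f (- int m) = 0"
  then obtain N where N: "\<forall>m>N. f (- int m) = 0"
    by (auto simp: MOST_nat)
  have "of_int (int_choose (- int m + int n) n) * f (- int m + int n) = 0" if "m > N + n" for m
  proof -
    have "- int m + int n = - int (m - n)" using that by simp
    then show ?thesis using N that by (metis add_lessD1 less_diff_conv mult_zero_right)
  qed
  then show "\<forall>\<^sub>\<infinity>m. of_int (int_choose (- int m + int n) n) * f (- int m + int n) = 0"
    by (auto simp: MOST_nat)
qed

definition rho :: "nat \<Rightarrow> 'c::comm_ring_1 fls \<Rightarrow> 'c fls mat" where
  "rho k f = mat (k + 1) (k + 1) (\<lambda>(i, j). if i \<le> j then hyperderiv (j - i) f else 0)"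

text \<open>
  The parameter \<open>\<eta>\<close> is the fixed \<open>(q - 1)\<close>-st root of \<open>-\<theta>\<close>. The infinite product converges for the
  Gauss norm of the Tate algebra, so its coefficients are the limits of the coefficients of the
  partial products.
\<close>

definition omega ::
    "('a::{field,finite} fls alg_closure \<Rightarrow> 'c::{field,complete_space}) \<Rightarrow> 'c \<Rightarrow> 'c fps" where
  "omega \<iota> \<eta> = fps_const \<eta> * Abs_fps (\<lambda>n. lim (\<lambda>m.
     fps_nth (\<Prod>i<m. inverse (1 - fps_const (1 / theta \<iota> ^ (CARD('a) ^ i)) * fps_X)) n))"

definition Psi ::
    "('a::{field,finite} fls alg_closure \<Rightarrow> 'c::{field,complete_space}) \<Rightarrow> 'c \<Rightarrow> nat \<Rightarrow> 'c fls mat" where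
  "Psi \<iota> \<eta> k = the (mat_inverse (rho k (fls_X - fls_const (theta \<iota>))))
                 * the (mat_inverse (rho k (fps_to_fls (omega \<iota> \<eta>))))"


section \<open>Tensor products of commutative algebras\<close>

text \<open>
  For subrings \<open>F \<subseteq> L\<close> of a commutative ring, \<open>L \<otimes>\<^sub>F L\<close> is the quotient of the monoid ring
  \<open>\<int>[L \<times> L]\<close> of the multiplicative monoid \<open>L \<times> L\<close> by the relations making \<open>(a, b) \<mapsto> a \<otimes> b\<close>
  biadditive and \<open>F\<close>-balanced.
\<close>

definition pair_ring :: "'x::comm_ring_1 set \<Rightarrow> (('x \<times> 'x) \<Rightarrow>\<^sub>0 int) ring" where
  "pair_ring L =
    \<lparr>carrier = {f. Poly_Mapping.keys f \<subseteq> L \<times> L},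
     monoid.mult = (\<lambda>f g. \<Sum>(a, b)\<in>Poly_Mapping.keys f. \<Sum>(c, d)\<in>Poly_Mapping.keys g.
               Poly_Mapping.single (a * c, b * d)
                 (Poly_Mapping.lookup f (a, b) * Poly_Mapping.lookup g (c, d))),
     one = Poly_Mapping.single (1, 1) 1,
     ring.zero = 0,
     add = (+)\<rparr>"

definition tensor_relations :: "'x::comm_ring_1 set \<Rightarrow> 'x set \<Rightarrow> (('x \<times> 'x) \<Rightarrow>\<^sub>0 int) set" where
  "tensor_relations F L =
     (let e = (\<lambda>a b. Poly_Mapping.single (a, b) (1::int)) in
      {e (a + a') b - e a b - e a' b | a a' b. a \<in> L \<and> a' \<in> L \<and> b \<in> L} \<union>
      {e a (b + b') - e a b - e a b' | a b b'. a \<in> L \<and> b \<in> L \<and> b' \<in> L} \<union>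
      {e (c * a) b - e a (c * b) | a b c. a \<in> L \<and> b \<in> L \<and> c \<in> F})"

definition tensor_ideal :: "'x::comm_ring_1 set \<Rightarrow> 'x set \<Rightarrow> (('x \<times> 'x) \<Rightarrow>\<^sub>0 int) set" where
  "tensor_ideal F L = Idl\<^bsub>pair_ring L\<^esub> (tensor_relations F L)"

definition tensor_ring :: "'x::comm_ring_1 set \<Rightarrow> 'x set \<Rightarrow> (('x \<times> 'x) \<Rightarrow>\<^sub>0 int) set ring" where
  "tensor_ring F L = pair_ring L Quot tensor_ideal F L"

definition pure_tensor ::
    "'x::comm_ring_1 set \<Rightarrow> 'x set \<Rightarrow> 'x \<Rightarrow> 'x \<Rightarrow> (('x \<times> 'x) \<Rightarrow>\<^sub>0 int) set" where
  "pure_tensor F L a b = tensor_ideal F L +>\<^bsub>pair_ring L\<^esub> Poly_Mapping.single (a, b) 1"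


section \<open>The general linear group over a commutative ring and its coordinate ring\<close>

definition mat_monoid :: "('r, 'm) ring_scheme \<Rightarrow> nat \<Rightarrow> 'r mat monoid" where
  "mat_monoid R n =
    \<lparr>carrier = {A \<in> carrier_mat n n. \<forall>i<n. \<forall>j<n. A $$ (i, j) \<in> carrier R},
     monoid.mult = (\<lambda>A B. mat n n (\<lambda>(i, j). \<Oplus>\<^bsub>R\<^esub>l\<in>{..<n}. A $$ (i, l) \<otimes>\<^bsub>R\<^esub> B $$ (l, j))),
     one = mat n n (\<lambda>(i, j). if i = j then \<one>\<^bsub>R\<^esub> else \<zero>\<^bsub>R\<^esub>)\<rparr>"

definition GL :: "('r, 'm) ring_scheme \<Rightarrow> nat \<Rightarrow> 'r mat monoid" where
  "GL R n = units_of (mat_monoid R n)"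

definition ring_det :: "('r, 'm) ring_scheme \<Rightarrow> nat \<Rightarrow> 'r mat \<Rightarrow> 'r" where
  "ring_det R n A = (\<Oplus>\<^bsub>R\<^esub>p\<in>{p. p permutes {..<n}}.
     (if evenperm p then \<one>\<^bsub>R\<^esub> else \<ominus>\<^bsub>R\<^esub> \<one>\<^bsub>R\<^esub>) \<otimes>\<^bsub>R\<^esub> (\<Otimes>\<^bsub>R\<^esub>i\<in>{..<n}. A $$ (i, p i)))"

text \<open>
  The coordinate ring \<open>F[X\<^sub>i\<^sub>j, 1/det X]\<close> is presented by polynomials in the \<open>X\<^sub>i\<^sub>j\<close> and one
  further variable \<open>1/det X\<close>. Two polynomials with the same image in the coordinate ring have the
  same value at every point of \<open>GL\<^sub>n\<close>, as the last variable is always evaluated at the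
  inverse of the determinant.
\<close>

datatype gl_var = Entry nat nat | Inv_Det

definition gl_polys :: "'f::zero set \<Rightarrow> nat \<Rightarrow> ((gl_var \<Rightarrow>\<^sub>0 nat) \<Rightarrow>\<^sub>0 'f) set" where
  "gl_polys F n = {f. (\<forall>m. Poly_Mapping.lookup f m \<in> F) \<and>
     (\<forall>m\<in>Poly_Mapping.keys f. Poly_Mapping.keys m \<subseteq> {Entry i j | i j. i < n \<and> j < n} \<union> {Inv_Det})}"

definition gl_eval ::
    "('r, 'm) ring_scheme \<Rightarrow> ('f \<Rightarrow> 'r) \<Rightarrow> nat \<Rightarrow> 'r mat \<Rightarrow> ((gl_var \<Rightarrow>\<^sub>0 nat) \<Rightarrow>\<^sub>0 'f::zero) \<Rightarrow> 'r" where
  "gl_eval R h n A f =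
     (let v = (\<lambda>x. case x of Entry i j \<Rightarrow> A $$ (i, j) | Inv_Det \<Rightarrow> inv\<^bsub>R\<^esub> (ring_det R n A))
      in \<Oplus>\<^bsub>R\<^esub>m\<in>Poly_Mapping.keys f. h (Poly_Mapping.lookup f m) \<otimes>\<^bsub>R\<^esub>
           (\<Otimes>\<^bsub>R\<^esub>x\<in>Poly_Mapping.keys m. v x [^]\<^bsub>R\<^esub> Poly_Mapping.lookup m x))"


section \<open>The motivic Galois group\<close>

definition LL ::
    "('a::{field,finite} fls alg_closure \<Rightarrow> 'c::{field,complete_space}) \<Rightarrow> (('c fls \<times> 'c fls) \<Rightarrow>\<^sub>0 int) set ring" where
  "LL \<iota> = tensor_ring (rat_funs (K_bar \<iota>)) Tate_frac"

abbreviation LL_tensor ::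
    "('a::{field,finite} fls alg_closure \<Rightarrow> 'c::{field,complete_space}) \<Rightarrow> 'c fls \<Rightarrow> 'c fls \<Rightarrow> (('c fls \<times> 'c fls) \<Rightarrow>\<^sub>0 int) set" where
  "LL_tensor \<iota> \<equiv> pure_tensor (rat_funs (K_bar \<iota>)) Tate_frac"

definition Psi_tilde ::
    "('a::{field,finite} fls alg_closure \<Rightarrow> 'c::{field,complete_space}) \<Rightarrow> nat \<Rightarrow> 'c fls mat \<Rightarrow>
     (('c fls \<times> 'c fls) \<Rightarrow>\<^sub>0 int) set mat" where
  "Psi_tilde \<iota> n \<Psi> =
     inv\<^bsub>GL (LL \<iota>) n\<^esub> (map_mat (\<lambda>a. LL_tensor \<iota> a 1) \<Psi>)
       \<otimes>\<^bsub>GL (LL \<iota>) n\<^esub> map_mat (\<lambda>a. LL_tensor \<iota> 1 a) \<Psi>"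

definition galois_ideal ::
    "('a::{field,finite} fls alg_closure \<Rightarrow> 'c::{field,complete_space}) \<Rightarrow> nat \<Rightarrow> 'c fls mat \<Rightarrow>
     ((gl_var \<Rightarrow>\<^sub>0 nat) \<Rightarrow>\<^sub>0 'c fls) set" where
  "galois_ideal \<iota> n \<Psi> = {f \<in> gl_polys (carrier (Fqt \<iota>)) n.
     gl_eval (LL \<iota>) (\<lambda>c. LL_tensor \<iota> c 1) n (Psi_tilde \<iota> n \<Psi>) f = \<zero>\<^bsub>LL \<iota>\<^esub>}"

text \<open>
  The \<open>R\<close>-points of the closed subscheme of \<open>GL\<^sub>n\<close> defined by this ideal, for an
  \<open>F\<^sub>q(t)\<close>-algebra \<open>R\<close> with structure map \<open>h\<close>.
\<close>

definition motivic_galois_points ::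
    "('a::{field,finite} fls alg_closure \<Rightarrow> 'c::{field,complete_space}) \<Rightarrow> nat \<Rightarrow> 'c fls mat \<Rightarrow>
     ('r, 'm) ring_scheme \<Rightarrow> ('c fls \<Rightarrow> 'r) \<Rightarrow> 'r mat set" where
  "motivic_galois_points \<iota> n \<Psi> R h =
     {A \<in> carrier (GL R n). \<forall>f\<in>galois_ideal \<iota> n \<Psi>. gl_eval R h n A f = \<zero>\<^bsub>R\<^esub>}"

text \<open>
  The \<open>k\<close>-th prolongation \<open>\<rho>\<^sub>kC\<close> of the Carlitz module has \<open>t\<close>-action \<open>N + 1\<tau>\<close>, where
  \<open>t - N = \<rho>(t - \<theta>)\<close> is the matrix \<^term>\<open>rho k (fls_X - fls_const (theta \<iota>))\<close> of \<open>\<sigma>\<close> on its dual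
  \<open>t\<close>-motive. The trivialization \<^const>\<open>Psi\<close> solves \<open>\<sigma>(\<Psi>) = (t - N) \<Psi>\<close>, as
  \<open>\<omega> = (t - \<theta>\<^sup>1\<^sup>/\<^sup>q) \<sigma>(\<omega>)\<close>.
\<close>

definition Gamma_prolongation ::
    "('a::{field,finite} fls alg_closure \<Rightarrow> 'c::{field,complete_space}) \<Rightarrow> 'c \<Rightarrow> nat \<Rightarrow>
     ('r, 'm) ring_scheme \<Rightarrow> ('c fls \<Rightarrow> 'r) \<Rightarrow> 'r mat set" where
  "Gamma_prolongation \<iota> \<eta> k = motivic_galois_points \<iota> (k + 1) (Psi \<iota> \<eta> k)"

end

theory Submission
  imports
    Defs
    "HOL-Library.Multiset_Order"
    "Jordan_Normal_Form.Char_Poly"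
begin

text \<open>
  The matrix \<open>\<Psi>\<inverse>\<close> is the upper triangular Toeplitz matrix of the hyperderivatives of
  \<open>\<Omega> = (t - \<theta>) \<omega>\<close>, so the entries of \<open>\<Psi>\<close> are the coefficients \<open>u\<^sub>j\<close> of an inverse power series and
  \<open>\<Psi>~\<close> is the Toeplitz matrix of \<open>\<Sum>\<^sub>i \<partial>\<^sup>(\<^sup>i\<^sup>)\<Omega> \<otimes> u\<^sub>j\<^sub>-\<^sub>i\<close>. These elements are an invertible linear change, over
  the right factor, of the \<open>\<partial>\<^sup>(\<^sup>i\<^sup>)\<Omega> \<otimes> 1\<close>; hence the theorem amounts to the algebraic independence of
  the hyperderivatives of \<open>\<Omega>\<close> over the rational functions.

  The coefficientwise Frobenius \<open>\<tau>\<close> satisfies \<open>\<tau> \<Omega> = b \<Omega>\<close> with \<open>b = t - \<theta>\<^sup>q\<close>, hence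
  \<open>\<tau>(\<partial>\<^sup>(\<^sup>j\<^sup>)\<Omega>) = b \<partial>\<^sup>(\<^sup>j\<^sup>)\<Omega> + \<partial>\<^sup>(\<^sup>j\<^sup>-\<^sup>1\<^sup>)\<Omega>\<close>. A monic algebraic relation with minimal leading monomial is
  therefore an eigenvector of the semilinear substitution \<open>Y\<^sub>j \<mapsto> b Y\<^sub>j + Y\<^sub>j\<^sub>-\<^sub>1\<close>. Comparing degrees in \<open>t\<close>,
  it is homogeneous; comparing poles along the orbit of \<open>\<theta>\<close> under Frobenius, its coefficients are
  fixed by \<open>\<tau>\<close> and it is invariant under \<open>Y\<^sub>j \<mapsto> Y\<^sub>j + x Y\<^sub>j\<^sub>-\<^sub>1\<close> for every \<open>x\<close>. Regarding \<open>(Y\<^sub>j)\<close> as the coefficients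
  of a polynomial in \<open>T\<close>, this substitution is multiplication by \<open>1 + x T\<close>, so over an algebraically
  closed field every point with \<open>Y\<^sub>0 \<noteq> 0\<close> lies in the orbit of a point \<open>(Y\<^sub>0, 0, 0, \<dots>)\<close>. The relation is
  thus a constant multiple of a power of \<open>Y\<^sub>0\<close>, and the constant vanishes because \<open>\<Omega> \<noteq> 0\<close>.
\<close>

section \<open>Polynomials in countably many variables\<close>

text \<open>Two obstacles shape the proof. In characteristic p the coefficients of the substitution
  may vanish in the field, and every p-th power is killed by derivations, so infinitesimal
  invariance says too little. Invariance is therefore obtained for every x at once, by showing that
  each coefficient of a polynomial in x is 0. It is then applied over the algebraic closure of the
  Laurent series, where the polynomial with coefficients \<open>y j\<close> splits. The second
  obstacle is the tensor ring, which is given only as a quotient of a monoid ring. Independence of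
  the tensors is tested by functionals: algebraic independence yields a linear map \<phi>, over the
  rational functions, with prescribed values on the monomials in the hyperderivatives of \<Omega>.
  The map sending \<open>a \<otimes> b\<close> to \<open>\<phi> a * b\<close> then evaluates
  polynomials in the entries of \<Psi>~, and a suitable \<phi> places them at any prescribed
  point.\<close>

definition peval :: "(nat multiset \<Rightarrow> 'e::comm_ring_1) \<Rightarrow> (nat \<Rightarrow> 'e) \<Rightarrow> 'e" where
  "peval c y = (\<Sum>m | c m \<noteq> 0. c m * (\<Prod>j\<in>#m. y j))"

lemma peval_superset:
  assumes "finite M" "{m. c m \<noteq> 0} \<subseteq> M"
  shows "peval c y = (\<Sum>m\<in>M. c m * (\<Prod>j\<in>#m. y j))"
  unfolding peval_def by (rule sum.mono_neutral_left) (use assms in auto)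

text \<open>Vanishing is assumed only at points without zero coordinates, since shift invariance
  later gives values only where \<open>y 0 \<noteq> 0\<close>. Fixing the other variables leaves a
  polynomial in variable \<open>n\<close> with infinitely many roots, so its coefficients vanish at
  all such points and have one variable less.\<close>

lemma peval_eq_0_imp_zero_bounded:
  fixes c :: "nat multiset \<Rightarrow> 'e::idom"
  assumes inf: "infinite (UNIV :: 'e set)"
  assumes "finite {m. c m \<noteq> 0}" "\<And>m. c m \<noteq> 0 \<Longrightarrow> set_mset m \<subseteq> {..<n}"
    and "\<And>y. (\<forall>j. y j \<noteq> 0) \<Longrightarrow> peval c y = 0"
  shows "c m = 0"
  using assms(2-)
proof (induction n arbitrary: c m)
  case 0
  have sub: "{m. c m \<noteq> 0} \<subseteq> {{#}}"
    using 0(2) by auto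
  have "peval c (\<lambda>_. 1) = c {#}"
    by (subst peval_superset[OF _ sub]) auto
  then have "c {#} = 0"
    using 0(3)[of "\<lambda>_. 1"] by simp
  then show ?case using sub by auto
next
  case (Suc n)
  define S where "S = {m. c m \<noteq> 0}"
  have fS: "finite S" using Suc.prems by (simp add: S_def)
  define r where "r = (\<lambda>m::nat multiset. filter_mset (\<lambda>j. j \<noteq> n) m)"
  \<comment> \<open>\<open>c' i\<close> is the coefficient of the \<open>i\<close>-th power of
    variable \<open>n\<close>. The value 0 on multisets containing \<open>n\<close> makes
    \<open>i\<close> the exact exponent, so that each monomial is counted once.\<close>
  define c' where "c' = (\<lambda>i m. if n \<in># m then 0 else c (m + replicate_mset i n))"
  have split: "m = r m + replicate_mset (count m n) n" for m
    unfolding r_def by (rule multiset_eqI) auto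
  have c'c: "c' (count m n) (r m) = c m" for m
  proof -
    have "n \<notin># r m" by (simp add: r_def)
    then show ?thesis using split[of m] by (simp add: c'_def)
  qed
  have inj: "inj_on (\<lambda>m. (count m n, r m)) S"
  proof (rule inj_onI)
    fix m m' assume "(count m n, r m) = (count m' n, r m')"
    then show "m = m'" using split[of m] split[of m'] by simp
  qed
  have supp: "{m. c' i m \<noteq> 0} \<subseteq> r ` S" for i
  proof
    fix m assume "m \<in> {m. c' i m \<noteq> 0}"
    then have m: "n \<notin># m" "c (m + replicate_mset i n) \<noteq> 0"
      by (auto simp: c'_def split: if_splits)
    have "r (m + replicate_mset i n) = m"
      unfolding r_def by (rule multiset_eqI) (use m in \<open>auto simp: not_in_iff\<close>)
    then show "m \<in> r ` S"
      using m(2) by (intro image_eqI[of _ _ "m + replicate_mset i n"]) (simp_all add: S_def)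
  qed
  have z: "peval (c' i) y = 0" if y: "\<forall>j. y j \<noteq> 0" for i y
  proof -
    define N where "N = Max (insert 0 ((\<lambda>m. count m n) ` S)) + 1"
    have N: "count m n < N" if "m \<in> S" for m
      unfolding N_def using that fS by (simp add: less_Suc_eq_le)
    define P where "P = (\<Sum>i<N. monom (peval (c' i) y) i)"
    have "poly P x = 0" if "x \<noteq> 0" for x
    proof -
      define y' where "y' = y(n := x)"
      have "0 = peval c y'"
        using Suc.prems(3)[of y'] y that by (simp add: y'_def fun_upd_def)
      also have "\<dots> = (\<Sum>m\<in>S. c m * (\<Prod>j\<in>#m. y' j))"
        by (simp add: peval_def S_def)
      also have "\<dots> = (\<Sum>m\<in>S. c' (count m n) (r m) * (\<Prod>j\<in>#r m. y j) * x ^ count m n)"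
      proof (rule sum.cong[OF refl])
        fix m assume "m \<in> S"
        have "(\<Prod>j\<in>#m. y' j) = (\<Prod>j\<in>#r m. y' j) * x ^ count m n"
          by (subst split[of m]) (simp add: y'_def)
        also have "(\<Prod>j\<in>#r m. y' j) = (\<Prod>j\<in>#r m. y j)"
          by (intro arg_cong[where f = prod_mset] image_mset_cong) (auto simp: y'_def r_def)
        finally show "c m * (\<Prod>j\<in>#m. y' j) = c' (count m n) (r m) * (\<Prod>j\<in>#r m. y j) * x ^ count m n"
          by (simp add: c'c)
      qed
      also have "\<dots> = (\<Sum>(i, m)\<in>(\<lambda>m. (count m n, r m)) ` S. c' i m * (\<Prod>j\<in>#m. y j) * x ^ i)"
        by (subst sum.reindex) (use inj in simp_all)
      also have "\<dots> = (\<Sum>(i, m)\<in>{..<N} \<times> r ` S. c' i m * (\<Prod>j\<in>#m. y j) * x ^ i)"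
      proof (rule sum.mono_neutral_left)
        have "c' i m = 0" if "(i, m) \<notin> (\<lambda>m. (count m n, r m)) ` S" for i m
        proof (rule ccontr)
          assume "c' i m \<noteq> 0"
          then have m: "n \<notin># m" "c (m + replicate_mset i n) \<noteq> 0"
            by (auto simp: c'_def split: if_splits)
          have "r (m + replicate_mset i n) = m"
            unfolding r_def by (rule multiset_eqI) (use m in \<open>auto simp: not_in_iff\<close>)
          moreover have "count (m + replicate_mset i n) n = i"
            using m by (simp add: not_in_iff)
          ultimately show False
            using that m by (force simp: S_def image_iff)
        qed
        then show "\<forall>i\<in>{..<N} \<times> r ` S - (\<lambda>m. (count m n, r m)) ` S. (case i of (i, m) \<Rightarrow> c' i m * (\<Prod>j\<in>#m. y j) * x ^ i) = 0"
          by auto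
      qed (use fS N in auto)
      also have "\<dots> = (\<Sum>i<N. \<Sum>m\<in>r ` S. c' i m * (\<Prod>j\<in>#m. y j) * x ^ i)"
        by (simp add: sum.cartesian_product)
      also have "\<dots> = (\<Sum>i<N. peval (c' i) y * x ^ i)"
        using fS supp by (simp add: peval_superset[of "r ` S"] sum_distrib_right)
      also have "\<dots> = poly P x"
        by (simp add: P_def poly_sum poly_monom)
      finally show ?thesis by simp
    qed
    then have "- {0} \<subseteq> {x. poly P x = 0}" by auto
    moreover have "infinite (- {0 :: 'e})" using inf by (simp add: Compl_eq_Diff_UNIV)
    ultimately have "infinite {x. poly P x = 0}" using infinite_super by blast
    then have P0: "P = 0" using poly_roots_finite by blast
    show ?thesis
    proof (cases "i < N")
      case True
      have "coeff P i = peval (c' i) y"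
        using True by (simp add: P_def coeff_sum coeff_monom)
      then show ?thesis using P0 by simp
    next
      case False
      have "c' i m = 0" for m
      proof (rule ccontr)
        assume "c' i m \<noteq> 0"
        then have m: "n \<notin># m" "m + replicate_mset i n \<in> S"
          by (auto simp: c'_def S_def split: if_splits)
        then show False using N[OF m(2)] False by simp
      qed
      then show ?thesis by (simp add: peval_def)
    qed
  qed
  have "c' (count m n) (r m) = 0"
  proof (rule Suc.IH[OF _ _ z])
    show "finite {m'. c' (count m n) m' \<noteq> 0}"
      by (rule finite_subset[OF supp]) (use fS in simp)
  next
    fix m' assume "c' (count m n) m' \<noteq> 0"
    then have "n \<notin># m'" "c (m' + replicate_mset (count m n) n) \<noteq> 0"
      by (auto simp: c'_def split: if_splits)
    then show "set_mset m' \<subseteq> {..<n}"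
      using Suc.prems(2)[of "m' + replicate_mset (count m n) n"]
      by (auto simp: subset_iff less_Suc_eq)
  qed auto
  then show ?case
    by (simp add: c'c)
qed

lemma peval_eq_0_imp_zero:
  fixes c :: "nat multiset \<Rightarrow> 'e::idom"
  assumes "infinite (UNIV :: 'e set)" "finite {m. c m \<noteq> 0}"
    and "\<And>y. (\<forall>j. y j \<noteq> 0) \<Longrightarrow> peval c y = 0"
  shows "c m = 0"
proof -
  have "finite (\<Union>m\<in>{m. c m \<noteq> 0}. set_mset m)" using assms by auto
  then obtain n where "(\<Union>m\<in>{m. c m \<noteq> 0}. set_mset m) \<subseteq> {..<n}"
    using finite_nat_iff_bounded by blast
  then show ?thesis
    by (intro peval_eq_0_imp_zero_bounded[OF assms(1,2) _ assms(3), of n]) auto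
qed

text \<open>Expansion of a product of factors \<open>y j + x * y (j - 1)\<close>: each factor keeps
  its index or lowers it by one, and repetitions in the list record multiplicities. The index 0
  cannot be lowered because \<open>y (-1)\<close> is read as 0.\<close>

primrec substs :: "nat list \<Rightarrow> nat multiset list" where
  "substs [] = [{#}]"
| "substs (j # l) = map (add_mset j) (substs l) @ (if j = 0 then [] else map (add_mset (j - 1)) (substs l))"

abbreviation shift :: "(nat \<Rightarrow> 'e::zero) \<Rightarrow> nat \<Rightarrow> 'e" where
  "shift y j \<equiv> (if j = 0 then 0 else y (j - 1))"

text \<open>Lowering indices lowers the monomial in the multiset order, keeps its degree and drops
  its index sum. These three facts make the substitution triangular, make it respect homogeneous
  parts, and give the exponent of \<open>x\<close>.\<close>

lemma substs_mem:
  "m \<in> set (substs l) \<Longrightarrow> m \<noteq> mset l \<Longrightarrow> m < mset l \<and> size m = length l \<and> sum_mset m < sum_list l"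
proof (induction l arbitrary: m)
  case (Cons j l)
  consider m' where "m' \<in> set (substs l)" "m = add_mset j m'"
    | m' where "m' \<in> set (substs l)" "m = add_mset (j - 1) m'" "j \<noteq> 0"
    using Cons.prems by (auto split: if_splits)
  then show ?case
  proof cases
    case 1
    then show ?thesis using Cons by auto
  next
    case 2
    have "m' \<le> mset l \<and> size m' = length l \<and> sum_mset m' \<le> sum_list l"
      using Cons.IH[of m'] 2 by (cases "m' = mset l") (auto simp: sum_mset_sum_list)
    then show ?thesis using 2 by (auto intro: add_mset_lt_lt_le)
  qed
qed auto

text \<open>Leaving every index alone is the only choice that returns the original monomial, because
  any lowering makes it strictly smaller. The substitution is thus unipotent.\<close>

lemma count_substs: "count_list (substs l) (mset l) = 1"
proof (induction l)
  case (Cons j l)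
  have "count_list (map (add_mset j) (substs l)) (add_mset j (mset l)) = count_list (substs l) (mset l)"
    by (induction "substs l" rule: list.induct) (auto simp: count_list_map_conv inj_def)
  moreover have "count_list (map (add_mset (j - 1)) (substs l)) (add_mset j (mset l)) = 0" if "j \<noteq> 0"
  proof (rule count_notin, rule notI)
    assume "add_mset j (mset l) \<in> set (map (add_mset (j - 1)) (substs l))"
    then obtain m' where m': "m' \<in> set (substs l)" "add_mset j (mset l) = add_mset (j - 1) m'" by auto
    have "m' \<le> mset l"
      using substs_mem[OF m'(1)] by (cases "m' = mset l") auto
    then have "add_mset (j - 1) m' < add_mset j (mset l)"
      using that by (intro add_mset_lt_lt_le) simp_all
    then show False using m' by simp
  qed
  ultimately show ?case using Cons.IH by auto
qed simp

text \<open>The exponent of \<open>x\<close> counts the lowered indices, which is the drop of the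
  index sum; the subtraction is never truncated.\<close>

lemma prod_list_substs:
  fixes y :: "nat \<Rightarrow> 'e::comm_ring_1"
  shows "(\<Prod>j\<leftarrow>l. y j + x * shift y j) =
    (\<Sum>m\<leftarrow>substs l. x ^ (sum_list l - sum_mset m) * (\<Prod>j\<in>#m. y j))"
proof (induction l)
  case (Cons j l)
  have le: "sum_mset m \<le> sum_list l" if "m \<in> set (substs l)" for m
    using substs_mem[OF that] by (cases "m = mset l") (auto simp: sum_mset_sum_list)
  have "(\<Sum>m\<leftarrow>map (add_mset j) (substs l). x ^ (sum_list (j # l) - sum_mset m) * (\<Prod>j\<in>#m. y j)) =
        (\<Sum>m\<leftarrow>substs l. y j * (x ^ (sum_list l - sum_mset m) * (\<Prod>j\<in>#m. y j)))"
    by (simp add: o_def mult_ac cong: map_cong)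
  moreover have "(\<Sum>m\<leftarrow>map (add_mset (j-1)) (substs l). x ^ (sum_list (j # l) - sum_mset m) * (\<Prod>j\<in>#m. y j)) =
        (\<Sum>m\<leftarrow>substs l. x * y (j-1) * (x ^ (sum_list l - sum_mset m) * (\<Prod>j\<in>#m. y j)))" if "j \<noteq> 0"
  proof -
    have "sum_list (j # l) - sum_mset (add_mset (j-1) m) = Suc (sum_list l - sum_mset m)"
      if "m \<in> set (substs l)" for m using le[OF that] \<open>j \<noteq> 0\<close> by simp
    then show ?thesis by (simp add: o_def mult_ac cong: map_cong)
  qed
  ultimately show ?case
    by (simp add: Cons.IH sum_list_const_mult distrib_right)
qed simp

text \<open>Matrix entry of the substitution on monomials; sorting merely selects a list that
  represents the multiset. It is a natural number, whose image in a field of characteristic p can be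
  0.\<close>

definition subst_count :: "nat multiset \<Rightarrow> nat multiset \<Rightarrow> nat" where
  "subst_count m m' = count_list (substs (sorted_list_of_multiset m)) m'"

lemma finite_subst_count: "finite {m'. subst_count m m' \<noteq> 0}"
  by (rule finite_subset[of _ "set (substs (sorted_list_of_multiset m))"])
     (auto simp: subst_count_def count_list_0_iff)

lemma subst_count_same [simp]: "subst_count m m = 1"
  using count_substs[of "sorted_list_of_multiset m"] by (simp add: subst_count_def)

lemma subst_count_less:
  assumes "subst_count m m' \<noteq> 0" "m' \<noteq> m"
  shows "m' < m" "size m' = size m" "sum_mset m' < sum_mset m"
proof -
  have "m' \<in> set (substs (sorted_list_of_multiset m))"
    using assms(1) by (auto simp: subst_count_def count_list_0_iff)
  moreover have "sum_list (sorted_list_of_multiset m) = sum_mset m" "length (sorted_list_of_multiset m) = size m"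
    by (metis mset_sorted_list_of_multiset sum_mset_sum_list, metis mset_sorted_list_of_multiset size_mset)
  ultimately show "m' < m" "size m' = size m" "sum_mset m' < sum_mset m"
    using substs_mem[of m' "sorted_list_of_multiset m"] assms(2) by auto
qed

text \<open>\<open>M\<close> may be any finite set containing the support, so that one
  \<open>M\<close> serves all monomials of a relation and the double sum can be exchanged.\<close>

lemma prod_mset_subst:
  fixes y :: "nat \<Rightarrow> 'e::comm_ring_1"
  assumes "finite M" "{m'. subst_count m m' \<noteq> 0} \<subseteq> M"
  shows "(\<Prod>j\<in>#m. y j + x * shift y j) =
    (\<Sum>m'\<in>M. of_nat (subst_count m m') * x ^ (sum_mset m - sum_mset m') * (\<Prod>j\<in>#m'. y j))"
proof -
  define l where "l = sorted_list_of_multiset m"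
  have m: "m = mset l" by (simp add: l_def)
  have count: "(\<Sum>m\<leftarrow>L. f m) = (\<Sum>m\<in>set L. of_nat (count_list L m) * f m)" for L and f :: "nat multiset \<Rightarrow> 'e"
  proof (induction L)
    case (Cons a L)
    have "(\<Sum>m\<in>set (a # L). of_nat (count_list (a # L) m) * f m)
        = (\<Sum>m\<in>insert a (set L). of_nat (count_list L m) * f m + (if m = a then f a else 0))"
      by (intro sum.cong) (auto simp: algebra_simps)
    also have "\<dots> = (\<Sum>m\<in>insert a (set L). of_nat (count_list L m) * f m) + f a"
      by (subst sum.distrib) simp
    also have "(\<Sum>m\<in>insert a (set L). of_nat (count_list L m) * f m) = (\<Sum>m\<in>set L. of_nat (count_list L m) * f m)"
      by (rule sum.mono_neutral_right) auto
    finally show ?case using Cons by simp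
  qed simp
  have "(\<Prod>j\<in>#m. y j + x * shift y j) = (\<Prod>j\<leftarrow>l. y j + x * shift y j)"
    unfolding m by (simp flip: prod_mset_prod_list)
  also have "\<dots> = (\<Sum>m'\<in>set (substs l). of_nat (subst_count m m') * x ^ (sum_mset m - sum_mset m') * (\<Prod>j\<in>#m'. y j))"
    unfolding prod_list_substs count
    by (simp add: subst_count_def mult_ac flip: l_def) (simp add: m sum_mset_sum_list)
  also have "\<dots> = (\<Sum>m'\<in>M. of_nat (subst_count m m') * x ^ (sum_mset m - sum_mset m') * (\<Prod>j\<in>#m'. y j))"
    by (rule sum.mono_neutral_cong)
       (use assms in \<open>auto simp: subst_count_def count_list_0_iff simp flip: l_def\<close>)
  finally show ?thesis .
qed

section \<open>Hyperderivatives and rational functions\<close>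

lemma int_choose_0 [simp]: "int_choose i 0 = 1"
  by (simp add: int_choose_def)

lemma int_choose_Suc_Suc: "int_choose (i + 1) (Suc n) = int_choose i n + int_choose i (Suc n)"
  using gbinomial_int_Suc_Suc[of i n]
  by (simp add: int_choose_def gbinomial_prod_rev lessThan_atLeast0)

lemma hyperderiv_nth [simp]:
  "fls_nth (hyperderiv n f) i = of_int (int_choose (i + int n) n) * fls_nth f (i + int n)"
  by transfer simp

lemma hyperderiv_0 [simp]: "hyperderiv 0 f = f"
  by (intro fls_eqI) simp

text \<open>Leibniz rule for a linear factor, whose hyperderivatives of order above one vanish; on
  coefficients it is Pascal's rule. It is applied to \<open>b\<close>, for the action of Frobenius,
  and to \<open>t - \<theta>\<close>, for the shape of \<open>Psi\<close>.\<close>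

lemma hyperderiv_linear_mult:
  fixes f :: "'c::comm_ring_1 fls"
  shows "hyperderiv n ((fls_X - fls_const z) * f) =
    (fls_X - fls_const z) * hyperderiv n f + shift (\<lambda>j. hyperderiv j f) n"
proof (cases n)
  case (Suc m)
  have "of_int (int_choose (i + (1 + int m)) (Suc m)) =
      of_int (int_choose (i + int m) m) + (of_int (int_choose (i + int m) (Suc m)) :: 'c)" for i
    using int_choose_Suc_Suc[of "i + int m" m] by (simp add: add_ac flip: of_int_add)
  then show ?thesis
    unfolding Suc
    by (intro fls_eqI) (simp add: left_diff_distrib fls_X_times_conv_shift algebra_simps)
qed simp

section \<open>Rational functions as a subfield of the Laurent series\<close>

abbreviation poly_fls :: "'c::field poly \<Rightarrow> 'c fls" where
  "poly_fls p \<equiv> fps_to_fls (fps_of_poly p)"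

interpretation poly_fls: inj_idom_hom "poly_fls :: 'c::field poly \<Rightarrow> 'c fls"
  by unfold_locales
     (auto simp: fps_of_poly_add fps_of_poly_mult fls_times_fps_to_fls)

lemma poly_fls_linear: "poly_fls [:- z, 1:] = fls_X - fls_const z"
  by (intro fls_eqI) (auto simp: coeff_pCons split: nat.splits)

lemma rat_funsI: "q \<noteq> 0 \<Longrightarrow> poly_fls p / poly_fls q \<in> rat_funs UNIV"
  unfolding rat_funs_def by blast

lemma rat_funs_polyI: "poly_fls p \<in> rat_funs UNIV"
  using rat_funsI[of 1 p] by simp

lemma rat_funsE:
  assumes "h \<in> rat_funs UNIV"
  obtains p q where "q \<noteq> 0" "h * poly_fls q = poly_fls p"
  using assms unfolding rat_funs_def by (auto simp: field_simps)

text \<open>With the denominator cleared, closure properties become identities between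
  polynomials.\<close>

lemma rat_fun_iff: "h \<in> rat_funs UNIV \<longleftrightarrow> (\<exists>p q. q \<noteq> 0 \<and> h * poly_fls q = poly_fls p)"
proof
  assume "\<exists>p q. q \<noteq> 0 \<and> h * poly_fls q = poly_fls p"
  then obtain p q where "q \<noteq> 0" "h * poly_fls q = poly_fls p" by blast
  then have "h = poly_fls p / poly_fls q" by (simp add: field_simps)
  then show "h \<in> rat_funs UNIV" using rat_funsI \<open>q \<noteq> 0\<close> by blast
qed (blast elim: rat_funsE)

lemma rat_funs_UNIV_subfield:
  fixes x y :: "'c::field fls"
  shows rat_funs_0: "(0 :: 'c fls) \<in> rat_funs UNIV" and rat_funs_1: "(1 :: 'c fls) \<in> rat_funs UNIV"
    and rat_funs_add: "x \<in> rat_funs UNIV \<Longrightarrow> y \<in> rat_funs UNIV \<Longrightarrow> x + y \<in> rat_funs UNIV"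
    and rat_funs_mult: "x \<in> rat_funs UNIV \<Longrightarrow> y \<in> rat_funs UNIV \<Longrightarrow> x * y \<in> rat_funs UNIV"
    and rat_funs_diff: "x \<in> rat_funs UNIV \<Longrightarrow> y \<in> rat_funs UNIV \<Longrightarrow> x - y \<in> rat_funs UNIV"
    and rat_funs_inverse: "x \<in> rat_funs UNIV \<Longrightarrow> inverse x \<in> rat_funs UNIV"
proof -
  show 0: "(0 :: 'c fls) \<in> rat_funs UNIV" and "(1 :: 'c fls) \<in> rat_funs UNIV"
    using rat_funs_polyI[of 0] rat_funs_polyI[of 1] by auto
  show "inverse x \<in> rat_funs UNIV" if x: "x \<in> rat_funs UNIV"
  proof (cases "x = 0")
    case False
    obtain p q where "q \<noteq> 0" "x * poly_fls q = poly_fls p" using x by (rule rat_funsE)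
    with False have "p \<noteq> 0" "inverse x * poly_fls p = poly_fls q" by (auto simp: field_simps)
    then show ?thesis unfolding rat_fun_iff by blast
  qed (simp add: 0)
  assume "x \<in> rat_funs UNIV" "y \<in> rat_funs UNIV"
  then obtain p q p' q' where xy: "q \<noteq> 0" "x * poly_fls q = poly_fls p"
    "q' \<noteq> 0" "y * poly_fls q' = poly_fls p'" by (meson rat_funsE)
  have "(x + y) * poly_fls (q * q') = poly_fls (p * q' + p' * q)"
    "(x - y) * poly_fls (q * q') = poly_fls (p * q' - p' * q)"
    "x * y * poly_fls (q * q') = poly_fls (p * p')"
    by (simp_all only: poly_fls.hom_mult poly_fls.hom_add poly_fls.hom_minus flip: xy(2,4)) (simp_all only: algebra_simps)
  moreover have "q * q' \<noteq> 0" using xy by simp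
  ultimately show "x + y \<in> rat_funs UNIV" "x - y \<in> rat_funs UNIV" "x * y \<in> rat_funs UNIV"
    unfolding rat_fun_iff by blast+
qed

lemma rat_funs_power: "x \<in> rat_funs UNIV \<Longrightarrow> x ^ n \<in> rat_funs UNIV"
  by (induction n) (auto intro: rat_funs_1 rat_funs_mult)

lemma rat_funs_of_nat: "of_nat n \<in> rat_funs UNIV"
  by (induction n) (auto intro: rat_funs_0 rat_funs_1 rat_funs_add)

lemma rat_funs_sum: "(\<And>i. i \<in> A \<Longrightarrow> f i \<in> rat_funs UNIV) \<Longrightarrow> sum f A \<in> rat_funs UNIV"
  by (induction A rule: infinite_finite_induct) (auto intro: rat_funs_0 rat_funs_add)

text \<open>Lowest terms come from a denominator of least degree: a common root could be cancelled,
  and the remainder of any other denominator modulo this one is again a denominator unless it is 0.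
  Making it monic determines it uniquely.\<close>

lemma rat_fun_reduced:
  assumes "h \<in> rat_funs UNIV"
  obtains A B where "lead_coeff B = 1" "h * poly_fls B = poly_fls A"
    "\<And>x. poly A x \<noteq> 0 \<or> poly B x \<noteq> 0"
    "\<And>A' B'. h * poly_fls B' = poly_fls A' \<Longrightarrow> B dvd B'"
proof -
  let ?P = "\<lambda>B. B \<noteq> 0 \<and> (\<exists>A. h * poly_fls B = poly_fls A)"
  obtain B0 where B0: "?P B0" and min: "\<And>B. ?P B \<Longrightarrow> degree B0 \<le> degree B"
    using exists_least_iff[of "\<lambda>d. \<exists>B. ?P B \<and> degree B = d"] rat_funsE[OF assms]
    by (metis (no_types, lifting) not_le)
  define B where "B = smult (inverse (lead_coeff B0)) B0"
  have B: "lead_coeff B = 1" "B \<noteq> 0" "degree B = degree B0" using B0 by (auto simp: B_def)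
  obtain A0 where A0: "h * poly_fls B0 = poly_fls A0" using B0 by blast
  define A where "A = smult (inverse (lead_coeff B0)) A0"
  have AB: "h * poly_fls B = poly_fls A"
    by (simp add: A_def B_def fps_of_poly_smult fls_times_fps_to_fls flip: A0)
  show ?thesis
  proof (rule that[OF B(1) AB])
    fix x show "poly A x \<noteq> 0 \<or> poly B x \<noteq> 0"
    proof (rule ccontr)
      assume "\<not> ?thesis"
      then obtain A1 B1 where *: "A = [:-x, 1:] * A1" "B = [:-x, 1:] * B1"
        by (auto simp: poly_eq_0_iff_dvd elim!: dvdE)
      have "poly_fls [:-x, 1:] * (h * poly_fls B1) = poly_fls [:-x, 1:] * poly_fls A1"
        using AB unfolding * by (simp only: poly_fls.hom_mult mult_ac)
      moreover have "poly_fls [:-x, 1:] \<noteq> 0" by simp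
      ultimately have "h * poly_fls B1 = poly_fls A1" by simp
      moreover have "B1 \<noteq> 0" using B(2) * by auto
      ultimately have "degree B0 \<le> degree B1" using min by blast
      moreover have "degree B = Suc (degree B1)"
        using \<open>B1 \<noteq> 0\<close> unfolding *(2) by (subst degree_mult_eq) auto
      ultimately show False using B(3) by simp
    qed
  next
    fix A' B' assume *: "h * poly_fls B' = poly_fls A'"
    have "B' mod B = 0"
    proof (rule ccontr)
      assume nz: "B' mod B \<noteq> 0"
      have "h * poly_fls (B' mod B) = h * poly_fls B' - poly_fls (B' div B) * (h * poly_fls B)"
        by (simp add: algebra_simps flip: minus_mult_div_eq_mod poly_fls.hom_mult poly_fls.hom_minus)
           (simp add: poly_fls.hom_minus poly_fls.hom_mult algebra_simps)
      also have "\<dots> = poly_fls (A' - B' div B * A)"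
        by (simp only: * AB poly_fls.hom_mult poly_fls.hom_minus)
      finally have "degree B0 \<le> degree (B' mod B)" using min nz by blast
      then show False using degree_mod_less[of B B'] B nz by auto
    qed
    then show "B dvd B'" by (rule mod_0_imp_dvd)
  qed
qed

text \<open>Abstracts the orbit of \<open>\<theta>\<close> under the \<open>q\<close>-Frobenius
  \<open>s\<close>. The chain is two-sided because poles are followed forwards and backwards; it
  will consist of the \<open>\<theta>^(q^i)\<close>, with chosen iterated \<open>q\<close>-th roots
  for negative \<open>i\<close>.\<close>

locale frob_chain = field_hom s for s :: "'c::field \<Rightarrow> 'c" +
  fixes \<zeta> :: "int \<Rightarrow> 'c"
  assumes inj_zeta: "inj \<zeta>" and s_zeta: "s (\<zeta> i) = \<zeta> (i + 1)"
begin

text \<open>When \<open>s\<close> is the \<open>q\<close>-power map, this is the inverse of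
  sigma.\<close>

definition tau :: "'c fls \<Rightarrow> 'c fls" where
  "tau f = Abs_fls (\<lambda>n. s (fls_nth f n))"

lemma tau_nth [simp]: "fls_nth (tau f) n = s (fls_nth f n)"
  unfolding tau_def by (rule nth_Abs_fls_lower_bound[of "fls_subdegree f"]) simp

lemma tau_mult: "tau (f * g) = tau f * tau g"
proof -
  have sub: "fls_subdegree (tau f) = fls_subdegree f" for f
  proof (cases "f = 0")
    case True
    then have "tau f = 0" by (intro fls_eqI) simp
    then show ?thesis using True by simp
  next
    case False
    then show ?thesis by (intro fls_subdegree_eqI) auto
  qed
  show ?thesis
    by (intro fls_eqI) (simp add: fls_times_nth(1) sub hom_distribs)
qed

sublocale tau: field_hom tau
  by unfold_locales (auto intro!: fls_eqI simp: hom_add tau_mult)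

interpretation map_poly: map_poly_inj_idom_hom s ..

abbreviation ptau :: "'c poly \<Rightarrow> 'c poly" where
  "ptau \<equiv> map_poly s"

lemma tau_poly_fls [simp]: "tau (poly_fls p) = poly_fls (ptau p)"
  by (intro fls_eqI) simp

lemma tau_hyperderiv: "tau (hyperderiv n f) = hyperderiv n (tau f)"
  by (intro fls_eqI) (simp add: hom_distribs)

lemma tau_rat_funs: "h \<in> rat_funs UNIV \<Longrightarrow> tau h \<in> rat_funs UNIV"
proof -
  assume "h \<in> rat_funs UNIV"
  then obtain p q where "q \<noteq> 0" "h * poly_fls q = poly_fls p" by (rule rat_funsE)
  then have "tau h * poly_fls (ptau q) = poly_fls (ptau p)" "ptau q \<noteq> 0"
    by (metis tau.hom_mult tau_poly_fls) (use \<open>q \<noteq> 0\<close> in auto)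
  then show ?thesis unfolding rat_fun_iff by blast
qed

definition b :: "'c fls" where "b = fls_X - fls_const (\<zeta> 1)"

lemma b_poly: "b = poly_fls [:- \<zeta> 1, 1:]"
  unfolding b_def poly_fls_linear ..

lemma b_nonzero [simp]: "b \<noteq> 0"
  unfolding b_poly by simp

lemma b_rat: "b \<in> rat_funs UNIV"
  unfolding b_poly by (rule rat_funs_polyI)

text \<open>\<open>s\<close> maps a root of a \<open>ptau\<close>-fixed polynomial to a root, so one
  root on the injective chain forces infinitely many.\<close>

lemma fixed_poly_nonzero:
  assumes "ptau G = G" "poly G (\<zeta> i) = 0"
  shows "G = 0"
proof (rule ccontr)
  assume "G \<noteq> 0"
  have "poly G (\<zeta> (i + int n)) = 0" for n
  proof (induction n)
    case (Suc n)
    have "poly (ptau G) (s (\<zeta> (i + int n))) = 0" unfolding poly_map_poly using Suc by simp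
    then show ?case using assms(1) by (simp add: s_zeta add_ac)
  qed (use assms in simp)
  then have "range (\<lambda>n. \<zeta> (i + int n)) \<subseteq> {x. poly G x = 0}" by auto
  moreover have "infinite (range (\<lambda>n. \<zeta> (i + int n)))"
    by (intro range_inj_infinite injI) (simp add: inj_eq[OF inj_zeta])
  ultimately show False using poly_roots_finite[OF \<open>G \<noteq> 0\<close>] infinite_super by blast
qed

text \<open>The valuation of a rational function at infinity is invariant under \<open>tau\<close>.\<close>
lemma twisted_fixed_degree:
  assumes "h \<in> rat_funs UNIV" "h \<noteq> 0" "b ^ i * tau h = b ^ d * h"
  shows "i = d"
proof -
  obtain A B where AB: "B \<noteq> 0" "h * poly_fls B = poly_fls A" using assms(1) by (rule rat_funsE)
  then have A: "A \<noteq> 0" using assms(2) by auto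
  have tau: "tau h * poly_fls (ptau B) = poly_fls (ptau A)" using AB(2) by (metis tau.hom_mult tau_poly_fls)
  let ?b = "[:- \<zeta> 1, 1:]"
  have "b ^ i * (tau h * poly_fls (ptau B)) * poly_fls B = b ^ d * (h * poly_fls B) * poly_fls (ptau B)"
    using assms(3) by (simp add: mult_ac)
  then have "poly_fls (?b ^ i * ptau A * B) = poly_fls (?b ^ d * A * ptau B)"
    unfolding tau AB(2) b_poly by (simp only: poly_fls.hom_mult poly_fls.hom_power)
  then have "?b ^ i * ptau A * B = ?b ^ d * A * ptau B" by simp
  then have "degree (?b ^ i * ptau A * B) = degree (?b ^ d * A * ptau B)" by simp
  moreover have "degree (?b ^ n) = n" "?b ^ n \<noteq> 0" for n by (simp_all add: degree_linear_power)
  moreover have "ptau A \<noteq> 0" "ptau B \<noteq> 0" using A AB(1) by auto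
  ultimately show ?thesis using A AB(1) by (simp add: degree_mult_eq)
qed

text \<open>The monic denominator of least degree divides its image under \<open>ptau\<close>, which
  is also a denominator; degree and leading coefficient agree, so it is fixed, and then so is the
  numerator.\<close>

lemma fixed_rat_fun:
  assumes "h \<in> rat_funs UNIV" "tau h = h"
  obtains G H where "H \<noteq> 0" "ptau H = H" "ptau G = G" "h * poly_fls H = poly_fls G"
proof -
  obtain A B where AB: "lead_coeff B = 1" "h * poly_fls B = poly_fls A"
    and min: "\<And>A' B'. h * poly_fls B' = poly_fls A' \<Longrightarrow> B dvd B'"
    using rat_fun_reduced[OF assms(1)] by metis
  have tau: "h * poly_fls (ptau B) = poly_fls (ptau A)" using AB(2) assms(2) by (metis tau.hom_mult tau_poly_fls)
  then obtain Q where Q: "ptau B = B * Q" using min by (meson dvdE)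
  have B: "B \<noteq> 0" "ptau B \<noteq> 0" using AB(1) by auto
  then have "Q \<noteq> 0" using Q by auto
  have "degree (ptau B) = degree B" by simp
  then have "degree Q = 0" using B \<open>Q \<noteq> 0\<close> unfolding Q by (simp add: degree_mult_eq)
  then obtain c where c: "Q = [:c:]" by (rule degree_eq_zeroE)
  have "lead_coeff (ptau B) = 1" using AB(1) by simp
  then have "c = 1" using AB(1) unfolding Q c by (cases "c = 0") auto
  then have "ptau B = B" using Q c by simp
  moreover then have "ptau A = A" using tau AB(2) by simp
  ultimately show ?thesis using that B AB by blast
qed

text \<open>Poles of \<open>h\<close> along the chain \<open>\<zeta>\<close> would have to start at \<open>\<zeta>\<^sub>1\<close> and to end at \<open>\<zeta>\<^sub>0\<close>.\<close>
lemma telescoper_nonzero: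
  assumes h: "h \<in> rat_funs UNIV"
    and \<gamma>: "\<And>i. \<gamma> i \<in> rat_funs UNIV" "\<And>i. tau (\<gamma> i) = \<gamma> i"
    and eq: "h - tau h = (\<Sum>i=1..m. \<gamma> i * inverse b ^ i)" and "m \<ge> 1"
  shows "\<gamma> m = 0"
proof (rule ccontr)
  assume nz: "\<gamma> m \<noteq> 0"
  obtain G H where GH: "\<And>i. H i \<noteq> 0" "\<And>i. ptau (H i) = H i" "\<And>i. ptau (G i) = G i"
    "\<And>i. \<gamma> i * poly_fls (H i) = poly_fls (G i)"
  proof -
    have "\<forall>i. \<exists>G H. H \<noteq> 0 \<and> ptau H = H \<and> ptau G = G \<and> \<gamma> i * poly_fls H = poly_fls G"
      using fixed_rat_fun[OF \<gamma>] by metis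
    then show ?thesis using that by metis
  qed
  \<comment> \<open>Common denominator of the \<open>\<gamma> i\<close>, with numerators
    \<open>E i\<close>. Both are \<open>ptau\<close>-fixed, so \<open>D\<close> has no zero on the
    chain, and \<open>E m\<close> has one only if it is 0.\<close>
  define D where "D = (\<Prod>i=1..m. H i)"
  define E where "E i = G i * (\<Prod>j\<in>{1..m} - {i}. H j)" for i
  have D: "D \<noteq> 0" "ptau D = D" using GH by (auto simp: D_def map_poly.hom_prod)
  have E: "ptau (E i) = E i" for i using GH by (simp add: E_def map_poly.hom_prod map_poly.hom_mult)
  have \<gamma>D: "\<gamma> i * poly_fls D = poly_fls (E i)" if "i \<in> {1..m}" for i
  proof -
    have "D = H i * (\<Prod>j\<in>{1..m} - {i}. H j)" unfolding D_def by (rule prod.remove) (use that in auto)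
    then show ?thesis
      by (simp only: E_def poly_fls.hom_mult mult.assoc [symmetric] GH(4))
  qed
  obtain A B where B: "lead_coeff B = 1" and AB: "h * poly_fls B = poly_fls A"
    and cop: "\<And>x. poly A x \<noteq> 0 \<or> poly B x \<noteq> 0"
    using rat_fun_reduced[OF h] by metis
  have B0: "B \<noteq> 0" using B by auto
  have tAB: "tau h * poly_fls (ptau B) = poly_fls (ptau A)" using AB by (metis tau.hom_mult tau_poly_fls)
  let ?b = "[:- \<zeta> 1, 1:]"
  define S where "S = (\<Sum>i=1..m. E i * ?b ^ (m - i))"
  have "b ^ m * poly_fls D * (h - tau h) = (\<Sum>i=1..m. (\<gamma> i * poly_fls D) * b ^ (m - i))"
    unfolding eq sum_distrib_left
  proof (rule sum.cong[OF refl])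
    fix i assume "i \<in> {1..m}"
    then have "b ^ m = b ^ (m - i) * b ^ i" by (simp flip: power_add)
    then show "b ^ m * poly_fls D * (\<gamma> i * inverse b ^ i) = \<gamma> i * poly_fls D * b ^ (m - i)"
      by (simp add: field_simps)
  qed
  also have "\<dots> = poly_fls S"
    unfolding S_def poly_fls.hom_sum b_poly
    by (intro sum.cong) (simp_all only: \<gamma>D poly_fls.hom_mult poly_fls.hom_power)
  finally have "b ^ m * poly_fls D * ((h * poly_fls B) * poly_fls (ptau B) - (tau h * poly_fls (ptau B)) * poly_fls B) =
      poly_fls B * poly_fls (ptau B) * poly_fls S"
    by (metis (no_types, opaque_lifting) left_diff_distrib mult.assoc mult.commute)
  then have "poly_fls (?b ^ m * D * (A * ptau B - ptau A * B)) = poly_fls (B * ptau B * S)"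
    unfolding AB tAB b_poly by (simp only: poly_fls.hom_mult poly_fls.hom_power poly_fls.hom_minus)
  then have id: "?b ^ m * D * (A * ptau B - ptau A * B) = B * ptau B * S" by simp
  have Dz: "poly D (\<zeta> i) \<noteq> 0" for i using fixed_poly_nonzero[OF D(2)] D(1) by blast
  have tz: "poly (ptau P) (\<zeta> i) = s (poly P (\<zeta> (i - 1)))" for P i
    using poly_map_poly[of P "\<zeta> (i - 1)"] by (simp add: s_zeta)
  have bz: "poly ?b (\<zeta> i) = 0 \<longleftrightarrow> i = 1" for i using inj_zeta by (auto simp: inj_eq)
  define Z where "Z = {i. poly B (\<zeta> i) = 0}"
  have "\<zeta> ` Z \<subseteq> {x. poly B x = 0}" by (auto simp: Z_def)
  then have finZ: "finite Z"
    using poly_roots_finite[OF B0] inj_zeta by (meson finite_imageD finite_subset inj_on_subset subset_UNIV)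
  have Z: "i \<in> Z \<longleftrightarrow> poly B (\<zeta> i) = 0" for i by (simp add: Z_def)
  have ev: "poly ?b (\<zeta> i) ^ m * poly D (\<zeta> i) * (poly A (\<zeta> i) * s (poly B (\<zeta> (i-1))) - s (poly A (\<zeta> (i-1))) * poly B (\<zeta> i))
      = poly B (\<zeta> i) * s (poly B (\<zeta> (i-1))) * poly S (\<zeta> i)" for i
    using arg_cong[OF id, of "\<lambda>p. poly p (\<zeta> i)"] unfolding poly_mult poly_diff poly_power tz .
  have "Z = {}"
  proof (rule ccontr)
    assume "Z \<noteq> {}"
    \<comment> \<open>At the last pole \<open>\<zeta> i\<close> of \<open>h\<close> on the chain:
      \<open>tau h\<close> has a pole at \<open>\<zeta> (i + 1)\<close> and \<open>h\<close> has
      none there. On the chain the right-hand side can have a pole only at \<open>\<zeta> 1\<close>,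
      so \<open>i = 0\<close>.\<close>
    define i where "i = Max Z"
    have "i \<in> Z" using finZ \<open>Z \<noteq> {}\<close> by (simp add: i_def)
    moreover have "i + 1 \<notin> Z" using Max_ge[OF finZ, of "i + 1"] by (auto simp: i_def)
    ultimately have "poly ?b (\<zeta> (i + 1)) ^ m = 0"
      using ev[of "i + 1"] Dz[of "i+1"] cop[of "\<zeta> i"] by (auto simp: Z)
    then have i: "i = 0" using bz[of "i + 1"] by (metis add_cancel_right_left power_eq_0_iff)
    \<comment> \<open>At the first pole \<open>\<zeta> j\<close> of \<open>h\<close>,
      \<open>tau h\<close> is regular, since its poles are shifted by one. So this pole must be
      \<open>\<zeta> 1\<close>, which lies after the last pole \<open>\<zeta> 0\<close>.\<close>
    define j where "j = Min Z"
    have "j \<in> Z" using finZ \<open>Z \<noteq> {}\<close> by (simp add: j_def)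
    moreover have "j - 1 \<notin> Z" using Min_le[OF finZ, of "j - 1"] by (auto simp: j_def)
    ultimately have "poly ?b (\<zeta> j) ^ m = 0"
      using ev[of j] Dz[of j] cop[of "\<zeta> j"] by (auto simp: Z)
    then have j: "j = 1" using bz[of j] by (metis power_eq_0_iff)
    have "j \<le> i" unfolding i_def using finZ \<open>j \<in> Z\<close> by simp
    then show False using i j by simp
  qed
  \<comment> \<open>Without poles of \<open>h\<close> on the chain, \<open>h - tau h\<close> is
    regular at \<open>\<zeta> 1\<close>, so the coefficient \<open>E m\<close> of the highest polar
    term vanishes there.\<close>
  then have "poly S (\<zeta> 1) = 0"
    using ev[of 1] Z[of 1] Z[of 0] bz[of 1] \<open>m \<ge> 1\<close> by (auto simp: zero_power)
  also have "S = (\<Sum>i\<in>{1..m} - {m}. E i * ?b ^ (m - i)) + E m"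
    unfolding S_def by (subst sum.remove[of _ m]) (use \<open>m \<ge> 1\<close> in auto)
  also have "poly \<dots> (\<zeta> 1) = poly (E m) (\<zeta> 1)"
    using bz[of 1] by (auto simp: poly_sum intro!: sum.neutral)
  finally have "E m = 0" using fixed_poly_nonzero[OF E] by blast
  then show False using \<gamma>D[of m] \<open>m \<ge> 1\<close> nz D(1) by simp
qed

text \<open>The terms are removed one by one, starting from the highest power of
  \<open>1/b\<close>.\<close>

lemma telescoper_zero:
  assumes h: "h \<in> rat_funs UNIV"
    and \<gamma>: "\<And>i. \<gamma> i \<in> rat_funs UNIV" "\<And>i. tau (\<gamma> i) = \<gamma> i"
    and "h - tau h = (\<Sum>i=1..m. \<gamma> i * inverse b ^ i)" and "i \<in> {1..m}"
  shows "\<gamma> i = 0"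
  using assms(4,5)
proof (induction m arbitrary: i)
  case (Suc m)
  have z: "\<gamma> (Suc m) = 0" by (rule telescoper_nonzero[OF h \<gamma> Suc.prems(1)]) simp_all
  then show ?case
    using Suc.IH[of i] Suc.prems by (cases "i = Suc m") auto
qed simp

end

section \<open>Algebraic independence of the hyperderivatives\<close>

lemma peval_cong:
  assumes "\<And>m j. c m \<noteq> 0 \<Longrightarrow> j \<in># m \<Longrightarrow> y j = y' j"
  shows "peval c y = peval c y'"
  unfolding peval_def
  by (intro sum.cong refl arg_cong2[where f = "(*)"] arg_cong[where f = prod_mset] image_mset_cong)
     (use assms in auto)

lemma shift_invariant_peval_coeff:
  fixes c :: "nat multiset \<Rightarrow> 'e::alg_closed_field"
  assumes inv: "\<And>x y. peval c (\<lambda>j. y j + x * shift y j) = peval c y"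
    and "poly g 0 \<noteq> 0"
  shows "peval c (coeff g) = peval c (coeff [:poly g 0:])"
  using assms(2)
proof (induction "degree g" arbitrary: g rule: less_induct)
  case less
  show ?case
  proof (cases "degree g = 0")
    case True
    then show ?thesis by (elim degree_eq_zeroE) simp
  next
    case False
    then obtain r where r: "poly g r = 0" using alg_closed_imp_poly_has_root[of g] by auto
    then obtain g1 where g1: "g = [:-r, 1:] * g1" by (auto simp: poly_eq_0_iff_dvd)
    have r0: "r \<noteq> 0" using r less.prems by auto
    have "g1 \<noteq> 0" using False g1 by auto
    have deg: "degree g1 < degree g"
      using \<open>g1 \<noteq> 0\<close> unfolding g1 by (subst degree_mult_eq) auto
    \<comment> \<open>Rescaled so that \<open>g = (1 - T/r) g2\<close>. This is the shift with
      \<open>x = -1/r\<close>; it preserves the constant term while the degree drops.\<close>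
    define g2 where "g2 = smult (-r) g1"
    have "coeff g j = coeff g2 j + (- 1 / r) * shift (coeff g2) j" for j
      using r0 by (cases j) (auto simp: g1 g2_def algebra_simps)
    then have "peval c (coeff g) = peval c (coeff g2)" using inv[of "coeff g2" "-1/r"] by presburger
    also have "\<dots> = peval c (coeff [:poly g2 0:])"
      using deg r0 less.prems by (intro less.hyps) (auto simp: g2_def g1)
    also have "poly g2 0 = poly g 0" by (simp add: g2_def g1)
    finally show ?thesis .
  qed
qed

text \<open>Homogeneity leaves a single monomial at the points \<open>(y 0, 0, 0, ...)\<close>, the
  \<open>d\<close>-th power of variable 0. One zero \<open>v\<close> with
  \<open>v 0 \<noteq> 0\<close> therefore kills the values at all points with
  \<open>y 0 \<noteq> 0\<close>, which is what \<open>peval_eq_0_imp_zero\<close> asks for.\<close>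

lemma shift_invariant_zero:
  fixes c :: "nat multiset \<Rightarrow> 'e::alg_closed_field"
  assumes inf: "infinite (UNIV :: 'e set)"
    and inv: "\<And>x y. peval c (\<lambda>j. y j + x * shift y j) = peval c y"
    and fin: "finite {m. c m \<noteq> 0}" and size: "\<And>m. c m \<noteq> 0 \<Longrightarrow> size m = d"
    and v: "peval c v = 0" "v 0 \<noteq> 0"
  shows "c m = 0"
proof -
  have "finite (\<Union>m\<in>{m. c m \<noteq> 0}. set_mset m)" using fin by auto
  then obtain n where n: "(\<Union>m\<in>{m. c m \<noteq> 0}. set_mset m) \<subseteq> {..<n}"
    using finite_nat_iff_bounded by blast
  have peval: "peval c y = c (replicate_mset d 0) * y 0 ^ d" if "y 0 \<noteq> 0" for y
  proof -
    \<comment> \<open>Truncating \<open>y\<close> beyond the variables of \<open>c\<close> does not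
      change the value; the bound \<open>Suc n\<close> keeps \<open>y 0\<close> even if
      \<open>n = 0\<close>.\<close>
    define g where "g = (\<Sum>j<Suc n. monom (y j) j)"
    have g: "coeff g j = (if j < Suc n then y j else 0)" for j
      by (simp add: g_def coeff_sum coeff_monom del: sum.lessThan_Suc)
    then have "poly g 0 = y 0" by (simp add: poly_0_coeff_0)
    have "peval c y = peval c (coeff g)"
      by (rule peval_cong) (use n in \<open>auto simp: g\<close>)
    also have "\<dots> = peval c (coeff [:y 0:])"
      using shift_invariant_peval_coeff[OF inv, of g] \<open>poly g 0 = y 0\<close> that by simp
    also have "\<dots> = (\<Sum>m\<in>insert (replicate_mset d 0) {m. c m \<noteq> 0}. c m * (\<Prod>j\<in>#m. coeff [:y 0:] j))"
      by (rule peval_superset) (use fin in auto)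
    also have "\<dots> = (\<Sum>m\<in>{replicate_mset d 0}. c m * (\<Prod>j\<in>#m. coeff [:y 0:] j))"
    proof (rule sum.mono_neutral_right)
      have "c m * (\<Prod>j\<in>#m. coeff [:y 0:] j) = 0" if "m \<noteq> replicate_mset d 0" "c m \<noteq> 0" for m
      proof -
        have "\<exists>j\<in>#m. j \<noteq> 0"
        proof (rule ccontr)
          assume "\<not> ?thesis"
          then have "m = replicate_mset (size m) 0"
            by (metis set_mset_subset_singletonD singletonI subsetI)
          then show False using that size by auto
        qed
        then obtain j where "j \<in># m" "j \<noteq> 0" by blast
        then have "(\<Prod>j\<in>#m. coeff [:y 0:] j) = 0"
          by (auto simp: coeff_pCons image_iff split: nat.splits intro!: prod_mset_zero_iff[THEN iffD2] bexI[of _ j])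
        then show ?thesis by simp
      qed
      then show "\<forall>i\<in>insert (replicate_mset d 0) {m. c m \<noteq> 0} - {replicate_mset d 0}.
          c i * (\<Prod>j\<in>#i. coeff [:y 0:] j) = 0" by blast
    qed (use fin in auto)
    finally show ?thesis by simp
  qed
  have "c (replicate_mset d 0) = 0" using peval[of v] v by simp
  then show ?thesis
    by (intro peval_eq_0_imp_zero[OF inf fin]) (simp add: peval)
qed

lemma infinite_fls: "infinite (UNIV :: 'c::field fls set)"
proof -
  have "inj (\<lambda>n. poly_fls (monom (1::'c) n))"
    by (rule injI) (simp add: fps_of_poly_eq_iff monom_eq_iff')
  then show ?thesis using range_inj_infinite infinite_super subset_UNIV by metis
qed

text \<open>Reads the off-diagonal part of the substitution as a polynomial in \<open>x\<close>. It
  has no constant term, because a monomial other than \<open>m'\<close> that contributes to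
  \<open>m'\<close> has a strictly larger index sum. It is used at \<open>x = 1/b\<close> and later
  at arbitrary \<open>x\<close>.\<close>

lemma sum_group_weight:
  fixes w :: "nat multiset \<Rightarrow> 'e::comm_ring_1"
  assumes "finite S" "\<And>m. m \<in> S \<Longrightarrow> sum_mset m \<le> N"
  shows "(\<Sum>m\<in>S - {m'}. of_nat (subst_count m m') * w m * x ^ (sum_mset m - sum_mset m')) =
    (\<Sum>i=1..N. (\<Sum>m | m \<in> S \<and> m \<noteq> m' \<and> sum_mset m = sum_mset m' + i. of_nat (subst_count m m') * w m) * x ^ i)"
proof -
  define T where "T = {m \<in> S. m \<noteq> m' \<and> sum_mset m' < sum_mset m}"
  let ?f = "\<lambda>m. of_nat (subst_count m m') * w m * x ^ (sum_mset m - sum_mset m')"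
  have "(\<Sum>m\<in>S - {m'}. ?f m) = (\<Sum>m\<in>T. ?f m)"
  proof (rule sum.mono_neutral_right)
    have "?f m = 0" if "m \<in> S - {m'} - T" for m
      using subst_count_less(3)[of m m'] that by (cases "subst_count m m' = 0") (auto simp: T_def)
    then show "\<forall>m\<in>S - {m'} - T. ?f m = 0" by blast
  qed (use assms in \<open>auto simp: T_def\<close>)
  also have "\<dots> = (\<Sum>i=1..N. \<Sum>m\<in>{m\<in>T. sum_mset m - sum_mset m' = i}. ?f m)"
  proof (rule sum.group[symmetric])
    show "finite T" using assms(1) by (simp add: T_def)
    show "(\<lambda>m. sum_mset m - sum_mset m') ` T \<subseteq> {1..N}"
      using assms(2) by (fastforce simp: T_def)
  qed simp
  also have "\<dots> = (\<Sum>i=1..N. (\<Sum>m | m \<in> S \<and> m \<noteq> m' \<and> sum_mset m = sum_mset m' + i. of_nat (subst_count m m') * w m) * x ^ i)"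
    unfolding sum_distrib_right by (intro sum.cong) (auto simp: T_def)
  finally show ?thesis .
qed

context frob_chain
begin

text \<open>The coefficients range over all rational functions over \<open>'c\<close>, a field that
  contains \<open>b\<close> and is stable under \<open>tau\<close>.\<close>

theorem hyperderiv_alg_independent:
  assumes nz: "\<Omega> \<noteq> 0" and tau_Omega: "tau \<Omega> = b * \<Omega>"
    and c: "finite {m. c m \<noteq> 0}" "\<And>m. c m \<in> rat_funs UNIV"
    and rel: "peval c (\<lambda>j. hyperderiv j \<Omega>) = 0"
  shows "c m = 0"
proof (rule ccontr)
  assume "c m \<noteq> 0"
  define v where "v = (\<lambda>j. hyperderiv j \<Omega>)"
  define \<beta> where "\<beta> = inverse b"
  have bb: "b * \<beta> = 1" by (simp add: \<beta>_def)
  have \<beta>: "\<beta> \<in> rat_funs UNIV" unfolding \<beta>_def by (rule rat_funs_inverse[OF b_rat])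
  have tau_v: "tau (v j) = b * (v j + \<beta> * shift v j)" for j
  proof -
    have "tau (v j) = b * v j + shift v j"
      unfolding v_def tau_hyperderiv tau_Omega b_def by (rule hyperderiv_linear_mult)
    also have "\<dots> = b * v j + (b * \<beta>) * shift v j" by (simp only: bb mult_1)
    finally show ?thesis by (simp only: distrib_left mult.assoc)
  qed
  define R where "R = (\<lambda>c. finite {m. c m \<noteq> 0} \<and> (\<forall>m. c m \<in> rat_funs UNIV) \<and> peval c v = 0)"
  define P where "P m0 \<longleftrightarrow> (\<exists>c. R c \<and> c m0 \<noteq> 0 \<and> (\<forall>m>m0. c m = 0))" for m0
  have lead: "\<exists>m0. c m0 \<noteq> 0 \<and> P m0" if "R c" "c m \<noteq> 0" for c and m :: "nat multiset"
  proof -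
    have fin: "finite {m. c m \<noteq> 0}" using that(1) by (simp add: R_def)
    define m0 where "m0 = Max {m. c m \<noteq> 0}"
    have "m0 \<in> {m. c m \<noteq> 0}" unfolding m0_def by (rule Max_in[OF fin]) (use that(2) in blast)
    moreover have "c m' = 0" if "m0 < m'" for m'
      using Max_ge[OF fin, of m'] that unfolding m0_def by (metis leD mem_Collect_eq)
    ultimately show ?thesis using that(1) unfolding P_def by blast
  qed
  have "\<exists>m. P m"
    using lead[of c m] \<open>c m \<noteq> 0\<close> c rel by (auto simp: R_def v_def)
  \<comment> \<open>Monomials are multisets of indices because the multiset order on them is a
    well-order, so that a least leading monomial exists.\<close>
  define m0 where "m0 = (LEAST m. P m)"
  have "P m0" unfolding m0_def by (rule LeastI_ex) fact
  have least: "\<not> P m" if "m < m0" for m using that not_less_Least unfolding m0_def by blast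
  obtain c1 where c1: "R c1" "c1 m0 \<noteq> 0" "\<And>m. m > m0 \<Longrightarrow> c1 m = 0"
    using \<open>P m0\<close> unfolding P_def by blast
  \<comment> \<open>The leading coefficient 1 is fixed by \<open>tau\<close>; this lets the leading
    terms cancel in \<open>f\<close> below.\<close>
  define e where "e = (\<lambda>m. inverse (c1 m0) * c1 m)"
  have e: "finite {m. e m \<noteq> 0}" "\<And>m. e m \<in> rat_funs UNIV" "peval e v = 0" "e m0 = 1"
      "\<And>m. m > m0 \<Longrightarrow> e m = 0"
    using c1 by (auto simp: R_def e_def peval_def mult.assoc sum_distrib_left[symmetric] intro!: rat_funs_mult rat_funs_inverse)
  define S where "S = {m. e m \<noteq> 0}"
  have S: "finite S" "m0 \<in> S" "\<And>m. m \<in> S \<Longrightarrow> m \<le> m0" "\<And>m. m \<notin> S \<Longrightarrow> e m = 0"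
    using e(1,4,5) by (auto simp: S_def not_less[symmetric])
  define d where "d = size m0"
  \<comment> \<open>Since \<open>tau (v j) = b * (v j + \<beta> * v (j - 1))\<close>, the
    coefficient of \<open>m'\<close> in the image of the monomial \<open>m\<close> under
    \<open>tau\<close> is \<open>b ^ size m * K m m'\<close>.\<close>
  define K where "K m m' = (of_nat (subst_count m m') * \<beta> ^ (sum_mset m - sum_mset m'))" for m m'
  have K_same [simp]: "K m m = 1" for m by (simp add: K_def)
  have K_less: "m' < m" "size m' = size m" "sum_mset m' < sum_mset m" if "K m m' \<noteq> 0" "m' \<noteq> m" for m m'
  proof -
    have "subst_count m m' \<noteq> 0" using that(1) unfolding K_def by (metis mult_zero_left of_nat_0)
    then show "m' < m" "size m' = size m" "sum_mset m' < sum_mset m"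
      using subst_count_less that(2) by blast+
  qed
  have K_rat: "K m m' \<in> rat_funs UNIV" for m m'
    unfolding K_def by (intro rat_funs_mult rat_funs_of_nat rat_funs_power \<beta>)
  \<comment> \<open>The coefficients of the relation after applying \<open>tau\<close> and expanding
    again in monomials in \<open>v\<close>.\<close>
  define a where "a m' = (\<Sum>m\<in>S. tau (e m) * b ^ size m * K m m')" for m'
  define M where "M = S \<union> (\<Union>m\<in>S. {m'. subst_count m m' \<noteq> 0})"
  have M: "finite M" "\<And>m. m \<in> S \<Longrightarrow> {m'. subst_count m m' \<noteq> 0} \<subseteq> M" "S \<subseteq> M"
    unfolding M_def using S(1) finite_subst_count by auto
  have a_supp: "{m. a m \<noteq> 0} \<subseteq> M"
  proof
    fix m' assume "m' \<in> {m. a m \<noteq> 0}"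
    then have "(\<Sum>m\<in>S. tau (e m) * b ^ size m * K m m') \<noteq> 0" by (simp add: a_def)
    then obtain m where "m \<in> S" "tau (e m) * b ^ size m * K m m' \<noteq> 0" by (rule sum.not_neutral_contains_not_neutral)
    then have "m \<in> S" "K m m' \<noteq> 0" by auto
    then show "m' \<in> M" unfolding K_def M_def by (cases "subst_count m m' = 0") auto
  qed
  have prod_tau: "(\<Prod>j\<in>#m. tau (v j)) = b ^ size m * (\<Sum>m'\<in>M. K m m' * (\<Prod>j\<in>#m'. v j))" if "m \<in> S" for m
  proof -
    have "(\<Prod>j\<in>#m. tau (v j)) = b ^ size m * (\<Prod>j\<in>#m. v j + \<beta> * shift v j)"
      unfolding tau_v by (induction m) (simp_all add: mult_ac)
    also have "(\<Prod>j\<in>#m. v j + \<beta> * shift v j) = (\<Sum>m'\<in>M. K m m' * (\<Prod>j\<in>#m'. v j))"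
      unfolding K_def by (rule prod_mset_subst[OF M(1) M(2)[OF that]])
    finally show ?thesis .
  qed
  have "peval a v = (\<Sum>m'\<in>M. \<Sum>m\<in>S. tau (e m) * b ^ size m * (K m m' * (\<Prod>j\<in>#m'. v j)))"
    by (simp add: peval_superset[OF M(1) a_supp] a_def sum_distrib_right mult.assoc)
  also have "\<dots> = (\<Sum>m\<in>S. tau (e m) * (\<Prod>j\<in>#m. tau (v j)))"
    by (subst sum.swap) (simp add: prod_tau sum_distrib_left mult.assoc)
  also have "\<dots> = tau (peval e v)"
    by (simp add: peval_def S_def tau.hom_sum tau.hom_mult tau.hom_prod_mset image_mset.compositionality o_def)
  finally have a_rel: "peval a v = 0" using e(3) by simp
  have a_rat: "a m \<in> rat_funs UNIV" for m
    unfolding a_def by (intro rat_funs_sum rat_funs_mult tau_rat_funs e rat_funs_power b_rat K_rat)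
  \<comment> \<open>At \<open>m0\<close> both terms equal \<open>b ^ d\<close>, so a nonzero
    \<open>f\<close> would be a relation with a smaller leading monomial. Hence \<open>e\<close> is
    an eigenvector of the semilinear substitution.\<close>
  define f where "f m = a m - b ^ d * e m" for m
  have "f m = 0" for m
  proof (rule ccontr)
    assume nz: "f m \<noteq> 0"
    have supp: "{m. f m \<noteq> 0} \<subseteq> M"
    proof
      fix m assume "m \<in> {m. f m \<noteq> 0}"
      then have "a m \<noteq> 0 \<or> e m \<noteq> 0" by (auto simp: f_def)
      then show "m \<in> M" using a_supp M(3) by (auto simp: S_def)
    qed
    then have fin: "finite {m. f m \<noteq> 0}" using M(1) finite_subset by blast
    have "peval f v = peval a v - b ^ d * peval e v"
      using M(3) a_supp
      by (simp add: peval_superset[OF M(1) supp] peval_superset[OF M(1) a_supp] peval_superset[OF M(1), of e, unfolded S_def[symmetric]]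
          f_def left_diff_distrib sum_subtractf sum_distrib_left mult.assoc)
    then have "R f" using fin e(3) a_rel
      by (auto simp: R_def f_def intro!: rat_funs_diff rat_funs_mult rat_funs_power b_rat a_rat e)
    then obtain m1 where m1: "f m1 \<noteq> 0" "P m1" using lead nz by blast
    have zero: "K m m1 = 0" if "m \<in> S" "m1 \<ge> m0" "m \<noteq> m1" for m
      using K_less(1)[of m m1] S(3)[OF that(1)] that(2,3) by (metis leD order.trans)
    have "m1 < m0"
    proof (rule ccontr)
      assume "\<not> m1 < m0"
      then have ge: "m1 \<ge> m0" by simp
      show False
      proof (cases "m1 = m0")
        case True
        have "a m1 = tau (e m0) * b ^ size m0 * K m0 m1"
          unfolding a_def using S(1,2) zero ge by (subst sum.remove[of _ m0]) (auto simp: True intro!: sum.neutral)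
        then show False using m1 e(4) True by (simp add: f_def d_def)
      next
        case False
        then have "a m1 = 0" unfolding a_def using zero ge S(3) by (intro sum.neutral) (metis antisym mult_zero_right)
        moreover have "e m1 = 0" using False ge e(5) by auto
        ultimately show False using m1 by (simp add: f_def)
      qed
    qed
    then show False using least m1 by blast
  qed
  then have ae: "a m = b ^ d * e m" for m by (simp add: f_def)
  \<comment> \<open>At the largest monomial of a wrong size no other monomial contributes, since the
    substitution keeps sizes and only lowers. What remains is a twisted equation for one
    coefficient, excluded by \<open>twisted_fixed_degree\<close>.\<close>
  have size_S: "size m = d" if "m \<in> S" for m
  proof (rule ccontr)
    assume "size m \<noteq> d"
    define m' where "m' = Max {m \<in> S. size m \<noteq> d}"
    have "m' \<in> {m \<in> S. size m \<noteq> d}"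
      unfolding m'_def by (rule Max_in) (use S(1) that \<open>size m \<noteq> d\<close> in auto)
    then have m': "m' \<in> S" "size m' \<noteq> d" by auto
    have max: "m \<le> m'" if "m \<in> S" "size m \<noteq> d" for m
      unfolding m'_def by (rule Max_ge) (use S(1) that in auto)
    have "K m m' = 0" if "m \<in> S" "m \<noteq> m'" for m
      using K_less(1,2)[of m m'] max[OF that(1)] that(2) m'(2) by (metis leD)
    then have "a m' = tau (e m') * b ^ size m'"
      unfolding a_def using S(1) m'(1) by (subst sum.remove[of _ m']) (auto intro!: sum.neutral)
    then have "b ^ size m' * tau (e m') = b ^ d * e m'" using ae by (simp add: mult_ac)
    then show False using twisted_fixed_degree[OF e(2)] m' by (auto simp: S_def)
  qed
  have eq: "e m' = (\<Sum>m\<in>S. tau (e m) * K m m')" for m'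
  proof -
    have "b ^ d * e m' = b ^ d * (\<Sum>m\<in>S. tau (e m) * K m m')"
      unfolding ae[symmetric] a_def sum_distrib_left by (intro sum.cong) (auto simp: size_S mult_ac)
    then show ?thesis by simp
  qed
  define N where "N = (\<Sum>m\<in>S. sum_mset m)"
  have N: "sum_mset m \<le> N" if "m \<in> S" for m unfolding N_def by (rule member_le_sum) (use S(1) that in auto)
  \<comment> \<open>Coefficient of \<open>\<beta> ^ i\<close> in the off-diagonal part of
    \<open>eq\<close>, with \<open>e\<close> in place of \<open>tau e\<close>; the replacement is
    justified where the contributing coefficients are known to be fixed.\<close>
  define \<gamma> where "\<gamma> m' i = (\<Sum>m\<in>{m\<in>S. m \<noteq> m' \<and> sum_mset m = sum_mset m' + i}. of_nat (subst_count m m') * e m)" for m' i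
  have \<gamma>_rat: "\<gamma> m' i \<in> rat_funs UNIV" for m' i
    unfolding \<gamma>_def by (intro rat_funs_sum rat_funs_mult rat_funs_of_nat e)
  \<comment> \<open>At the largest monomial whose coefficient is not fixed, all other contributing
    coefficients are fixed. So \<open>e m' - tau (e m')\<close> is a combination of positive powers
    of \<open>1/b\<close> with fixed coefficients, and \<open>telescoper_zero\<close> makes it
    vanish.\<close>
  have fixed: "tau (e m) = e m" for m
  proof (rule ccontr)
    assume "tau (e m) \<noteq> e m"
    define m' where "m' = Max {m \<in> S. tau (e m) \<noteq> e m}"
    have "m \<in> S" using S(4)[of m] \<open>tau (e m) \<noteq> e m\<close> tau.hom_zero by fastforce
    then have "m' \<in> {m \<in> S. tau (e m) \<noteq> e m}"
      unfolding m'_def by (intro Max_in) (use S(1) \<open>tau (e m) \<noteq> e m\<close> in auto)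
    then have m': "m' \<in> S" "tau (e m') \<noteq> e m'" by auto
    have max: "m \<le> m'" if "m \<in> S" "tau (e m) \<noteq> e m" for m
      unfolding m'_def by (rule Max_ge) (use S(1) that in auto)
    have fix_above: "subst_count m m' = 0 \<or> tau (e m) = e m" if "m \<in> S" "m \<noteq> m'" for m
      using subst_count_less(1)[of m m'] max[OF that(1)] that(2) by (metis leD)
    have "e m' - tau (e m') = (\<Sum>m\<in>S - {m'}. tau (e m) * K m m')"
      by (subst (1) eq, subst sum.remove[of _ m']) (use S(1) m' in auto)
    also have "\<dots> = (\<Sum>m\<in>S - {m'}. of_nat (subst_count m m') * e m * \<beta> ^ (sum_mset m - sum_mset m'))"
      by (intro sum.cong refl) (use fix_above in \<open>fastforce simp: K_def\<close>)
    finally have tel: "e m' - tau (e m') = (\<Sum>i=1..N. \<gamma> m' i * inverse b ^ i)"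
      unfolding \<gamma>_def \<beta>_def using sum_group_weight[OF S(1) N, of m' e "inverse b"] by (rule trans)
    have "tau (\<gamma> m' i) = \<gamma> m' i" for i
      unfolding \<gamma>_def tau.hom_sum tau.hom_mult
    proof (intro sum.cong refl)
      fix m assume "m \<in> {m \<in> S. m \<noteq> m' \<and> sum_mset m = sum_mset m' + i}"
      then have "subst_count m m' = 0 \<or> tau (e m) = e m" using fix_above by blast
      then show "tau (of_nat (subst_count m m')) * tau (e m) = of_nat (subst_count m m') * e m"
        by (auto simp: hom_distribs)
    qed
    then have "\<gamma> m' i = 0" if "i \<in> {1..N}" for i
      by (rule telescoper_zero[where h = "e m'" and \<gamma> = "\<gamma> m'" and m = N, OF e(2) \<gamma>_rat _ tel that])
    then have "e m' - tau (e m') = 0" unfolding tel by (intro sum.neutral) simp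
    then show False using m' by simp
  qed
  \<comment> \<open>Now the difference is 0 for every \<open>m'\<close>, in \<open>S\<close> or not,
    and \<open>telescoper_zero\<close> gives each coefficient separately. This is what replaces the
    single value \<open>\<beta>\<close> by an arbitrary \<open>x\<close> below.\<close>
  have \<gamma>_zero: "\<gamma> m' i = 0" if "i \<in> {1..N}" for m' i
  proof -
    have "(\<Sum>m\<in>S - {m'}. e m * K m m') = 0"
    proof (cases "m' \<in> S")
      case True
      then have "e m' = e m' + (\<Sum>m\<in>S - {m'}. e m * K m m')"
        using eq[of m'] S(1) by (simp add: fixed sum.remove[of _ m'])
      then show ?thesis by simp
    next
      case False
      then show ?thesis using eq[of m'] S(4) by (simp add: fixed)
    qed
    then have tel: "e m' - tau (e m') = (\<Sum>i=1..N. \<gamma> m' i * inverse b ^ i)"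
      using sum_group_weight[OF S(1) N, of m' e \<beta>]
      by (simp add: fixed K_def \<gamma>_def mult_ac flip: \<beta>_def)
    have "tau (\<gamma> m' i) = \<gamma> m' i" for i
      by (simp add: \<gamma>_def hom_distribs fixed)
    then show ?thesis
      by (rule telescoper_zero[where h = "e m'" and \<gamma> = "\<gamma> m'" and m = N, OF e(2) \<gamma>_rat _ tel that])
  qed
  \<comment> \<open>Splitting the polynomial with coefficients \<open>y\<close> requires an
    algebraically closed field, so the coefficients move to the closure of the Laurent series. The
    identities \<open>\<gamma> m' i = 0\<close> move with them.\<close>
  define g where "g m = to_ac (e m)" for m
  have gS: "{m. g m \<noteq> 0} = S" by (simp add: g_def S_def)
  have inv: "peval g (\<lambda>j. y j + x * shift y j) = peval g y" for x y
  proof -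
    have inner: "(\<Sum>m\<in>S. g m * (of_nat (subst_count m m') * x ^ (sum_mset m - sum_mset m'))) = g m'" for m'
    proof -
      define D where "D = (\<lambda>i. \<Sum>m\<in>{m\<in>S. m \<noteq> m' \<and> sum_mset m = sum_mset m' + i}. of_nat (subst_count m m') * g m)"
      have "D i = to_ac (\<gamma> m' i)" for i
        by (simp add: D_def \<gamma>_def g_def to_ac_sum)
      then have D: "D i = 0" if "i \<in> {1..N}" for i using \<gamma>_zero[OF that] by simp
      have "(\<Sum>m\<in>S - {m'}. g m * (of_nat (subst_count m m') * x ^ (sum_mset m - sum_mset m'))) =
        (\<Sum>m\<in>S - {m'}. of_nat (subst_count m m') * g m * x ^ (sum_mset m - sum_mset m'))"
        by (simp add: mult_ac)
      also have "\<dots> = (\<Sum>i=1..N. D i * x ^ i)"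
        unfolding D_def by (rule sum_group_weight[OF S(1) N])
      also have "\<dots> = 0" using D by simp
      finally have rest: "(\<Sum>m\<in>S - {m'}. g m * (of_nat (subst_count m m') * x ^ (sum_mset m - sum_mset m'))) = 0" .
      show ?thesis
      proof (cases "m' \<in> S")
        case True
        then show ?thesis using S(1) rest by (simp add: sum.remove[of _ m'])
      next
        case False
        then show ?thesis using rest S(4) by (simp add: g_def)
      qed
    qed
    have "peval g (\<lambda>j. y j + x * shift y j) = (\<Sum>m\<in>S. g m * (\<Prod>j\<in>#m. y j + x * shift y j))"
      unfolding peval_def gS ..
    also have "\<dots> = (\<Sum>m\<in>S. \<Sum>m'\<in>M. g m * (of_nat (subst_count m m') * x ^ (sum_mset m - sum_mset m')) * (\<Prod>j\<in>#m'. y j))"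
      by (intro sum.cong refl) (simp only: prod_mset_subst[OF M(1) M(2), of _ y x] sum_distrib_left mult.assoc)
    also have "\<dots> = (\<Sum>m'\<in>M. g m' * (\<Prod>j\<in>#m'. y j))"
      by (subst sum.swap) (simp add: inner flip: sum_distrib_right)
    also have "\<dots> = peval g y" using peval_superset[OF M(1), of g y] gS M(3) by simp
    finally show ?thesis .
  qed
  have "infinite (range (to_ac :: 'c fls \<Rightarrow> _))"
    using finite_imageD[OF _ inj_to_ac] infinite_fls by blast
  then have inf: "infinite (UNIV :: 'c fls alg_closure set)" by (rule infinite_super[OF subset_UNIV])
  have "peval g (\<lambda>j. to_ac (v j)) = to_ac (peval e v)"
    unfolding peval_def gS S_def[symmetric]
    by (simp add: g_def to_ac_sum to_ac_prod_mset image_mset.compositionality o_def)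
  then have "g m0 = 0"
    using shift_invariant_zero[OF inf inv, of d "\<lambda>j. to_ac (v j)" m0] gS S(1) size_S e(3) nz
    by (auto simp: v_def)
  then show False using gS S(2) by blast
qed

end

section \<open>Tensor products\<close>

abbreviation pair_times :: "'x::comm_ring_1 \<times> 'x \<Rightarrow> 'x \<times> 'x \<Rightarrow> 'x \<times> 'x" where
  "pair_times x y \<equiv> (fst x * fst y, snd x * snd y)"

text \<open>The additive group of the monoid ring is free abelian on the pairs; with its product
  named, ring laws reduce to generators by \<open>pair_induct\<close>.\<close>

definition pair_mult :: "(('x::comm_ring_1 \<times> 'x) \<Rightarrow>\<^sub>0 int) \<Rightarrow> (('x \<times> 'x) \<Rightarrow>\<^sub>0 int) \<Rightarrow> (('x \<times> 'x) \<Rightarrow>\<^sub>0 int)" where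
  pair_mult_eq: "pair_mult f g = (\<Sum>x\<in>Poly_Mapping.keys f. \<Sum>y\<in>Poly_Mapping.keys g.
     Poly_Mapping.single (pair_times x y) (Poly_Mapping.lookup f x * Poly_Mapping.lookup g y))"

lemma pair_ring_simps [simp]:
  "carrier (pair_ring L) = {f. Poly_Mapping.keys f \<subseteq> L \<times> L}"
  "f \<otimes>\<^bsub>pair_ring L\<^esub> g = pair_mult f g"
  "\<one>\<^bsub>pair_ring L\<^esub> = frag_of (1, 1)"
  "\<zero>\<^bsub>pair_ring L\<^esub> = 0" "f \<oplus>\<^bsub>pair_ring L\<^esub> g = f + g"
  by (simp_all add: pair_ring_def pair_mult_eq case_prod_unfold)

lemma pair_mult_add_left: "pair_mult (f + f') g = pair_mult f g + pair_mult f' g"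
  unfolding pair_mult_eq
  by (rule setsum_keys_plus_distrib) (simp_all add: distrib_right single_add sum.distrib)

lemma pair_mult_add_right: "pair_mult f (g + g') = pair_mult f g + pair_mult f g'"
  unfolding pair_mult_eq sum.distrib[symmetric]
  by (intro sum.cong refl setsum_keys_plus_distrib) (simp_all add: distrib_left single_add)

lemma pair_mult_0 [simp]: "pair_mult 0 g = 0" "pair_mult f 0 = 0"
  by (simp_all add: pair_mult_eq)

lemma pair_mult_diff_left: "pair_mult (f - f') g = pair_mult f g - pair_mult f' g"
  using pair_mult_add_left[of "f - f'" f' g] by (simp add: algebra_simps)

lemma pair_mult_diff_right: "pair_mult f (g - g') = pair_mult f g - pair_mult f g'"
  using pair_mult_add_right[of f "g - g'" g'] by (simp add: algebra_simps)

lemma pair_mult_single [simp]: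
  "pair_mult (Poly_Mapping.single x m) (Poly_Mapping.single y n) = Poly_Mapping.single (pair_times x y) (m * n)"
  by (cases "m = 0"; cases "n = 0") (simp_all add: pair_mult_eq)

lemma pair_mult_uminus_right: "pair_mult f (- g) = - pair_mult f g"
  using pair_mult_diff_right[of f 0 g] by simp

lemmas pair_mult_distribs = pair_mult_add_left pair_mult_add_right pair_mult_diff_left pair_mult_diff_right

lemma pair_induct [case_names zero single diff]:
  fixes f :: "'k \<Rightarrow>\<^sub>0 int"
  assumes "P 0" "\<And>x. P (frag_of x)" "\<And>f g. P f \<Longrightarrow> P g \<Longrightarrow> P (f - g)"
  shows "P f"
  by (rule frag_induction[of f UNIV]) (use assms in auto)

lemma pair_mult_comm: "pair_mult f g = pair_mult g f"
proof (induction f rule: pair_induct)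
  case (single x)
  show ?case by (induction g rule: pair_induct) (simp_all add: pair_mult_distribs mult_ac)
qed (simp_all add: pair_mult_distribs)

lemma pair_mult_assoc: "pair_mult (pair_mult f g) h = pair_mult f (pair_mult g h)"
proof (induction f rule: pair_induct)
  case (single x)
  show ?case
  proof (induction g rule: pair_induct)
    case (single y)
    show ?case by (induction h rule: pair_induct) (simp_all add: pair_mult_distribs mult_ac)
  qed (simp_all add: pair_mult_distribs)
qed (simp_all add: pair_mult_distribs)

lemma pair_mult_1: "pair_mult (frag_of (1, 1)) f = f"
  by (induction f rule: pair_induct) (simp_all add: pair_mult_distribs)

text \<open>On generators this is \<open>a \<otimes> b \<mapsto> \<phi> a * b\<close>. It is linear
  over the right factor for every \<open>\<phi>\<close>.\<close>

definition tensor_map :: "('x::comm_ring_1 \<Rightarrow> 'x) \<Rightarrow> (('x \<times> 'x) \<Rightarrow>\<^sub>0 int) \<Rightarrow> 'x" where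
  "tensor_map \<phi> f = (\<Sum>x\<in>Poly_Mapping.keys f. of_int (Poly_Mapping.lookup f x) * (\<phi> (fst x) * snd x))"

lemma tensor_map_add: "tensor_map \<phi> (f + g) = tensor_map \<phi> f + tensor_map \<phi> g"
  unfolding tensor_map_def by (rule setsum_keys_plus_distrib) (simp_all add: algebra_simps)

lemma tensor_map_diff: "tensor_map \<phi> (f - g) = tensor_map \<phi> f - tensor_map \<phi> g"
  using tensor_map_add[of \<phi> "f - g" g] by simp

lemma tensor_map_0 [simp]: "tensor_map \<phi> 0 = 0"
  by (simp add: tensor_map_def)

lemma tensor_map_uminus: "tensor_map \<phi> (- f) = - tensor_map \<phi> f"
  using tensor_map_diff[of \<phi> 0 f] by simp

lemma tensor_map_single [simp]: "tensor_map \<phi> (Poly_Mapping.single x n) = of_int n * (\<phi> (fst x) * snd x)"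
  by (cases "n = 0") (simp_all add: tensor_map_def)

lemma tensor_map_mult_right:
  "tensor_map \<phi> (pair_mult (frag_of (1, b)) f) = b * tensor_map \<phi> f"
  by (induction f rule: pair_induct) (simp_all add: pair_mult_distribs tensor_map_diff algebra_simps)

locale subring_pair =
  fixes F L :: "'x::comm_ring_1 set"
  assumes one_L: "1 \<in> L" and add_L: "\<And>x y. x \<in> L \<Longrightarrow> y \<in> L \<Longrightarrow> x + y \<in> L"
    and mult_L: "\<And>x y. x \<in> L \<Longrightarrow> y \<in> L \<Longrightarrow> x * y \<in> L" and F_L: "F \<subseteq> L"
begin

lemma pair_mult_closed:
  assumes "Poly_Mapping.keys f \<subseteq> L \<times> L" "Poly_Mapping.keys g \<subseteq> L \<times> L"
  shows "Poly_Mapping.keys (pair_mult f g) \<subseteq> L \<times> L"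
proof -
  have "Poly_Mapping.keys (pair_mult f g) \<subseteq> (\<Union>x\<in>Poly_Mapping.keys f. \<Union>y\<in>Poly_Mapping.keys g. {pair_times x y})"
    unfolding pair_mult_eq
    by (intro order.trans[OF keys_sum] UN_mono order_refl) simp
  also have "\<dots> \<subseteq> L \<times> L"
    using assms by (auto intro!: mult_L)
  finally show ?thesis .
qed

lemma pair_diff_closed:
  assumes "Poly_Mapping.keys f \<subseteq> L \<times> L" "Poly_Mapping.keys g \<subseteq> L \<times> L"
  shows "Poly_Mapping.keys (f - g) \<subseteq> L \<times> L" "Poly_Mapping.keys (f + g) \<subseteq> L \<times> L"
  by (rule order.trans[OF keys_diff] order.trans[OF Poly_Mapping.keys_add], rule Un_least[OF assms])+

sublocale P: cring "pair_ring L"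
proof (intro cringI abelian_groupI comm_monoidI)
  fix f assume "f \<in> carrier (pair_ring L)"
  then show "\<exists>y\<in>carrier (pair_ring L). y \<oplus>\<^bsub>pair_ring L\<^esub> f = \<zero>\<^bsub>pair_ring L\<^esub>"
    by (intro bexI[of _ "- f"]) auto
qed (simp_all add: pair_mult_closed pair_diff_closed(2) pair_mult_assoc pair_mult_1 pair_mult_distribs
    one_L add.assoc add.commute[of f g for f g], rule pair_mult_comm)

lemma pair_ring_closed:
  assumes "f \<in> carrier (pair_ring L)" "g \<in> carrier (pair_ring L)"
  shows "f - g \<in> carrier (pair_ring L)" "f + g \<in> carrier (pair_ring L)" "pair_mult f g \<in> carrier (pair_ring L)"
  using assms pair_diff_closed pair_mult_closed by simp_all

lemma single_carrier: "a \<in> L \<Longrightarrow> b \<in> L \<Longrightarrow> frag_of (a, b) \<in> carrier (pair_ring L)"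
  by simp

lemma relations_carrier: "tensor_relations F L \<subseteq> carrier (pair_ring L)"
  unfolding tensor_relations_def Let_def
  by (intro Un_least subsetI; elim CollectE exE conjE; hypsubst;
      intro pair_ring_closed(1) single_carrier; use F_L in \<open>blast intro: add_L mult_L\<close>)

sublocale I: ideal "tensor_ideal F L" "pair_ring L"
  unfolding tensor_ideal_def by (rule P.genideal_ideal[OF relations_carrier])

abbreviation TT where "TT \<equiv> tensor_ring F L"
abbreviation pt where "pt \<equiv> pure_tensor F L"
abbreviation proj where "proj f \<equiv> tensor_ideal F L +>\<^bsub>pair_ring L\<^esub> f"

sublocale T: cring TT
  unfolding tensor_ring_def by (rule I.quotient_is_cring) (rule P.is_cring)

sublocale proj: ring_hom_cring "pair_ring L" TT "\<lambda>f. proj f"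
  unfolding tensor_ring_def by (rule I.rcos_ring_hom_cring) (rule P.is_cring)

lemma proj_eqI:
  assumes "f \<in> carrier (pair_ring L)" "g \<in> carrier (pair_ring L)" "f - g \<in> tensor_ideal F L"
  shows "proj f = proj g"
proof -
  have "\<ominus>\<^bsub>pair_ring L\<^esub> g = - g"
    by (rule P.minus_equality) (use assms in auto)
  then have "f \<ominus>\<^bsub>pair_ring L\<^esub> g = f - g" by (simp add: a_minus_def)
  then have "f \<in> proj g"
    using I.a_rcos_module_minus[OF P.ring_axioms assms(2,1)] assms(3) by simp
  then show ?thesis using I.a_repr_independence' assms by metis
qed

lemma proj_eqD:
  assumes "f \<in> carrier (pair_ring L)" "g \<in> carrier (pair_ring L)" "proj f = proj g"
  shows "f - g \<in> tensor_ideal F L"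
proof -
  have "\<ominus>\<^bsub>pair_ring L\<^esub> g = - g"
    by (rule P.minus_equality) (use assms in auto)
  then have "f \<ominus>\<^bsub>pair_ring L\<^esub> g = f - g" by (simp add: a_minus_def)
  moreover have "f \<in> proj g" using I.a_rcos_self[OF assms(1)] assms(3) by simp
  ultimately show ?thesis
    using I.a_rcos_module_minus[OF P.ring_axioms assms(2,1)] by simp
qed

lemma proj_surj: "Y \<in> carrier TT \<Longrightarrow> \<exists>g. g \<in> carrier (pair_ring L) \<and> Y = proj g"
  unfolding tensor_ring_def FactRing_def A_RCOSETS_def' by auto

lemma pt_closed [intro, simp]: "a \<in> L \<Longrightarrow> b \<in> L \<Longrightarrow> pt a b \<in> carrier TT"
  unfolding pure_tensor_def by (rule proj.hom_closed[OF single_carrier])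

lemma pt_mult: "a \<in> L \<Longrightarrow> b \<in> L \<Longrightarrow> a' \<in> L \<Longrightarrow> b' \<in> L \<Longrightarrow> pt a b \<otimes>\<^bsub>TT\<^esub> pt a' b' = pt (a * a') (b * b')"
  unfolding pure_tensor_def
  using proj.hom_mult[OF single_carrier[of a b] single_carrier[of a' b']] by simp

lemma pt_one: "pt 1 1 = \<one>\<^bsub>TT\<^esub>"
  unfolding pure_tensor_def using proj.hom_one by simp

lemma pt_add_left: "a \<in> L \<Longrightarrow> a' \<in> L \<Longrightarrow> b \<in> L \<Longrightarrow> pt (a + a') b = pt a b \<oplus>\<^bsub>TT\<^esub> pt a' b"
  and pt_add_right: "a \<in> L \<Longrightarrow> b \<in> L \<Longrightarrow> b' \<in> L \<Longrightarrow> pt a (b + b') = pt a b \<oplus>\<^bsub>TT\<^esub> pt a b'"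
  and pt_balanced: "c \<in> F \<Longrightarrow> a \<in> L \<Longrightarrow> b \<in> L \<Longrightarrow> pt (c * a) b = pt a (c * b)"
proof -
  let ?e = "\<lambda>a b. frag_of (a, b)"
  have rel: "tensor_relations F L \<subseteq> tensor_ideal F L"
    unfolding tensor_ideal_def by (rule P.genideal_self[OF relations_carrier])
  { assume *: "a \<in> L" "a' \<in> L" "b \<in> L"
    have "?e (a + a') b - (?e a b + ?e a' b) \<in> tensor_relations F L"
      unfolding tensor_relations_def Let_def using * by (auto simp: diff_diff_eq)
    then have "proj (?e (a + a') b) = proj (?e a b + ?e a' b)"
      using * rel by (intro proj_eqI pair_ring_closed(2) single_carrier) (auto intro: add_L)
    then show "pt (a + a') b = pt a b \<oplus>\<^bsub>TT\<^esub> pt a' b"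
      unfolding pure_tensor_def using proj.hom_add[OF single_carrier[of a b] single_carrier[of a' b]] * by simp }
  { assume *: "a \<in> L" "b \<in> L" "b' \<in> L"
    have "?e a (b + b') - (?e a b + ?e a b') \<in> tensor_relations F L"
      unfolding tensor_relations_def Let_def using * by (auto simp: diff_diff_eq)
    then have "proj (?e a (b + b')) = proj (?e a b + ?e a b')"
      using * rel by (intro proj_eqI pair_ring_closed(2) single_carrier) (auto intro: add_L)
    then show "pt a (b + b') = pt a b \<oplus>\<^bsub>TT\<^esub> pt a b'"
      unfolding pure_tensor_def using proj.hom_add[OF single_carrier[of a b] single_carrier[of a b']] * by simp }
  assume *: "c \<in> F" "a \<in> L" "b \<in> L"
  have "?e (c * a) b - ?e a (c * b) \<in> tensor_relations F L"
    unfolding tensor_relations_def Let_def using * by auto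
  then show "pt (c * a) b = pt a (c * b)"
    unfolding pure_tensor_def using * rel F_L by (intro proj_eqI single_carrier mult_L) auto
qed

end

section \<open>Functionals on the tensor ring and their partial multiplicativity\<close>

locale tensor_functional = subring_pair F L for F L :: "'x::comm_ring_1 set" +
  fixes \<phi> :: "'x \<Rightarrow> 'x"
  assumes phi_add: "\<And>x y. x \<in> L \<Longrightarrow> y \<in> L \<Longrightarrow> \<phi> (x + y) = \<phi> x + \<phi> y"
    and phi_scale: "\<And>c x. c \<in> F \<Longrightarrow> x \<in> L \<Longrightarrow> \<phi> (c * x) = c * \<phi> x"
begin

text \<open>\<open>\<phi>\<close> is not multiplicative, so the kernel of
  \<open>tensor_map \<phi>\<close> need not be an ideal. The set \<open>J\<close> of elements all of
  whose multiples by generators lie in the kernel is one, and it contains the relations because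
  \<open>\<phi>\<close> is additive and \<open>F\<close>-linear.\<close>

lemma tensor_map_ideal:
  assumes "f \<in> tensor_ideal F L"
  shows "tensor_map \<phi> f = 0"
proof -
  define J where "J = {f \<in> carrier (pair_ring L). \<forall>a\<in>L. \<forall>b\<in>L. tensor_map \<phi> (pair_mult (frag_of (a, b)) f) = 0}"
  have J_mult: "pair_mult g f \<in> J" if f: "f \<in> J" and g: "g \<in> carrier (pair_ring L)" for f g
  proof -
    have "tensor_map \<phi> (pair_mult (frag_of (a, b)) (pair_mult g f)) = 0" if ab: "a \<in> L" "b \<in> L" for a b
    proof -
      have "Poly_Mapping.keys g \<subseteq> L \<times> L" using g by simp
      then show ?thesis
      proof (induction g rule: frag_induction)
        case (one x)
        then have "a * fst x \<in> L" "b * snd x \<in> L" using ab mult_L by auto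
        then show ?case using f by (simp add: J_def flip: pair_mult_assoc)
      qed (simp_all add: pair_mult_distribs tensor_map_diff)
    qed
    moreover have "pair_mult g f \<in> carrier (pair_ring L)" using f g pair_mult_closed by (simp add: J_def)
    ultimately show ?thesis by (simp add: J_def)
  qed
  have "ideal J (pair_ring L)"
  proof (rule idealI[OF P.ring_axioms])
    show "subgroup J (add_monoid (pair_ring L))"
    proof (rule group.subgroupI)
      show "group (add_monoid (pair_ring L))" by (rule P.a_group)
      fix f assume f: "f \<in> J"
      then have "\<ominus>\<^bsub>pair_ring L\<^esub> f = 0 - f" by (intro P.minus_equality) (auto simp: J_def)
      moreover have "0 - f \<in> J" using f by (simp add: J_def pair_mult_uminus_right tensor_map_uminus)
      ultimately show "inv\<^bsub>add_monoid (pair_ring L)\<^esub> f \<in> J" by (simp add: a_inv_def)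
      fix g assume "g \<in> J"
      then show "f \<otimes>\<^bsub>add_monoid (pair_ring L)\<^esub> g \<in> J"
        using f pair_diff_closed(2)[of f g] by (auto simp: J_def pair_mult_distribs tensor_map_add)
    next
      have "0 \<in> J" by (simp add: J_def)
      then show "J \<noteq> {}" by blast
    qed (auto simp: J_def)
  qed (use J_mult in \<open>auto simp: pair_mult_comm\<close>)
  moreover have "tensor_relations F L \<subseteq> J"
  proof
    fix r assume r: "r \<in> tensor_relations F L"
    then have "r \<in> carrier (pair_ring L)" using relations_carrier by blast
    moreover have "\<forall>a\<in>L. \<forall>b\<in>L. tensor_map \<phi> (pair_mult (frag_of (a, b)) r) = 0"
    proof (intro ballI)
      fix a b assume ab: "a \<in> L" "b \<in> L"
      have scale: "\<phi> (a * (c * d)) = c * \<phi> (a * d)" if "c \<in> F" "d \<in> L" for c d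
        using phi_scale[OF that(1) mult_L[OF ab(1) that(2)]] by (simp add: mult_ac)
      show "tensor_map \<phi> (pair_mult (frag_of (a, b)) r) = 0"
        using r unfolding tensor_relations_def Let_def
        by (elim UnE CollectE exE conjE; hypsubst;
            simp add: pair_mult_distribs tensor_map_diff distrib_left phi_add mult_L ab scale;
            simp add: algebra_simps)
    qed
    ultimately show "r \<in> J" by (simp add: J_def)
  qed
  ultimately have "tensor_ideal F L \<subseteq> J"
    unfolding tensor_ideal_def by (rule P.genideal_minimal)
  then have "f \<in> J" using assms by blast
  then show ?thesis unfolding J_def using one_L by (auto simp: pair_mult_1 dest!: bspec[of _ _ 1])
qed

text \<open>Descent of \<open>tensor_map \<phi>\<close> to the quotient; \<open>Theta_proj\<close>
  shows that the chosen representative does not matter.\<close>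

definition \<Theta> where "\<Theta> U = tensor_map \<phi> (SOME f. f \<in> carrier (pair_ring L) \<and> U = proj f)"

lemma Theta_proj:
  assumes f: "f \<in> carrier (pair_ring L)"
  shows "\<Theta> (proj f) = tensor_map \<phi> f"
proof -
  define g where "g = (SOME g. g \<in> carrier (pair_ring L) \<and> proj f = proj g)"
  have g: "g \<in> carrier (pair_ring L)" "proj f = proj g"
    using someI[of "\<lambda>g. g \<in> carrier (pair_ring L) \<and> proj f = proj g" f] f unfolding g_def by blast+
  have "tensor_map \<phi> (f - g) = 0" by (rule tensor_map_ideal[OF proj_eqD[OF f g]])
  then show ?thesis unfolding \<Theta>_def g_def[symmetric] by (simp add: tensor_map_diff)
qed

lemma Theta_zero: "\<Theta> \<zero>\<^bsub>TT\<^esub> = 0"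
  using Theta_proj[of 0] proj.hom_zero by simp

lemma Theta_add:
  assumes "U \<in> carrier TT" "Y \<in> carrier TT"
  shows "\<Theta> (U \<oplus>\<^bsub>TT\<^esub> Y) = \<Theta> U + \<Theta> Y"
proof -
  obtain f g where fg: "f \<in> carrier (pair_ring L)" "U = proj f" "g \<in> carrier (pair_ring L)" "Y = proj g"
    using assms proj_surj by metis
  then have "f + g \<in> carrier (pair_ring L)" using pair_ring_closed(2) by blast
  then show ?thesis
    using proj.hom_add[OF fg(1,3)] Theta_proj[of "f + g"] Theta_proj[OF fg(1)] Theta_proj[OF fg(3)]
    by (simp add: tensor_map_add fg(2,4))
qed

lemma Theta_sum:
  assumes "finite A" "\<And>i. i \<in> A \<Longrightarrow> U i \<in> carrier TT"
  shows "\<Theta> (\<Oplus>\<^bsub>TT\<^esub>i\<in>A. U i) = (\<Sum>i\<in>A. \<Theta> (U i))"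
  using assms by (induction A rule: finite_induct) (auto simp: Theta_zero Theta_add T.finsum_closed Pi_def)

lemma Theta_pt_right:
  assumes "b \<in> L" "U \<in> carrier TT"
  shows "\<Theta> (pt 1 b \<otimes>\<^bsub>TT\<^esub> U) = b * \<Theta> U"
proof -
  obtain f where f: "f \<in> carrier (pair_ring L)" "U = proj f" using proj_surj[OF assms(2)] by blast
  have "pair_mult (frag_of (1, b)) f \<in> carrier (pair_ring L)"
    by (intro pair_ring_closed(3) single_carrier one_L assms f)
  then show ?thesis
    unfolding pure_tensor_def f(2)
    using proj.hom_mult[OF single_carrier[OF one_L assms(1)] f(1)] Theta_proj[OF f(1)]
      Theta_proj[of "pair_mult (frag_of (1, b)) f"]
    by (simp add: tensor_map_mult_right)
qed

lemma Theta_pt: "a \<in> L \<Longrightarrow> b \<in> L \<Longrightarrow> \<Theta> (pt a b) = \<phi> a * b"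
  unfolding pure_tensor_def by (subst Theta_proj) simp_all

end

text \<open>\<open>\<phi>\<close> acts as the evaluation \<open>v i \<mapsto> y i\<close> on
  monomials in \<open>v\<close>, without being a ring homomorphism. This suffices to make
  \<open>\<Theta>\<close> multiplicative on products of sums of tensors
  \<open>v i \<otimes> b\<close>.\<close>

locale multiplicative_functional = tensor_functional F L \<phi> for F L :: "'x::comm_ring_1 set" and \<phi> +
  fixes v y :: "nat \<Rightarrow> 'x"
  assumes v_L: "\<And>i. v i \<in> L" and phi_v: "\<And>m. \<phi> (\<Prod>j\<in>#m. v j) = (\<Prod>j\<in>#m. y j)"
begin

lemma v_prod_L: "(\<Prod>j\<in>#m. v j) \<in> L"
  by (induction m) (auto intro: one_L mult_L v_L)

text \<open>Elements from which a monomial in \<open>v\<close> on the left factor can be pulled out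
  of \<open>\<Theta>\<close>. The property passes to sums and to products with
  \<open>v i \<otimes> b\<close>, so it can be carried through an induction.\<close>

definition good where
  "good Y \<longleftrightarrow> Y \<in> carrier TT \<and> (\<forall>m. \<Theta> (pt (\<Prod>j\<in>#m. v j) 1 \<otimes>\<^bsub>TT\<^esub> Y) = (\<Prod>j\<in>#m. y j) * \<Theta> Y)"

lemma Theta_one: "\<Theta> \<one>\<^bsub>TT\<^esub> = 1"
  using Theta_pt[of 1 1] phi_v[of "{#}"] one_L by (simp add: pt_one)

lemma good_one: "good \<one>\<^bsub>TT\<^esub>"
  unfolding good_def by (simp add: v_prod_L one_L Theta_pt phi_v Theta_one)

lemma good_add: "good U \<Longrightarrow> good Y \<Longrightarrow> good (U \<oplus>\<^bsub>TT\<^esub> Y)"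
  unfolding good_def by (simp add: T.r_distr v_prod_L one_L Theta_add algebra_simps)

lemma good_zero: "good \<zero>\<^bsub>TT\<^esub>"
  unfolding good_def by (simp add: v_prod_L one_L Theta_zero)

lemma good_sum:
  assumes "finite A" "\<And>i. i \<in> A \<Longrightarrow> good (U i)"
  shows "good (\<Oplus>\<^bsub>TT\<^esub>i\<in>A. U i)"
  using assms
proof (induction A rule: finite_induct)
  case (insert i A)
  have "U j \<in> carrier TT" if "j \<in> insert i A" for j using insert.prems[OF that] by (simp add: good_def)
  then have "(\<Oplus>\<^bsub>TT\<^esub>i\<in>insert i A. U i) = U i \<oplus>\<^bsub>TT\<^esub> (\<Oplus>\<^bsub>TT\<^esub>i\<in>A. U i)"
    using insert.hyps by (intro T.finsum_insert) auto
  then show ?case using insert by (simp add: good_add)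
qed (simp add: good_zero)

lemma good_step:
  assumes "b \<in> L" "good Y"
  shows "good (pt (v i) b \<otimes>\<^bsub>TT\<^esub> Y)" "\<Theta> (pt (v i) b \<otimes>\<^bsub>TT\<^esub> Y) = y i * b * \<Theta> Y"
proof -
  have Y: "Y \<in> carrier TT" using assms(2) by (simp add: good_def)
  have *: "\<Theta> (pt (\<Prod>j\<in>#m. v j) 1 \<otimes>\<^bsub>TT\<^esub> (pt (v i) b \<otimes>\<^bsub>TT\<^esub> Y)) = (\<Prod>j\<in>#m. y j) * (y i * b * \<Theta> Y)" for m
  proof -
    \<comment> \<open>The left factor \<open>v i\<close> joins the monomial, and the right factor
      \<open>b\<close> leaves by linearity of \<open>\<Theta>\<close>.\<close>
    have "pt (\<Prod>j\<in>#m. v j) 1 \<otimes>\<^bsub>TT\<^esub> (pt (v i) b \<otimes>\<^bsub>TT\<^esub> Y) = pt 1 b \<otimes>\<^bsub>TT\<^esub> (pt (\<Prod>j\<in>#add_mset i m. v j) 1 \<otimes>\<^bsub>TT\<^esub> Y)"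
      using Y assms(1) by (simp add: T.m_assoc[symmetric] pt_mult v_prod_L v_L one_L mult_L mult_ac)
    also have "\<Theta> \<dots> = b * \<Theta> (pt (\<Prod>j\<in>#add_mset i m. v j) 1 \<otimes>\<^bsub>TT\<^esub> Y)"
      by (rule Theta_pt_right[OF assms(1)]) (intro T.m_closed pt_closed v_prod_L one_L Y)
    also have "\<Theta> (pt (\<Prod>j\<in>#add_mset i m. v j) 1 \<otimes>\<^bsub>TT\<^esub> Y) = (\<Prod>j\<in>#add_mset i m. y j) * \<Theta> Y"
      using assms(2) unfolding good_def by blast
    finally show ?thesis by (simp add: mult_ac)
  qed
  show **: "\<Theta> (pt (v i) b \<otimes>\<^bsub>TT\<^esub> Y) = y i * b * \<Theta> Y"
    using *[of "{#}"] Y assms(1) by (simp add: pt_one v_L)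
  show "good (pt (v i) b \<otimes>\<^bsub>TT\<^esub> Y)"
    unfolding good_def using * ** Y assms(1) v_L by simp
qed

lemma good_sum_step:
  assumes u: "\<And>i. i \<in> A \<Longrightarrow> u i \<in> L" and "finite A" and Y: "good Y"
    and U: "U = (\<Oplus>\<^bsub>TT\<^esub>i\<in>A. pt (v i) (u i))"
  shows "good (U \<otimes>\<^bsub>TT\<^esub> Y)" "\<Theta> (U \<otimes>\<^bsub>TT\<^esub> Y) = (\<Sum>i\<in>A. y i * u i) * \<Theta> Y"
proof -
  have YT: "Y \<in> carrier TT" using Y by (simp add: good_def)
  have "U \<otimes>\<^bsub>TT\<^esub> Y = (\<Oplus>\<^bsub>TT\<^esub>i\<in>A. pt (v i) (u i) \<otimes>\<^bsub>TT\<^esub> Y)"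
    unfolding U by (rule T.finsum_ldistr) (use assms(2) YT u v_L in auto)
  moreover have "good (\<Oplus>\<^bsub>TT\<^esub>i\<in>A. pt (v i) (u i) \<otimes>\<^bsub>TT\<^esub> Y)"
    by (rule good_sum[OF assms(2)]) (rule good_step(1)[OF u Y])
  moreover have "\<Theta> (\<Oplus>\<^bsub>TT\<^esub>i\<in>A. pt (v i) (u i) \<otimes>\<^bsub>TT\<^esub> Y) = (\<Sum>i\<in>A. y i * u i * \<Theta> Y)"
    by (subst Theta_sum[OF assms(2)]) (auto simp: u v_L YT good_step(2)[OF _ Y] intro!: sum.cong)
  ultimately show "good (U \<otimes>\<^bsub>TT\<^esub> Y)" "\<Theta> (U \<otimes>\<^bsub>TT\<^esub> Y) = (\<Sum>i\<in>A. y i * u i) * \<Theta> Y"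
    by (simp_all add: sum_distrib_right)
qed

lemma Theta_monomial:
  assumes u: "\<And>i. u i \<in> L" and U: "\<And>j. U j = (\<Oplus>\<^bsub>TT\<^esub>i\<in>{..j}. pt (v i) (u (j - i)))" and "finite A"
  shows "good (\<Otimes>\<^bsub>TT\<^esub>j\<in>A. U j [^]\<^bsub>TT\<^esub> (e j :: nat)) \<and>
    \<Theta> (\<Otimes>\<^bsub>TT\<^esub>j\<in>A. U j [^]\<^bsub>TT\<^esub> e j) = (\<Prod>j\<in>A. (\<Sum>i\<le>j. y i * u (j - i)) ^ e j)"
  using assms(3)
proof (induction A rule: finite_induct)
  case empty
  then show ?case by (simp add: good_one Theta_one)
next
  case (insert j A)
  have X_T: "U j \<in> carrier TT" for j unfolding U by (intro T.finsum_closed) (auto simp: u v_L)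
  let ?z = "\<Sum>i\<le>j. y i * u (j - i)"
  let ?Y = "\<Otimes>\<^bsub>TT\<^esub>j\<in>A. U j [^]\<^bsub>TT\<^esub> e j"
  have Y: "?Y \<in> carrier TT" using X_T by (intro T.finprod_closed) auto
  have "good (U j [^]\<^bsub>TT\<^esub> n \<otimes>\<^bsub>TT\<^esub> ?Y) \<and> \<Theta> (U j [^]\<^bsub>TT\<^esub> n \<otimes>\<^bsub>TT\<^esub> ?Y) = ?z ^ n * \<Theta> ?Y" for n :: nat
  proof (induction n)
    case 0
    then show ?case using insert.IH Y by simp
  next
    case (Suc n)
    have "U j [^]\<^bsub>TT\<^esub> Suc n \<otimes>\<^bsub>TT\<^esub> ?Y = U j \<otimes>\<^bsub>TT\<^esub> (U j [^]\<^bsub>TT\<^esub> n \<otimes>\<^bsub>TT\<^esub> ?Y)"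
      using X_T Y by (simp add: T.m_assoc T.m_lcomm)
    then show ?case
      using good_sum_step[where A = "{..j}" and u = "\<lambda>i. u (j - i)", OF u finite_atMost conjunct1[OF Suc] U] Suc
      by (simp add: U mult_ac)
  qed
  then show ?case
    using insert X_T Y by (simp add: T.finprod_insert Pi_def)
qed

end

text \<open>The vector space locale takes its scalars from a field type, so the rational functions
  are represented by \<open>'c poly fract\<close> and embedded in the Laurent series.\<close>

definition fract_fls :: "'c::field poly fract \<Rightarrow> 'c fls" where
  "fract_fls x = (THE h. \<forall>p q. q \<noteq> 0 \<longrightarrow> x = Fract p q \<longrightarrow> h = poly_fls p / poly_fls q)"

lemma fract_fls_Fract:
  assumes "q \<noteq> 0"
  shows "fract_fls (Fract p q) = poly_fls p / poly_fls q"
proof -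
  have *: "poly_fls p / poly_fls q = poly_fls p' / poly_fls q'" if "q' \<noteq> 0" "Fract p q = Fract p' q'" for p' q'
  proof -
    have "p * q' = p' * q" using that assms by (simp add: eq_fract)
    then have "poly_fls p * poly_fls q' = poly_fls p' * poly_fls q"
      by (simp only: flip: poly_fls.hom_mult)
    then show ?thesis using that assms by (simp add: frac_eq_eq)
  qed
  show ?thesis
    unfolding fract_fls_def by (rule the_equality) (use * assms in blast)+
qed

lemma fract_fls_rat: "fract_fls x \<in> rat_funs UNIV"
  by (cases x) (auto simp: fract_fls_Fract intro: rat_funsI)

lemma rat_funs_fract_fls:
  assumes "h \<in> rat_funs UNIV"
  obtains x where "h = fract_fls x"
proof -
  obtain p q where "q \<noteq> 0" "h = poly_fls p / poly_fls q" using assms unfolding rat_funs_def by blast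
  then show ?thesis using that[of "Fract p q"] by (simp add: fract_fls_Fract)
qed

lemma fract_fls_hom:
  "fract_fls (x + y) = fract_fls x + fract_fls y" "fract_fls (x * y) = fract_fls x * fract_fls y"
  "fract_fls 1 = 1" "fract_fls x = 0 \<longleftrightarrow> x = 0"
proof -
  obtain p q p' q' where *: "x = Fract p q" "q \<noteq> 0" "y = Fract p' q'" "q' \<noteq> 0"
    by (metis Fract_cases)
  then show "fract_fls (x + y) = fract_fls x + fract_fls y" "fract_fls (x * y) = fract_fls x * fract_fls y"
    by (simp_all add: fract_fls_Fract add_frac_eq fps_of_poly_add fps_of_poly_mult fls_times_fps_to_fls)
  show "fract_fls 1 = 1" by (simp add: One_fract_def fract_fls_Fract)
  show "fract_fls x = 0 \<longleftrightarrow> x = 0"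
    using * by (simp add: fract_fls_Fract Zero_fract_def eq_fract)
qed

interpretation fls_space: vector_space "\<lambda>x f. fract_fls x * f"
  by unfold_locales (simp_all add: fract_fls_hom algebra_simps)

interpretation fls_space: vector_space_pair "\<lambda>x f. fract_fls x * f" "\<lambda>x f. fract_fls x * f" ..

text \<open>By algebraic independence the monomials in the hyperderivatives are distinct and
  linearly independent over the rational functions. A linear map can thus be prescribed on them,
  here by the monomials in an arbitrary \<open>y\<close>, and extended to all Laurent
  series.\<close>

lemma (in frob_chain) multiplicative_functional_exists:
  assumes nz: "\<Omega> \<noteq> 0" and tau_Omega: "tau \<Omega> = b * \<Omega>"
  obtains \<phi> :: "'c fls \<Rightarrow> 'c fls" where "\<And>x y. \<phi> (x + y) = \<phi> x + \<phi> y"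
    "\<And>c x. c \<in> rat_funs UNIV \<Longrightarrow> \<phi> (c * x) = c * \<phi> x"
    "\<And>m. \<phi> (\<Prod>j\<in>#m. hyperderiv j \<Omega>) = (\<Prod>j\<in>#m. y j)"
proof -
  define V where "V = (\<lambda>m. \<Prod>j\<in>#m. hyperderiv j \<Omega>)"
  note indep = hyperderiv_alg_independent[OF nz tau_Omega]
  have inj: "inj V"
  proof (rule injI, rule ccontr)
    fix m m' assume V: "V m = V m'" "m \<noteq> m'"
    define c where "c = (\<lambda>i. if i = m then 1 else if i = m' then -1 else (0 :: 'c fls))"
    have supp: "{i. c i \<noteq> 0} \<subseteq> {m, m'}" by (auto simp: c_def)
    have fin: "finite {i. c i \<noteq> 0}" by (rule finite_subset[OF supp]) simp
    have rel: "peval c (\<lambda>j. hyperderiv j \<Omega>) = 0"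
      using V unfolding V_def by (subst peval_superset[OF _ supp]) (simp_all add: c_def)
    have rat: "c i \<in> rat_funs UNIV" for i
      using rat_funs_diff[OF rat_funs_0 rat_funs_1] by (auto simp: c_def intro: rat_funs_0 rat_funs_1)
    have "c m = 0" by (rule indep[OF fin rat rel])
    then show False by (simp add: c_def)
  qed
  have "fls_space.independent (range V)"
    unfolding fls_space.independent_explicit_finite_subsets
  proof (intro allI impI ballI)
    fix S u v assume S: "S \<subseteq> range V" "finite S" "(\<Sum>v\<in>S. fract_fls (u v) * v) = 0" and "v \<in> S"
    then obtain m where m: "v = V m" by blast
    define M where "M = V -` S"
    define c where "c = (\<lambda>m. if m \<in> M then fract_fls (u (V m)) else 0)"
    have M: "finite M" "{m. c m \<noteq> 0} \<subseteq> M"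
      unfolding M_def using finite_vimageI[OF S(2) inj] by (auto simp: c_def M_def)
    have VM: "V ` M = S" using S(1) by (auto simp: M_def)
    have "peval c (\<lambda>j. hyperderiv j \<Omega>) = (\<Sum>m\<in>M. fract_fls (u (V m)) * V m)"
      unfolding peval_superset[OF M] by (intro sum.cong) (auto simp: c_def V_def)
    also have "\<dots> = (\<Sum>v\<in>S. fract_fls (u v) * v)"
      unfolding VM[symmetric] using inj by (subst sum.reindex) (auto simp: inj_on_def inj_def)
    finally have rel: "peval c (\<lambda>j. hyperderiv j \<Omega>) = 0" using S(3) by simp
    have fin: "finite {m. c m \<noteq> 0}" by (rule finite_subset[OF M(2,1)])
    have rat: "c i \<in> rat_funs UNIV" for i by (simp add: c_def fract_fls_rat rat_funs_0)
    have "c m = 0" by (rule indep[OF fin rat rel])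
    then show "u v = 0" using m \<open>v \<in> S\<close> by (simp add: c_def M_def fract_fls_hom)
  qed
  from fls_space.linear_independent_extend[OF this, of "\<lambda>v. \<Prod>j\<in>#inv_into UNIV V v. y j"]
  obtain \<phi> where \<phi>: "Vector_Spaces.linear (\<lambda>x f. fract_fls x * f) (\<lambda>x f. fract_fls x * f) \<phi>"
    "\<forall>v\<in>range V. \<phi> v = (\<Prod>j\<in>#inv_into UNIV V v. y j)"
    by blast
  interpret \<phi>: Vector_Spaces.linear "\<lambda>x f. fract_fls x * f" "\<lambda>x f. fract_fls x * f" \<phi> by fact
  show ?thesis
  proof (rule that)
    show "\<phi> (c * x) = c * \<phi> x" if rat: "c \<in> rat_funs UNIV" for c x
    proof -
      obtain a where "c = fract_fls a" using rat_funs_fract_fls[OF rat] by blast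
      then show ?thesis using \<phi>.scale by simp
    qed
    show "\<phi> (\<Prod>j\<in>#m. hyperderiv j \<Omega>) = (\<Prod>j\<in>#m. y j)" for m
    proof -
      have "\<phi> (V m) = (\<Prod>j\<in>#m. y j)" using \<phi>(2) inj by simp
      then show ?thesis by (simp only: V_def)
    qed
  qed (rule \<phi>.add)
qed

section \<open>Toeplitz matrices over commutative rings\<close>

definition toeplitz :: "('r, 'm) ring_scheme \<Rightarrow> nat \<Rightarrow> (nat \<Rightarrow> 'r) \<Rightarrow> 'r mat" where
  "toeplitz R n a = mat n n (\<lambda>(i, j). if i \<le> j then a (j - i) else \<zero>\<^bsub>R\<^esub>)"

text \<open>Product of power series: the upper triangular Toeplitz matrices of size \<open>n\<close>
  form \<open>R[T]/(T^n)\<close>, with \<open>T\<close> the superdiagonal shift.\<close>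

definition conv :: "('r, 'm) ring_scheme \<Rightarrow> (nat \<Rightarrow> 'r) \<Rightarrow> (nat \<Rightarrow> 'r) \<Rightarrow> nat \<Rightarrow> 'r" where
  "conv R a c m = (\<Oplus>\<^bsub>R\<^esub>l\<in>{..m}. a l \<otimes>\<^bsub>R\<^esub> c (m - l))"

definition mset_prod :: "('r, 'm) ring_scheme \<Rightarrow> ('i \<Rightarrow> 'r) \<Rightarrow> 'i multiset \<Rightarrow> 'r" where
  "mset_prod R a m = (\<Otimes>\<^bsub>R\<^esub>x\<in>set_mset m. a x [^]\<^bsub>R\<^esub> count m x)"

lemma toeplitz_carrier [simp]: "toeplitz R n a \<in> carrier_mat n n"
  by (simp add: toeplitz_def)

lemma toeplitz_index [simp]:
  "i < n \<Longrightarrow> j < n \<Longrightarrow> toeplitz R n a $$ (i, j) = (if i \<le> j then a (j - i) else \<zero>\<^bsub>R\<^esub>)"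
  by (simp add: toeplitz_def)

lemma toeplitz_cong: "(\<And>i. i < n \<Longrightarrow> a i = c i) \<Longrightarrow> toeplitz R n a = toeplitz R n c"
  by (rule eq_matI) (auto simp: toeplitz_def)

context cring
begin

lemma finsum_swap:
  assumes "finite A" "\<And>i j. i \<in> A \<Longrightarrow> j \<in> B \<Longrightarrow> f i j \<in> carrier R"
  shows "(\<Oplus>i\<in>A. \<Oplus>j\<in>B. f i j) = (\<Oplus>j\<in>B. \<Oplus>i\<in>A. f i j)"
  using assms
proof (induction A rule: finite_induct)
  case (insert i A)
  have "(\<Oplus>i\<in>insert i A. \<Oplus>j\<in>B. f i j) = (\<Oplus>j\<in>B. f i j) \<oplus> (\<Oplus>j\<in>B. \<Oplus>i\<in>A. f i j)"
    using insert by (subst finsum_insert) (auto intro!: finsum_closed)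
  also have "\<dots> = (\<Oplus>j\<in>B. f i j \<oplus> (\<Oplus>i\<in>A. f i j))"
    using insert.prems by (subst finsum_addf) (auto intro!: finsum_closed)
  also have "\<dots> = (\<Oplus>j\<in>B. \<Oplus>i\<in>insert i A. f i j)"
    using insert by (intro finsum_cong') (auto intro!: finsum_closed)
  finally show ?case .
qed (simp add: finsum_zero)

abbreviation "MM \<equiv> mat_monoid R"

lemma mat_monoid_mult_index:
  "i < n \<Longrightarrow> j < n \<Longrightarrow> (A \<otimes>\<^bsub>MM n\<^esub> B) $$ (i, j) = (\<Oplus>l\<in>{..<n}. A $$ (i, l) \<otimes> B $$ (l, j))"
  by (simp add: mat_monoid_def)

lemma mat_monoid_carrierD:
  assumes "A \<in> carrier (MM n)"
  shows "A \<in> carrier_mat n n" "i < n \<Longrightarrow> j < n \<Longrightarrow> A $$ (i, j) \<in> carrier R"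
  using assms by (simp_all add: mat_monoid_def)

lemma mat_monoid_mult_closed:
  assumes "A \<in> carrier (MM n)" "B \<in> carrier (MM n)"
  shows "A \<otimes>\<^bsub>MM n\<^esub> B \<in> carrier (MM n)"
  using assms by (auto simp: mat_monoid_def intro!: finsum_closed)

lemma mat_monoid_eqI:
  assumes "A \<in> carrier (MM n)" "B \<in> carrier (MM n)"
    "\<And>i j. i < n \<Longrightarrow> j < n \<Longrightarrow> A $$ (i, j) = B $$ (i, j)"
  shows "A = B"
  using assms by (intro eq_matI) (auto simp: mat_monoid_def)

lemma mat_monoid_one: "\<one>\<^bsub>MM n\<^esub> = toeplitz R n (\<lambda>i. if i = 0 then \<one> else \<zero>)"
  by (rule eq_matI) (auto simp: mat_monoid_def toeplitz_def)

lemma toeplitz_closed: "(\<And>i. i < n \<Longrightarrow> a i \<in> carrier R) \<Longrightarrow> toeplitz R n a \<in> carrier (MM n)"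
  by (auto simp: mat_monoid_def)

lemma monoid_mat_monoid: "monoid (MM n)"
proof (rule monoidI)
  show one: "\<one>\<^bsub>MM n\<^esub> \<in> carrier (MM n)"
    unfolding mat_monoid_one by (rule toeplitz_closed) simp
  fix A assume A: "A \<in> carrier (MM n)"
  note AR = mat_monoid_carrierD(2)[OF A]
  have one_index: "\<one>\<^bsub>MM n\<^esub> $$ (i, j) = (if i = j then \<one> else \<zero>)" if "i < n" "j < n" for i j
    using that by (simp add: mat_monoid_def)
  show "\<one>\<^bsub>MM n\<^esub> \<otimes>\<^bsub>MM n\<^esub> A = A"
  proof (rule mat_monoid_eqI[OF mat_monoid_mult_closed[OF one A] A])
    fix i j assume ij: "i < n" "j < n"
    have "(\<Oplus>l\<in>{..<n}. \<one>\<^bsub>MM n\<^esub> $$ (i, l) \<otimes> A $$ (l, j)) = (\<Oplus>l\<in>{..<n}. if i = l then A $$ (l, j) else \<zero>)"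
      using ij AR by (intro finsum_cong') (auto simp: one_index)
    then show "(\<one>\<^bsub>MM n\<^esub> \<otimes>\<^bsub>MM n\<^esub> A) $$ (i, j) = A $$ (i, j)"
      using ij AR by (simp add: mat_monoid_mult_index finsum_singleton Pi_def)
  qed
  show "A \<otimes>\<^bsub>MM n\<^esub> \<one>\<^bsub>MM n\<^esub> = A"
  proof (rule mat_monoid_eqI[OF mat_monoid_mult_closed[OF A one] A])
    fix i j assume ij: "i < n" "j < n"
    have "(\<Oplus>l\<in>{..<n}. A $$ (i, l) \<otimes> \<one>\<^bsub>MM n\<^esub> $$ (l, j)) = (\<Oplus>l\<in>{..<n}. if j = l then A $$ (i, l) else \<zero>)"
      using ij AR by (intro finsum_cong') (auto simp: one_index)
    then show "(A \<otimes>\<^bsub>MM n\<^esub> \<one>\<^bsub>MM n\<^esub>) $$ (i, j) = A $$ (i, j)"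
      using ij AR by (simp add: mat_monoid_mult_index finsum_singleton Pi_def)
  qed
  fix B assume B: "B \<in> carrier (MM n)"
  note BR = mat_monoid_carrierD(2)[OF B]
  show "A \<otimes>\<^bsub>MM n\<^esub> B \<in> carrier (MM n)"
    by (rule mat_monoid_mult_closed[OF A B])
  fix C assume C: "C \<in> carrier (MM n)"
  note CR = mat_monoid_carrierD(2)[OF C]
  show "A \<otimes>\<^bsub>MM n\<^esub> B \<otimes>\<^bsub>MM n\<^esub> C = A \<otimes>\<^bsub>MM n\<^esub> (B \<otimes>\<^bsub>MM n\<^esub> C)"
  proof (rule mat_monoid_eqI)
    fix i j assume ij: "i < n" "j < n"
    have "(A \<otimes>\<^bsub>MM n\<^esub> B \<otimes>\<^bsub>MM n\<^esub> C) $$ (i, j) =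
        (\<Oplus>l\<in>{..<n}. \<Oplus>m\<in>{..<n}. A $$ (i, m) \<otimes> B $$ (m, l) \<otimes> C $$ (l, j))"
      using ij AR BR CR
      by (simp add: mat_monoid_mult_index) (intro finsum_cong', auto simp: mat_monoid_mult_index finsum_ldistr Pi_def intro!: finsum_closed)
    also have "\<dots> = (\<Oplus>m\<in>{..<n}. \<Oplus>l\<in>{..<n}. A $$ (i, m) \<otimes> B $$ (m, l) \<otimes> C $$ (l, j))"
      using ij AR BR CR by (intro finsum_swap) auto
    also have "\<dots> = (A \<otimes>\<^bsub>MM n\<^esub> (B \<otimes>\<^bsub>MM n\<^esub> C)) $$ (i, j)"
      using ij AR BR CR
      by (simp add: mat_monoid_mult_index) (intro finsum_cong', auto simp: mat_monoid_mult_index finsum_rdistr m_assoc Pi_def intro!: finsum_closed finsum_cong')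
    finally show "(A \<otimes>\<^bsub>MM n\<^esub> B \<otimes>\<^bsub>MM n\<^esub> C) $$ (i, j) =
        (A \<otimes>\<^bsub>MM n\<^esub> (B \<otimes>\<^bsub>MM n\<^esub> C)) $$ (i, j)" .
  qed (intro mat_monoid_mult_closed A B C)+
qed

lemma conv_closed: "(\<And>i. i \<le> m \<Longrightarrow> a i \<in> carrier R) \<Longrightarrow> (\<And>i. i \<le> m \<Longrightarrow> c i \<in> carrier R) \<Longrightarrow> conv R a c m \<in> carrier R"
  unfolding conv_def by (rule finsum_closed) auto

lemma conv_commute:
  assumes "\<And>i. i \<le> m \<Longrightarrow> a i \<in> carrier R" "\<And>i. i \<le> m \<Longrightarrow> c i \<in> carrier R"
  shows "conv R a c m = conv R c a m"
proof -
  have im: "(\<lambda>l. m - l) ` {..m} = {..m}"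
    by (auto simp: image_iff) (metis atMost_iff diff_diff_cancel diff_le_self)
  have "conv R a c m = (\<Oplus>l\<in>(\<lambda>l. m - l) ` {..m}. a l \<otimes> c (m - l))"
    by (simp add: conv_def im)
  also have "\<dots> = (\<Oplus>l\<in>{..m}. a (m - l) \<otimes> c (m - (m - l)))"
    by (rule finsum_reindex) (use assms in \<open>auto simp: inj_on_def\<close>)
  also have "\<dots> = conv R c a m"
    unfolding conv_def using assms by (intro finsum_cong') (auto simp: m_comm)
  finally show ?thesis .
qed

lemma toeplitz_mult:
  assumes a: "\<And>i. i < n \<Longrightarrow> a i \<in> carrier R" and c: "\<And>i. i < n \<Longrightarrow> c i \<in> carrier R"
  shows "toeplitz R n a \<otimes>\<^bsub>MM n\<^esub> toeplitz R n c = toeplitz R n (conv R a c)"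
proof (rule mat_monoid_eqI)
  show "toeplitz R n a \<otimes>\<^bsub>MM n\<^esub> toeplitz R n c \<in> carrier (MM n)"
    by (intro mat_monoid_mult_closed toeplitz_closed a c)
  show "toeplitz R n (conv R a c) \<in> carrier (MM n)"
    using a c by (intro toeplitz_closed conv_closed) auto
  fix i j assume ij: "i < n" "j < n"
  have *: "(toeplitz R n a \<otimes>\<^bsub>MM n\<^esub> toeplitz R n c) $$ (i, j) =
    (\<Oplus>l\<in>{..<n}. toeplitz R n a $$ (i, l) \<otimes> toeplitz R n c $$ (l, j))"
    by (rule mat_monoid_mult_index[OF ij])
  also have "\<dots> = (\<Oplus>l\<in>{i..j}. a (l - i) \<otimes> c (j - l))"
    by (rule add.finprod_mono_neutral_cong_right) (use ij a c in auto)
  also have "\<dots> = toeplitz R n (conv R a c) $$ (i, j)"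
  proof (cases "i \<le> j")
    case True
    then have "{i..j} = (\<lambda>l. i + l) ` {..j - i}"
      by (auto simp: image_iff) (metis atMost_iff diff_le_mono le_add_diff_inverse)
    then have "(\<Oplus>l\<in>{i..j}. a (l - i) \<otimes> c (j - l)) = (\<Oplus>l\<in>(\<lambda>l. i + l) ` {..j - i}. a (l - i) \<otimes> c (j - l))" by simp
    also have "\<dots> = (\<Oplus>l\<in>{..j - i}. a (i + l - i) \<otimes> c (j - (i + l)))"
      by (rule finsum_reindex) (use ij a c in auto)
    finally show ?thesis using True ij by (simp add: conv_def)
  qed (use ij in simp)
  finally show "(toeplitz R n a \<otimes>\<^bsub>MM n\<^esub> toeplitz R n c) $$ (i, j) = toeplitz R n (conv R a c) $$ (i, j)" .
qed

text \<open>Recursion for an inverse power series: the equation of index \<open>n\<close> contains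
  the new coefficient \<open>c n\<close> only in the product with the unit
  \<open>a 0\<close>.\<close>

lemma conv_inverse_exists:
  assumes a: "\<And>i. i < n \<Longrightarrow> a i \<in> carrier R" and unit: "a 0 \<in> Units R"
  shows "\<exists>c. (\<forall>i. c i \<in> carrier R) \<and> (\<forall>m<n. conv R a c m = (if m = 0 then \<one> else \<zero>))"
  using a
proof (induction n)
  case 0
  show ?case by (intro exI[of _ "\<lambda>_. \<zero>"]) simp
next
  case (Suc n)
  then obtain c where c: "\<And>i. c i \<in> carrier R" "\<And>m. m < n \<Longrightarrow> conv R a c m = (if m = 0 then \<one> else \<zero>)"
    by (metis less_Suc_eq)
  define s where "s = (\<Oplus>l\<in>{1..n}. a l \<otimes> c (n - l))"
  define d where "d = (if n = 0 then \<one> else \<zero>)"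
  define e where "e = inv (a 0) \<otimes> (d \<ominus> s)"
  define c' where "c' = c(n := e)"
  have s: "s \<in> carrier R" unfolding s_def using Suc.prems c(1) by (intro finsum_closed) auto
  have d: "d \<in> carrier R" by (simp add: d_def)
  have e: "e \<in> carrier R" using unit s d by (simp add: e_def)
  have c': "c' i \<in> carrier R" for i using c(1) e by (simp add: c'_def)
  have old: "conv R a c' m = conv R a c m" if "m < n" for m
    unfolding conv_def using that Suc.prems c(1) c' by (intro finsum_cong') (auto simp: c'_def)
  have "{..n} = insert 0 {1..n}" by auto
  then have "conv R a c' n = (\<Oplus>l\<in>insert 0 {1..n}. a l \<otimes> c' (n - l))" by (simp add: conv_def)
  also have "\<dots> = a 0 \<otimes> c' n \<oplus> (\<Oplus>l\<in>{1..n}. a l \<otimes> c' (n - l))"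
    using Suc.prems c' by (subst finsum_insert) auto
  also have "(\<Oplus>l\<in>{1..n}. a l \<otimes> c' (n - l)) = s"
    unfolding s_def using Suc.prems c(1) by (intro finsum_cong') (auto simp: c'_def)
  also have "a 0 \<otimes> c' n = d \<ominus> s"
    using m_assoc[of "a 0" "inv (a 0)" "d \<ominus> s"] Units_closed[OF unit] unit s d by (simp add: c'_def e_def)
  also have "d \<ominus> s \<oplus> s = d" using s d by (simp add: a_minus_def a_assoc l_neg)
  finally have "conv R a c' n = d" .
  then show ?case
    using c' old c(2) by (intro exI[of _ c']) (auto simp: less_Suc_eq d_def)
qed

lemma toeplitz_inverse:
  assumes a: "\<And>i. i < n \<Longrightarrow> a i \<in> carrier R" and c: "\<And>i. i < n \<Longrightarrow> c i \<in> carrier R"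
    and conv: "\<And>m. m < n \<Longrightarrow> conv R a c m = (if m = 0 then \<one> else \<zero>)"
  shows "toeplitz R n a \<in> carrier (GL R n)" "inv\<^bsub>GL R n\<^esub> (toeplitz R n a) = toeplitz R n c"
proof -
  interpret M: monoid "MM n" by (rule monoid_mat_monoid)
  have 1: "toeplitz R n a \<otimes>\<^bsub>MM n\<^esub> toeplitz R n c = \<one>\<^bsub>MM n\<^esub>"
    unfolding mat_monoid_one by (rule trans[OF toeplitz_mult toeplitz_cong]) (simp_all add: a c conv)
  have "conv R c a m = (if m = 0 then \<one> else \<zero>)" if "m < n" for m
    using conv[OF that] conv_commute[of m a c] a c that by simp
  then have 2: "toeplitz R n c \<otimes>\<^bsub>MM n\<^esub> toeplitz R n a = \<one>\<^bsub>MM n\<^esub>"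
    unfolding mat_monoid_one by (intro trans[OF toeplitz_mult toeplitz_cong]) (simp_all add: a c)
  note closed = toeplitz_closed[OF a] toeplitz_closed[OF c]
  have unit: "toeplitz R n a \<in> Units (MM n)"
    unfolding Units_def using closed 1 2 by auto
  then show "toeplitz R n a \<in> carrier (GL R n)" by (simp add: GL_def units_of_carrier)
  show "inv\<^bsub>GL R n\<^esub> (toeplitz R n a) = toeplitz R n c"
    unfolding GL_def M.units_of_inv[OF unit] by (rule M.inv_unique'[OF closed 1 2, symmetric])
qed

lemma toeplitz_GL_subgroup:
  assumes "n > 0"
  shows "subgroup {toeplitz R n a | a. a 0 \<in> Units R \<and> (\<forall>i<n. a i \<in> carrier R)} (GL R n)"
    (is "subgroup ?H _")
proof -
  interpret M: monoid "MM n" by (rule monoid_mat_monoid)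
  have mult: "monoid.mult (GL R n) = monoid.mult (MM n)" unfolding GL_def by (rule units_of_mult)
  show ?thesis
  proof
    show "?H \<subseteq> carrier (GL R n)"
    proof
      fix A assume "A \<in> ?H"
      then obtain a where a: "A = toeplitz R n a" "a 0 \<in> Units R" "\<And>i. i < n \<Longrightarrow> a i \<in> carrier R" by blast
      obtain c where c: "\<And>i. c i \<in> carrier R" "\<And>m. m < n \<Longrightarrow> conv R a c m = (if m = 0 then \<one> else \<zero>)"
        using conv_inverse_exists[of n a, OF a(3,2)] by blast
      show "A \<in> carrier (GL R n)" unfolding a(1) by (rule toeplitz_inverse(1)[OF a(3) c])
    qed
    show "\<one>\<^bsub>GL R n\<^esub> \<in> ?H"
      unfolding GL_def units_of_one mat_monoid_one by force
  next
    fix A B assume "A \<in> ?H" "B \<in> ?H"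
    then obtain a c where ac: "A = toeplitz R n a" "B = toeplitz R n c" "a 0 \<in> Units R" "c 0 \<in> Units R"
      "\<And>i. i < n \<Longrightarrow> a i \<in> carrier R" "\<And>i. i < n \<Longrightarrow> c i \<in> carrier R" by blast
    have "A \<otimes>\<^bsub>GL R n\<^esub> B = toeplitz R n (conv R a c)" unfolding mult ac(1,2) by (rule toeplitz_mult[OF ac(5,6)])
    moreover have "conv R a c 0 = a 0 \<otimes> c 0" using ac(5,6)[OF assms] by (simp add: conv_def)
    moreover have "conv R a c i \<in> carrier R" if "i < n" for i using that ac by (intro conv_closed) auto
    ultimately show "A \<otimes>\<^bsub>GL R n\<^esub> B \<in> ?H" using ac(3,4) by auto
  next
    fix A assume "A \<in> ?H"
    then obtain a where a: "A = toeplitz R n a" "a 0 \<in> Units R" "\<And>i. i < n \<Longrightarrow> a i \<in> carrier R" by blast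
    obtain c where c: "\<And>i. c i \<in> carrier R" "\<And>m. m < n \<Longrightarrow> conv R a c m = (if m = 0 then \<one> else \<zero>)"
      using conv_inverse_exists[of n a, OF a(3,2)] by blast
    have "inv\<^bsub>GL R n\<^esub> A = toeplitz R n c" unfolding a(1) by (rule toeplitz_inverse(2)[OF a(3) c])
    moreover have "a 0 \<otimes> c 0 = \<one>" using c(2)[OF assms] Units_closed[OF a(2)] c(1) by (simp add: conv_def)
    then have "c 0 \<in> Units R"
      using a(2) c(1)[of 0] m_comm[of "a 0" "c 0"] by (auto simp: Units_def)
    ultimately show "inv\<^bsub>GL R n\<^esub> A \<in> ?H" using c(1) by blast
  qed
qed

text \<open>The last row of the matrix has only its diagonal entry, so the corner entry of
  \<open>A B = 1\<close> says that \<open>a 0\<close> divides 1.\<close>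

lemma toeplitz_unit_diagonal:
  assumes "n > 0" "toeplitz R n a \<in> carrier (GL R n)"
  shows "a 0 \<in> Units R"
proof -
  have A: "toeplitz R n a \<in> Units (MM n)" using assms(2) by (simp add: GL_def units_of_carrier)
  then obtain B where B: "B \<in> carrier (MM n)"
    "toeplitz R n a \<otimes>\<^bsub>MM n\<^esub> B = \<one>\<^bsub>MM n\<^esub>" unfolding Units_def by auto
  have A': "toeplitz R n a \<in> carrier (MM n)" using A unfolding Units_def by auto
  have a0: "a 0 \<in> carrier R" using mat_monoid_carrierD(2)[OF A' assms(1) assms(1)] assms(1) by simp
  define k where "k = n - 1"
  have k: "k < n" "\<And>l. l < n \<Longrightarrow> l \<le> k" using assms(1) by (auto simp: k_def)
  have Bk: "B $$ (l, k) \<in> carrier R" if "l < n" for l using mat_monoid_carrierD(2)[OF B(1) that k(1)] .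
  have "\<one> = (toeplitz R n a \<otimes>\<^bsub>MM n\<^esub> B) $$ (k, k)"
    unfolding B(2) using k(1) by (simp add: mat_monoid_def)
  also have "\<dots> = (\<Oplus>l\<in>{..<n}. toeplitz R n a $$ (k, l) \<otimes> B $$ (l, k))"
    by (rule mat_monoid_mult_index[OF k(1) k(1)])
  also have "\<dots> = (\<Oplus>l\<in>{k}. a 0 \<otimes> B $$ (l, k))"
  proof (rule add.finprod_mono_neutral_cong_right)
    fix l assume "l \<in> {..<n} - {k}"
    then have "l < n" "l < k" using k(2)[of l] by auto
    then show "toeplitz R n a $$ (k, l) \<otimes> B $$ (l, k) = \<zero>" using k(1) Bk by simp
  next
    show "toeplitz R n a $$ (k, l) \<otimes> B $$ (l, k) = a 0 \<otimes> B $$ (l, k)" if "l \<in> {k}" for l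
      using that k(1) by simp
    show "(\<lambda>l. toeplitz R n a $$ (k, l) \<otimes> B $$ (l, k)) \<in> {..<n} \<rightarrow> carrier R"
      using mat_monoid_carrierD(2)[OF A' k(1)] Bk by simp
  qed (use k(1) in auto)
  also have "\<dots> = a 0 \<otimes> B $$ (k, k)" using a0 Bk k by simp
  finally show ?thesis
    using a0 Bk[OF k(1)] m_comm[of "a 0"] by (auto simp: Units_def)
qed

text \<open>A permutation other than the identity has some \<open>p i < i\<close>, and the entry at
  that place is below the diagonal.\<close>

lemma ring_det_toeplitz:
  assumes a: "\<And>i. i < n \<Longrightarrow> a i \<in> carrier R"
  shows "ring_det R n (toeplitz R n a) = a 0 [^] n"
proof -
  let ?A = "toeplitz R n a"
  have closed: "?A $$ (i, p i) \<in> carrier R" if "p permutes {..<n}" "i < n" for p i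
    using a permutes_in_image[OF that(1), of i] that(2) by auto
  define sg where "sg p = (if evenperm p then \<one> else \<ominus> \<one>)" for p :: "nat \<Rightarrow> nat"
  have sg: "sg p \<in> carrier R" for p by (simp add: sg_def)
  have "ring_det R n ?A = (\<Oplus>p\<in>{p. p permutes {..<n}}. sg p \<otimes> (\<Otimes>i\<in>{..<n}. ?A $$ (i, p i)))"
    by (simp add: ring_det_def sg_def)
  also have "\<dots> = (\<Oplus>p\<in>{id :: nat \<Rightarrow> nat}. \<Otimes>i\<in>{..<n}. a 0)"
  proof (rule add.finprod_mono_neutral_cong_right)
    fix p assume "p \<in> {p. p permutes {..<n}} - {id}"
    then have p: "p permutes {..<n}" "p \<noteq> id" by auto
    then have "\<not> (\<forall>i\<in>{..<n}. i \<le> p i)" using permutes_natset_ge[OF p(1)] by blast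
    then obtain i where i: "i < n" "p i < i" by (auto simp: not_le)
    have "(\<Otimes>i\<in>{..<n}. ?A $$ (i, p i)) = ?A $$ (i, p i) \<otimes> (\<Otimes>i\<in>{..<n} - {i}. ?A $$ (i, p i))"
      using i closed[OF p(1)] by (subst finprod_insert[symmetric]) (auto simp: insert_absorb)
    also have "\<dots> = \<zero>"
      using i closed[OF p(1)] by (auto intro!: l_null finprod_closed)
    finally show "sg p \<otimes> (\<Otimes>i\<in>{..<n}. ?A $$ (i, p i)) = \<zero>" using sg by simp
  next
    show "finite {p. p permutes {..<n}}" by (rule finite_permutations) simp
    show "{id} \<subseteq> {p. p permutes {..<n}}" by (simp add: permutes_id)
    show "sg p \<otimes> (\<Otimes>i\<in>{..<n}. ?A $$ (i, p i)) = (\<Otimes>i\<in>{..<n}. a 0)" if "p \<in> {id}" for p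
      using that a by (auto simp: sg_def evenperm_id intro!: finprod_cong' l_one finprod_closed)
    show "(\<lambda>p. sg p \<otimes> (\<Otimes>i\<in>{..<n}. ?A $$ (i, p i))) \<in> {p. p permutes {..<n}} \<rightarrow> carrier R"
      using closed sg by (auto intro!: m_closed finprod_closed)
  qed
  also have "\<dots> = a 0 [^] n"
  proof (cases "n = 0")
    case False
    then have "a 0 \<in> carrier R" using a by simp
    then show ?thesis by (simp add: finprod_const)
  qed simp
  finally show ?thesis .
qed

lemma mset_prod_superset:
  assumes "finite A" "set_mset m \<subseteq> A" "\<And>x. x \<in> A \<Longrightarrow> a x \<in> carrier R"
  shows "mset_prod R a m = (\<Otimes>x\<in>A. a x [^] count m x)"
  unfolding mset_prod_def
  by (rule finprod_mono_neutral_cong_left) (use assms in \<open>auto simp: not_in_iff\<close>)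

lemma mset_prod_empty [simp]: "mset_prod R a {#} = \<one>"
  by (simp add: mset_prod_def)

lemma mset_prod_closed: "(\<And>x. x \<in># m \<Longrightarrow> a x \<in> carrier R) \<Longrightarrow> mset_prod R a m \<in> carrier R"
  unfolding mset_prod_def by (rule finprod_closed) auto

lemma mset_prod_add_mset:
  assumes "a x \<in> carrier R" "\<And>y. y \<in># m \<Longrightarrow> a y \<in> carrier R"
  shows "mset_prod R a (add_mset x m) = a x \<otimes> mset_prod R a m"
proof -
  let ?A = "insert x (set_mset m)"
  have c: "\<And>y. y \<in> ?A \<Longrightarrow> a y \<in> carrier R" using assms by auto
  have "mset_prod R a (add_mset x m) = (\<Otimes>y\<in>?A. a y [^] count (add_mset x m) y)"
    by (rule mset_prod_superset) (use assms in auto)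
  also have "\<dots> = (\<Otimes>y\<in>?A. (if x = y then a y else \<one>) \<otimes> a y [^] count m y)"
    using c by (intro finprod_cong') (auto simp: m_comm)
  also have "\<dots> = (\<Otimes>y\<in>?A. if x = y then a y else \<one>) \<otimes> (\<Otimes>y\<in>?A. a y [^] count m y)"
    using c by (intro finprod_multf) auto
  also have "(\<Otimes>y\<in>?A. if x = y then a y else \<one>) = a x"
    using c by (intro finprod_singleton) auto
  also have "(\<Otimes>y\<in>?A. a y [^] count m y) = mset_prod R a m"
    by (rule mset_prod_superset[symmetric]) (use c in auto)
  finally show ?thesis .
qed

lemma mset_prod_replicate:
  assumes "a x \<in> carrier R" "\<And>y. y \<in># m \<Longrightarrow> a y \<in> carrier R"
  shows "mset_prod R a (m + replicate_mset r x) = mset_prod R a m \<otimes> a x [^] r"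
proof (induction r)
  case (Suc r)
  have c: "\<And>y. y \<in># m + replicate_mset r x \<Longrightarrow> a y \<in> carrier R"
    using assms by (auto split: if_splits)
  have "mset_prod R a (m + replicate_mset (Suc r) x) = a x \<otimes> mset_prod R a (m + replicate_mset r x)"
    using mset_prod_add_mset[of a x "m + replicate_mset r x", OF assms(1) c] by simp
  then show ?case using Suc assms by (simp add: mset_prod_closed m_ac)
qed (use assms in \<open>simp add: mset_prod_closed\<close>)

lemma mset_prod_zero:
  assumes "x \<in># m" "a x = \<zero>" "\<And>y. y \<in># m \<Longrightarrow> a y \<in> carrier R"
  shows "mset_prod R a m = \<zero>"
proof -
  obtain m' where m: "m = add_mset x m'" using multi_member_split[OF assms(1)] by blast
  then show ?thesis using assms by (simp add: mset_prod_add_mset mset_prod_closed)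
qed

end

section \<open>Evaluation of the coordinate ring at Toeplitz matrices\<close>

text \<open>
  On upper triangular Toeplitz matrices the variable \<open>X\<^sub>i\<^sub>j\<close> restricts to \<open>a\<^sub>j\<^sub>-\<^sub>i\<close>; the entries below
  the diagonal are represented by a further variable \<open>a\<^sub>n\<close> with value \<open>0\<close>, and the powers of
  \<open>1/det\<close> are cleared by a power of \<open>a\<^sub>0\<close>.
\<close>
definition gl_index :: "nat \<Rightarrow> gl_var \<Rightarrow> nat" where
  "gl_index n x = (case x of Entry i j \<Rightarrow> if i \<le> j then j - i else n | Inv_Det \<Rightarrow> 0)"

definition pm_mset :: "('v \<Rightarrow>\<^sub>0 nat) \<Rightarrow> 'v multiset" where
  "pm_mset m = Abs_multiset (Poly_Mapping.lookup m)"

text \<open>\<open>D\<close> is to bound the exponents of \<open>Inv_Det\<close>. Multiplication by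
  the \<open>D\<close>-th power of the determinant \<open>a 0 ^ n\<close> leaves \<open>a 0\<close>
  to the power \<open>n * (D - d)\<close> in a monomial of exponent \<open>d\<close>.\<close>

definition gl_mset :: "nat \<Rightarrow> nat \<Rightarrow> (gl_var \<Rightarrow>\<^sub>0 nat) \<Rightarrow> nat multiset" where
  "gl_mset n D m = image_mset (gl_index n) (filter_mset (\<lambda>x. x \<noteq> Inv_Det) (pm_mset m))
     + replicate_mset (n * (D - Poly_Mapping.lookup m Inv_Det)) 0"

definition gl_deg :: "((gl_var \<Rightarrow>\<^sub>0 nat) \<Rightarrow>\<^sub>0 'f::zero) \<Rightarrow> nat" where
  "gl_deg f = (\<Sum>m\<in>Poly_Mapping.keys f. Poly_Mapping.lookup m Inv_Det)"

text \<open>Entries on the same diagonal become the same variable, so different monomials of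
  \<open>f\<close> can merge and their coefficients are added.\<close>

definition gl_coeff :: "nat \<Rightarrow> ((gl_var \<Rightarrow>\<^sub>0 nat) \<Rightarrow>\<^sub>0 'f::comm_monoid_add) \<Rightarrow> nat multiset \<Rightarrow> 'f" where
  "gl_coeff n f \<mu> = (\<Sum>m | m \<in> Poly_Mapping.keys f \<and> gl_mset n (gl_deg f) m = \<mu>. Poly_Mapping.lookup f m)"

abbreviation "entry i j c \<equiv> Poly_Mapping.single (Poly_Mapping.single (Entry i j) (1 :: nat)) c"

lemma count_pm_mset [simp]: "count (pm_mset m) x = Poly_Mapping.lookup m x"
  using finite_lookup[of m] by (simp add: pm_mset_def count_Abs_multiset neq0_conv[symmetric] del: neq0_conv)

lemma set_pm_mset [simp]: "set_mset (pm_mset m) = Poly_Mapping.keys m"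
  by (auto simp: in_keys_iff simp flip: count_greater_zero_iff)

lemma gl_mset_le:
  assumes "f \<in> gl_polys F n" "m \<in> Poly_Mapping.keys f" "j \<in># gl_mset n D m"
  shows "j \<le> n"
proof -
  have keys: "Poly_Mapping.keys m \<subseteq> {Entry i j | i j. i < n \<and> j < n} \<union> {Inv_Det}"
    using assms(1,2) by (simp add: gl_polys_def)
  show ?thesis
    using assms(3) subsetD[OF keys] by (fastforce simp: gl_mset_def gl_index_def split: if_splits)
qed

lemma gl_deg_ge: "m \<in> Poly_Mapping.keys f \<Longrightarrow> Poly_Mapping.lookup m Inv_Det \<le> gl_deg f"
  unfolding gl_deg_def by (rule member_le_sum) auto

context cring
begin

lemma mset_prod_clear_det:
  assumes a: "\<And>i. i \<le> n \<Longrightarrow> a i \<in> carrier R"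
    and v: "\<And>x. x \<in># m \<Longrightarrow> x \<noteq> Inv_Det \<Longrightarrow> gl_index n x \<le> n \<and> v x = a (gl_index n x)"
    and I: "v Inv_Det \<in> carrier R" "v Inv_Det \<otimes> a 0 [^] n = \<one>"
  shows "mset_prod R v m \<otimes> a 0 [^] (n * count m Inv_Det) =
    mset_prod R a (image_mset (gl_index n) (filter_mset (\<lambda>x. x \<noteq> Inv_Det) m))"
  using v
proof (induction m)
  case (add x m)
  have vR: "v y \<in> carrier R" if "y \<in># add_mset x m" for y
    using that add.prems[OF that] a I(1) by (cases "y = Inv_Det") auto
  have step: "mset_prod R v (add_mset x m) = v x \<otimes> mset_prod R v m"
    by (rule mset_prod_add_mset) (use vR in auto)
  have m: "mset_prod R v m \<in> carrier R" by (rule mset_prod_closed) (use vR in auto)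
  have a0: "a 0 \<in> carrier R" using a by simp
  have IH: "mset_prod R v m \<otimes> a 0 [^] (n * count m Inv_Det) =
    mset_prod R a (image_mset (gl_index n) (filter_mset (\<lambda>x. x \<noteq> Inv_Det) m))"
    by (rule add.IH) (use add.prems in auto)
  show ?case
  proof (cases "x = Inv_Det")
    case True
    have "mset_prod R v (add_mset x m) \<otimes> a 0 [^] (n * count (add_mset x m) Inv_Det) =
      (v Inv_Det \<otimes> a 0 [^] n) \<otimes> (mset_prod R v m \<otimes> a 0 [^] (n * count m Inv_Det))"
      unfolding step using True m a0 I(1) by (simp add: nat_pow_mult[symmetric] m_ac)
    moreover have "mset_prod R a (image_mset (gl_index n) (filter_mset (\<lambda>x. x \<noteq> Inv_Det) m)) \<in> carrier R"
      unfolding IH[symmetric] using m a0 by simp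
    ultimately show ?thesis using True IH I(2) by simp
  next
    case False
    have x: "v x = a (gl_index n x)" "gl_index n x \<le> n" using add.prems[of x] False by auto
    have "mset_prod R a (image_mset (gl_index n) (filter_mset (\<lambda>x. x \<noteq> Inv_Det) (add_mset x m))) =
      a (gl_index n x) \<otimes> mset_prod R a (image_mset (gl_index n) (filter_mset (\<lambda>x. x \<noteq> Inv_Det) m))"
      using False a x(2) add.prems by (simp, intro mset_prod_add_mset) auto
    then show ?thesis
      using False m a0 vR[of x] by (simp add: step m_assoc IH[symmetric] x(1))
  qed
qed (use I a in simp)

text \<open>Up to a power of the unit \<open>a 0\<close>, the value of \<open>f\<close> is a
  polynomial in the \<open>a i\<close> whose coefficients \<open>gl_coeff n f\<close> depend on
  neither \<open>R\<close> nor \<open>a\<close>. This carries vanishing at the point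
  \<open>psi\<close> of the tensor ring over to all Toeplitz points of an arbitrary
  \<open>R\<close>.\<close>

lemma gl_eval_toeplitz:
  assumes n: "n > 0" and a: "\<And>i. i < n \<Longrightarrow> a i \<in> carrier R" and unit: "a 0 \<in> Units R"
    and f: "f \<in> gl_polys F n"
    and h: "\<And>c. c \<in> F \<Longrightarrow> h c \<in> carrier R" "h 0 = \<zero>" "0 \<in> F"
      "\<And>c d. c \<in> F \<Longrightarrow> d \<in> F \<Longrightarrow> c + d \<in> F \<and> h (c + d) = h c \<oplus> h d"
  shows "gl_eval R h n (toeplitz R n a) f \<in> carrier R"
    and "gl_eval R h n (toeplitz R n a) f \<otimes> a 0 [^] (n * gl_deg f) =
    (\<Oplus>\<mu>\<in>gl_mset n (gl_deg f) ` Poly_Mapping.keys f. h (gl_coeff n f \<mu>) \<otimes> mset_prod R (a(n := \<zero>)) \<mu>)"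
proof -
  define a' where "a' = a(n := \<zero>)"
  define D where "D = gl_deg f"
  define v where "v x = (case x of Entry i j \<Rightarrow> toeplitz R n a $$ (i, j) | Inv_Det \<Rightarrow> inv (ring_det R n (toeplitz R n a)))" for x
  let ?K = "Poly_Mapping.keys f" and ?c = "Poly_Mapping.lookup f"
  have a0: "a' 0 = a 0" "a 0 \<in> carrier R" using n a by (auto simp: a'_def)
  have a': "a' i \<in> carrier R" if "i \<le> n" for i using a that by (auto simp: a'_def)
  have cF: "?c m \<in> F" for m using f by (simp add: gl_polys_def)
  have det: "v Inv_Det \<in> carrier R" "v Inv_Det \<otimes> a 0 [^] n = \<one>"
  proof -
    have "a 0 [^] n \<in> Units R" using unit by (rule Units_pow_closed)
    then show "v Inv_Det \<in> carrier R" "v Inv_Det \<otimes> a 0 [^] n = \<one>"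
      by (simp_all add: v_def ring_det_toeplitz[OF a])
  qed
  have v: "gl_index n x \<le> n \<and> v x = a' (gl_index n x)" if x: "m \<in> ?K" "x \<in># pm_mset m" "x \<noteq> Inv_Det" for m x
  proof -
    have "Poly_Mapping.keys m \<subseteq> {Entry i j | i j. i < n \<and> j < n} \<union> {Inv_Det}"
      using f x(1) by (simp add: gl_polys_def)
    then obtain i j where "x = Entry i j" "i < n" "j < n" using x(2,3) by auto
    then show ?thesis by (auto simp: v_def gl_index_def a'_def)
  qed
  have vR: "v x \<in> carrier R" if "m \<in> ?K" "x \<in># pm_mset m" for m x
    using v[OF that] a' det(1) by (cases "x = Inv_Det") auto
  have mono: "mset_prod R v (pm_mset m) \<otimes> a 0 [^] (n * D) = mset_prod R a' (gl_mset n D m)" if m: "m \<in> ?K" for m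
  proof -
    let ?d = "Poly_Mapping.lookup m Inv_Det"
    let ?M = "image_mset (gl_index n) (filter_mset (\<lambda>x. x \<noteq> Inv_Det) (pm_mset m))"
    have "n * D = n * ?d + n * (D - ?d)"
      using gl_deg_ge[OF m] by (simp add: D_def flip: distrib_left)
    moreover have P: "mset_prod R v (pm_mset m) \<in> carrier R" using vR[OF m] by (rule mset_prod_closed)
    ultimately have "mset_prod R v (pm_mset m) \<otimes> a 0 [^] (n * D) =
        mset_prod R v (pm_mset m) \<otimes> a' 0 [^] (n * count (pm_mset m) Inv_Det) \<otimes> a 0 [^] (n * (D - ?d))"
      using a0 by (simp add: nat_pow_mult[symmetric] m_assoc)
    also have "mset_prod R v (pm_mset m) \<otimes> a' 0 [^] (n * count (pm_mset m) Inv_Det) = mset_prod R a' ?M"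
      by (rule mset_prod_clear_det[OF a' v[OF m]]) (use det a0 in auto)
    also have "mset_prod R a' ?M \<otimes> a 0 [^] (n * (D - ?d)) = mset_prod R a' (gl_mset n D m)"
      unfolding gl_mset_def a0(1)[symmetric]
      by (rule mset_prod_replicate[symmetric]) (use a' v[OF m] in auto)
    finally show ?thesis .
  qed
  have gl_R: "mset_prod R a' (gl_mset n D m) \<in> carrier R" if m: "m \<in> ?K" for m
    unfolding gl_mset_def
    by (rule mset_prod_closed) (use a' v[OF m] in \<open>auto split: if_splits\<close>)
  have P: "mset_prod R v (pm_mset m) \<in> carrier R" if "m \<in> ?K" for m
    using vR[OF that] by (rule mset_prod_closed)
  have hsum: "(\<Sum>m\<in>A. ?c m) \<in> F \<and> h (\<Sum>m\<in>A. ?c m) = (\<Oplus>m\<in>A. h (?c m))" if "finite A" for A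
    using that
  proof (induction A rule: finite_induct)
    case (insert m A)
    have "(\<Oplus>m\<in>insert m A. h (?c m)) = h (?c m) \<oplus> (\<Oplus>m\<in>A. h (?c m))"
      using insert.hyps by (rule finsum_insert) (use h(1)[OF cF] in auto)
    then show ?case using insert h(4)[OF cF[of m]] by simp
  qed (simp add: h finsum_empty)
  have eval: "gl_eval R h n (toeplitz R n a) f = (\<Oplus>m\<in>?K. h (?c m) \<otimes> mset_prod R v (pm_mset m))"
    by (simp add: gl_eval_def mset_prod_def v_def)
  show "gl_eval R h n (toeplitz R n a) f \<in> carrier R"
    unfolding eval using P h(1)[OF cF] by (intro finsum_closed) auto
  have "gl_eval R h n (toeplitz R n a) f \<otimes> a 0 [^] (n * D) =
      (\<Oplus>m\<in>?K. h (?c m) \<otimes> mset_prod R v (pm_mset m) \<otimes> a 0 [^] (n * D))"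
    unfolding eval using a0 P h(1)[OF cF] by (simp add: finsum_ldistr Pi_def)
  also have "\<dots> = (\<Oplus>m\<in>?K. h (?c m) \<otimes> mset_prod R a' (gl_mset n D m))"
    using a0 P h(1)[OF cF] gl_R by (intro finsum_cong') (auto simp: m_assoc mono)
  also have "\<dots> = (\<Oplus>\<mu>\<in>gl_mset n D ` ?K. h (gl_coeff n f \<mu>) \<otimes> mset_prod R a' \<mu>)"
  proof -
    have "(\<Oplus>\<mu>\<in>gl_mset n D ` ?K. h (gl_coeff n f \<mu>) \<otimes> mset_prod R a' \<mu>) =
      (\<Oplus>\<mu>\<in>gl_mset n D ` ?K. \<Oplus>m\<in>{m \<in> ?K. gl_mset n D m = \<mu>}. h (?c m) \<otimes> mset_prod R a' (gl_mset n D m))"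
    proof (rule finsum_cong'[OF refl])
      fix \<mu> assume "\<mu> \<in> gl_mset n D ` ?K"
      then have \<mu>: "mset_prod R a' \<mu> \<in> carrier R" using gl_R by auto
      have "h (gl_coeff n f \<mu>) \<otimes> mset_prod R a' \<mu> = (\<Oplus>m\<in>{m \<in> ?K. gl_mset n D m = \<mu>}. h (?c m) \<otimes> mset_prod R a' \<mu>)"
        using \<mu> h(1)[OF cF] hsum[of "{m \<in> ?K. gl_mset n D m = \<mu>}"]
        by (simp add: gl_coeff_def finsum_ldistr Pi_def flip: D_def)
      also have "\<dots> = (\<Oplus>m\<in>{m \<in> ?K. gl_mset n D m = \<mu>}. h (?c m) \<otimes> mset_prod R a' (gl_mset n D m))"
        using gl_R h(1)[OF cF] by (intro finsum_cong') auto
      finally show "h (gl_coeff n f \<mu>) \<otimes> mset_prod R a' \<mu> =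
        (\<Oplus>m\<in>{m \<in> ?K. gl_mset n D m = \<mu>}. h (?c m) \<otimes> mset_prod R a' (gl_mset n D m))" .
    qed (use gl_R h(1)[OF cF] in \<open>auto intro!: finsum_closed\<close>)
    also have "\<dots> = (\<Oplus>m\<in>(\<Union>\<mu>\<in>gl_mset n D ` ?K. {m \<in> ?K. gl_mset n D m = \<mu>}). h (?c m) \<otimes> mset_prod R a' (gl_mset n D m))"
      by (rule add.finprod_UN_disjoint[symmetric]) (use gl_R h(1)[OF cF] in \<open>auto simp: pairwise_def disjnt_def\<close>)
    also have "(\<Union>\<mu>\<in>gl_mset n D ` ?K. {m \<in> ?K. gl_mset n D m = \<mu>}) = ?K" by auto
    finally show ?thesis by simp
  qed
  finally show "gl_eval R h n (toeplitz R n a) f \<otimes> a 0 [^] (n * gl_deg f) =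
    (\<Oplus>\<mu>\<in>gl_mset n (gl_deg f) ` ?K. h (gl_coeff n f \<mu>) \<otimes> mset_prod R (a(n := \<zero>)) \<mu>)"
    by (simp add: D_def a'_def)
qed

text \<open>This lemma and \<open>gl_eval_two\<close> evaluate the two families of equations of the
  Toeplitz matrices: the entries below the diagonal, and the differences of neighbours along a
  diagonal.\<close>

lemma gl_eval_single:
  assumes "c \<noteq> 0" "h c \<in> carrier R" "A $$ (i, j) \<in> carrier R"
  shows "gl_eval R h n A (entry i j c) = h c \<otimes> A $$ (i, j)"
  using assms by (simp add: gl_eval_def)

lemma gl_eval_two:
  assumes "c \<noteq> 0" "d \<noteq> 0" "h c \<in> carrier R" "h d \<in> carrier R" "A $$ (i, j) \<in> carrier R" "A $$ (i', j') \<in> carrier R"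
    and "(i, j) \<noteq> (i', j')"
  shows "gl_eval R h n A (entry i j c + entry i' j' d) = h c \<otimes> A $$ (i, j) \<oplus> h d \<otimes> A $$ (i', j')"
proof -
  define m m' where "m = Poly_Mapping.single (Entry i j) (1 :: nat)" and "m' = Poly_Mapping.single (Entry i' j') (1 :: nat)"
  have m: "Poly_Mapping.keys m = {Entry i j}" "Poly_Mapping.lookup m (Entry i j) = 1"
    "Poly_Mapping.keys m' = {Entry i' j'}" "Poly_Mapping.lookup m' (Entry i' j') = 1"
    by (simp_all add: m_def m'_def)
  have neq: "m \<noteq> m'" using m(1,3) assms(7) by auto
  let ?f = "Poly_Mapping.single m c + Poly_Mapping.single m' d"
  have keys: "Poly_Mapping.keys ?f = {m, m'}"
    using neq assms(1,2) by (auto simp: in_keys_iff lookup_add lookup_single when_def split: if_splits)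
  have lookup: "Poly_Mapping.lookup ?f m = c" "Poly_Mapping.lookup ?f m' = d"
    using neq by (simp_all add: lookup_add lookup_single when_def)
  have "gl_eval R h n A ?f = h c \<otimes> A $$ (i, j) \<oplus> h d \<otimes> A $$ (i', j')"
    unfolding gl_eval_def keys Let_def
    by (subst finsum_insert) (use assms neq in \<open>simp_all add: lookup m\<close>)
  then show ?thesis by (simp only: m_def m'_def)
qed

end

section \<open>The completed algebraic closure and the Tate algebra\<close>

text \<open>Multiplication by a nonzero \<open>x\<close> permutes the nonzero elements; comparing
  their product before and after gives \<open>x ^ (q - 1) = 1\<close>.\<close>

lemma power_CARD_eq_self: "(x :: 'a::{field,finite}) ^ CARD('a) = x"
proof (cases "x = 0")
  case False
  let ?P = "\<Prod>y\<in>- {0 :: 'a}. y"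
  have "bij_betw ((*) x) (- {0}) (- {0})"
    by (rule bij_betw_byWitness[of _ "\<lambda>y. y / x"]) (use False in auto)
  then have "?P = (\<Prod>y\<in>- {0}. x * y)" by (rule prod.reindex_bij_betw[symmetric])
  also have "\<dots> = x ^ (CARD('a) - 1) * ?P" by (simp add: prod.distrib card_Diff_singleton Compl_eq_Diff_UNIV)
  finally have "x ^ (CARD('a) - 1) = 1" by simp
  then show ?thesis using power_minus_mult[of "CARD('a)" x] by simp
qed (simp add: zero_power)

lemma CARD_field_ge_2: "CARD('a::{field,finite}) \<ge> 2"
  using card_mono[of "UNIV :: 'a set" "{0, 1}"] by simp

text \<open>The polynomial \<open>(Y + 1)\<^sup>q - Y\<^sup>q - 1\<close> has degree less than \<open>q\<close> and vanishes on \<open>F\<^sub>q\<close>.\<close>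
lemma CARD_choose_eq_0:
  assumes "0 < i" "i < CARD('a)"
  shows "of_nat (CARD('a) choose i) = (0 :: 'a::{field,finite})"
proof -
  define q where "q = CARD('a)"
  define P where "P = (\<Sum>i\<in>{0<..<q}. monom (of_nat (q choose i) :: 'a) i)"
  have q: "q \<ge> 2" unfolding q_def by (rule CARD_field_ge_2)
  have split: "{..q} = insert 0 (insert q {0<..<q})" using q by auto
  have "poly P x = 0" for x
  proof -
    have "x + 1 = (x + 1) ^ q" unfolding q_def by (rule power_CARD_eq_self[symmetric])
    also have "\<dots> = (\<Sum>i\<le>q. of_nat (q choose i) * x ^ i)" by (simp add: binomial_ring)
    also have "\<dots> = 1 + x ^ q + poly P x"
      unfolding split using q by (simp add: P_def poly_sum poly_monom)
    also have "x ^ q = x" unfolding q_def by (rule power_CARD_eq_self)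
    finally show ?thesis by simp
  qed
  then have "{x. poly P x = 0} = UNIV" by auto
  moreover have "degree P < q"
  proof -
    have "degree P \<le> q - 1"
      unfolding P_def by (intro degree_sum_le) (auto intro: order.trans[OF degree_monom_le])
    then show ?thesis using q by simp
  qed
  ultimately have "P = 0"
    using card_poly_roots_bound[of P] by (auto simp: q_def)
  moreover have "coeff P i = of_nat (q choose i)"
    using assms by (simp add: P_def coeff_sum coeff_monom q_def)
  ultimately show ?thesis by (simp add: q_def)
qed

lemma int_choose_eq_0: "0 \<le> i \<Longrightarrow> i < int n \<Longrightarrow> int_choose i n = 0"
proof -
  assume i: "0 \<le> i" "i < int n"
  then have "(\<Prod>l<n. i - int l) = 0"
    by (intro prod_zero bexI[of _ "nat i"]) auto
  then show ?thesis unfolding int_choose_def by (simp only: div_0)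
qed

section \<open>The absolute value and the Frobenius of the completed closure\<close>

locale carlitz =
  fixes \<iota> :: "'a::{field,finite} fls alg_closure \<Rightarrow> 'c::{field,complete_space}" and \<eta> :: 'c
  assumes closure: "completed_alg_closure \<iota>" and eta: "\<eta> ^ (CARD('a) - 1) = - theta \<iota>"
begin

abbreviation nrm :: "'c \<Rightarrow> real" where "nrm x \<equiv> dist x 0"
abbreviation \<theta> where "\<theta> \<equiv> theta \<iota>"

lemma q_ge_2: "CARD('a) \<ge> 2" by (rule CARD_field_ge_2)

lemma iota_hom: "\<iota> 1 = 1" "\<iota> (x + y) = \<iota> x + \<iota> y" "\<iota> (x * y) = \<iota> x * \<iota> y"
  and dist_diff: "dist u w = nrm (u - w)"
  and nrm_mult: "nrm (u * w) = nrm u * nrm w"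
  and nrm_add: "nrm (u + w) \<le> max (nrm u) (nrm w)"
  and nrm_iota: "f \<noteq> 0 \<Longrightarrow> nrm (\<iota> (to_ac f)) = real CARD('a) powi (- fls_subdegree f)"
  using closure by (auto simp: completed_alg_closure_def)

sublocale iota: field_hom \<iota>
proof
  have "\<iota> 0 = \<iota> 0 + \<iota> 0" using iota_hom(2)[of 0 0] by simp
  then show "\<iota> 0 = 0" by (simp only: add_cancel_right_right)
qed (simp_all add: iota_hom)

lemma nrm_1 [simp]: "nrm 1 = 1"
  using nrm_mult[of 1 1] by (simp add: zero_less_dist_iff[of 1 "0 :: 'c", symmetric])

lemma nrm_uminus [simp]: "nrm (- u) = nrm u"
proof -
  have "nrm (- 1) * nrm (- 1) = 1" using nrm_mult[of "-1" "-1"] by simp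
  then have "nrm (- 1) = 1" using zero_le_dist[of "-1" "0 :: 'c"] by (simp add: square_eq_1_iff)
  then show ?thesis using nrm_mult[of "-1" u] by simp
qed

lemma nrm_diff: "nrm (u - w) \<le> max (nrm u) (nrm w)"
  using nrm_add[of u "- w"] by simp

lemma nrm_power: "nrm (u ^ n) = nrm u ^ n"
  by (induction n) (simp_all add: nrm_mult)

lemma nrm_sum_le:
  assumes "\<And>i. i \<in> A \<Longrightarrow> nrm (f i) \<le> B" "B \<ge> 0"
  shows "nrm (sum f A) \<le> B"
  using assms
proof (induction A rule: infinite_finite_induct)
  case (insert i A)
  then have "nrm (f i) \<le> B" "nrm (sum f A) \<le> B" by auto
  then show ?case using nrm_add[of "f i" "sum f A"] insert.hyps by simp
qed auto

lemma nrm_of_int: "nrm (of_int z) \<le> 1"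
proof -
  have nat: "nrm (of_nat n) \<le> 1" for n
  proof (induction n)
    case (Suc n)
    then show ?case using nrm_add[of 1 "of_nat n"] by simp
  qed simp
  show ?thesis
  proof (cases z)
    case (nonneg n)
    then show ?thesis using nat[of n] by simp
  next
    case (neg n)
    then show ?thesis using nat[of "Suc n"] nrm_uminus[of "of_nat (Suc n)"] by (simp only: of_int_minus of_int_of_nat_eq)
  qed
qed

lemma nrm_theta: "nrm \<theta> = real CARD('a)"
  using nrm_iota[of fls_X_inv] by (simp add: theta_def)

lemma theta_nonzero: "\<theta> \<noteq> 0"
  using nrm_theta q_ge_2 by auto

definition const_hom where "const_hom a = \<iota> (to_ac (fls_const a))"

sublocale const_hom: field_hom const_hom
  by unfold_locales (simp_all add: const_hom_def fls_plus_const[symmetric] fls_const_mult_const[symmetric] iota.hom_add iota.hom_mult del: fls_const_mult_const)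

lemma Fq_range: "Fq \<iota> = range const_hom"
  by (auto simp: Fq_def const_hom_def)

text \<open>The inner binomial coefficients vanish in \<open>'a\<close>, and
  \<open>const_hom\<close> carries this to \<open>'c\<close>.\<close>

lemma frobenius_add: "(u + w :: 'c) ^ CARD('a) = u ^ CARD('a) + w ^ CARD('a)"
proof -
  have split: "{..CARD('a)} = insert 0 (insert CARD('a) {0<..<CARD('a)})" using q_ge_2 by auto
  have "of_nat (CARD('a) choose i) = (0 :: 'c)" if "i \<in> {0<..<CARD('a)}" for i
    using CARD_choose_eq_0[where 'a = 'a and i = i] that const_hom.hom_of_nat[of "CARD('a) choose i"] by simp
  then have "(\<Sum>i\<in>{0<..<CARD('a)}. of_nat (CARD('a) choose i) * u ^ i * w ^ (CARD('a) - i)) = 0" by (intro sum.neutral) simp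
  then show ?thesis
    unfolding binomial_ring split using q_ge_2 by (simp add: add.commute)
qed

sublocale frob: field_hom "\<lambda>x :: 'c. x ^ CARD('a)"
  using q_ge_2 by unfold_locales (auto simp: frobenius_add power_mult_distrib zero_power)

text \<open>The negative part of the chain consists of iterated \<open>q\<close>-th roots taken in
  the algebraic closure. All members have absolute value above 1, and a member equal to a later one
  would have the same absolute value as a proper power of itself.\<close>

lemma frob_chain_exists: "\<exists>\<zeta>. frob_chain (\<lambda>x :: 'c. x ^ CARD('a)) \<zeta> \<and> \<zeta> 0 = \<theta>"
proof -
  have "\<exists>r :: nat \<Rightarrow> 'a fls alg_closure. r 0 = to_ac fls_X_inv \<and> (\<forall>n. r (Suc n) ^ CARD('a) = r n)"
  proof -
    have ex: "\<exists>y. y ^ CARD('a) = (x :: 'a fls alg_closure)" for x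
      using nth_root_exists[of "CARD('a)" x] q_ge_2 by auto
    define r where "r = rec_nat (to_ac fls_X_inv) (\<lambda>n x. SOME y :: 'a fls alg_closure. y ^ CARD('a) = x)"
    have "r 0 = to_ac fls_X_inv" "r (Suc n) ^ CARD('a) = r n" for n
      using someI_ex[OF ex[of "r n"]] by (simp_all add: r_def)
    then show ?thesis by blast
  qed
  then obtain r :: "nat \<Rightarrow> 'a fls alg_closure" where r: "r 0 = to_ac fls_X_inv" "\<And>n. r (Suc n) ^ CARD('a) = r n" by blast
  define \<zeta> where "\<zeta> i = (if i \<ge> 0 then \<theta> ^ (CARD('a) ^ nat i) else \<iota> (r (nat (- i))))" for i :: int
  have zeta0: "\<zeta> 0 = \<theta>" by (simp add: \<zeta>_def)
  have step: "\<zeta> i ^ CARD('a) = \<zeta> (i + 1)" for i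
  proof (cases "i \<ge> 0")
    case True
    then show ?thesis by (simp add: \<zeta>_def nat_add_distrib mult.commute flip: power_mult)
  next
    case False
    define n where "n = nat (- i) - 1"
    have n: "nat (- i) = Suc n" "i + 1 = - int n" using False by (auto simp: n_def)
    have "\<zeta> i ^ CARD('a) = \<iota> (r n)" using False n r(2)[of n] by (simp add: \<zeta>_def flip: iota.hom_power)
    also have "\<dots> = \<zeta> (i + 1)"
      unfolding n(2) by (cases n) (auto simp: \<zeta>_def r(1) theta_def nat_add_distrib)
    finally show ?thesis .
  qed
  have gt: "nrm (\<zeta> i) > 1" for i
  proof (induction i rule: int_induct[where k = 0])
    case base
    then show ?case using nrm_theta q_ge_2 by (simp add: zeta0)
  next
    case (step1 i)
    then show ?case using q_ge_2 unfolding step[symmetric] nrm_power by (intro one_less_power) auto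
  next
    case (step2 i)
    have "nrm (\<zeta> (i - 1)) ^ CARD('a) > 1" using step2 step[of "i - 1"] by (simp flip: nrm_power)
    then show ?case by (metis linorder_not_less power_le_one zero_le_dist)
  qed
  have iter: "\<zeta> (i + int n) = \<zeta> i ^ (CARD('a) ^ n)" for i n
  proof (induction n)
    case (Suc n)
    then show ?case using step[of "i + int n"] by (simp add: add_ac mult.commute flip: power_mult)
  qed simp
  have neq: "\<zeta> i \<noteq> \<zeta> j" if "i < j" for i j
  proof
    assume eq: "\<zeta> i = \<zeta> j"
    define n where "n = nat (j - i)"
    have j: "j = i + int n" "n > 0" using that by (auto simp: n_def)
    have "nrm (\<zeta> i) = nrm (\<zeta> i) ^ (CARD('a) ^ n)" using eq iter[of i n] by (simp add: j(1) flip: nrm_power)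
    moreover have "CARD('a) ^ n > 1" using q_ge_2 j(2) by (intro one_less_power) auto
    ultimately show False using power_strict_increasing[of 1 "CARD('a) ^ n" "nrm (\<zeta> i)"] gt[of i] by simp
  qed
  have "inj \<zeta>" by (rule injI) (metis neq linorder_neqE)
  then have "frob_chain (\<lambda>x :: 'c. x ^ CARD('a)) \<zeta>"
    by unfold_locales (simp_all add: step)
  then show ?thesis using zeta0 by blast
qed

section \<open>Limits and the Tate algebra\<close>

lemma tendsto_zero_iff: "(f \<longlongrightarrow> 0) G \<longleftrightarrow> ((\<lambda>n. nrm (f n)) \<longlongrightarrow> 0) G"
  by (rule tendsto_dist_iff)

text \<open>The type class of \<open>'c\<close> provides only a field and a complete metric;
  continuity of the arithmetic comes from the ultrametric axioms in
  \<open>completed_alg_closure\<close>.\<close>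

lemma tendsto_linear:
  assumes "f \<longlonglongrightarrow> x" "g \<longlonglongrightarrow> y"
  shows "(\<lambda>n. f n - c * g n) \<longlonglongrightarrow> x - c * (y :: 'c)"
  unfolding tendsto_dist_iff[of _ "x - c * y"]
proof (rule tendsto_sandwich[of "\<lambda>_. 0" _ _ "\<lambda>n. dist (f n) x + nrm c * dist (g n) y"])
  show "(\<lambda>n. dist (f n) x + nrm c * dist (g n) y) \<longlonglongrightarrow> 0"
    using tendsto_add[OF iffD1[OF tendsto_dist_iff assms(1)] tendsto_mult_left[OF iffD1[OF tendsto_dist_iff assms(2)], of "nrm c"]]
    by simp
  have "dist (f n - c * g n) (x - c * y) \<le> dist (f n) x + nrm c * dist (g n) y" for n
  proof -
    have "f n - c * g n - (x - c * y) = (f n - x) - c * (g n - y)" by (simp add: algebra_simps)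
    then have "dist (f n - c * g n) (x - c * y) \<le> max (nrm (f n - x)) (nrm (c * (g n - y)))"
      unfolding dist_diff[of "f n - c * g n"] using nrm_diff by metis
    also have "\<dots> \<le> nrm (f n - x) + nrm (c * (g n - y))" by simp
    finally show ?thesis unfolding nrm_mult dist_diff[of "f n" x] dist_diff[of "g n" y] .
  qed
  then show "\<forall>\<^sub>F n in sequentially. dist (f n - c * g n) (x - c * y) \<le> dist (f n) x + nrm c * dist (g n) y" by simp
qed auto

lemma tendsto_frob:
  assumes "f \<longlonglongrightarrow> (x :: 'c)"
  shows "(\<lambda>n. f n ^ CARD('a)) \<longlonglongrightarrow> x ^ CARD('a)"
proof -
  have "dist (f n ^ CARD('a)) (x ^ CARD('a)) = dist (f n) x ^ CARD('a)" for n
    unfolding dist_diff[of "f n ^ CARD('a)"] frob.hom_minus[symmetric] nrm_power dist_diff[of "f n" x] ..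
  moreover have "(\<lambda>n. dist (f n) x ^ CARD('a)) \<longlonglongrightarrow> 0 ^ CARD('a)"
    by (rule tendsto_power[OF iffD1[OF tendsto_dist_iff assms]])
  moreover have "(0 :: real) ^ CARD('a) = 0" using q_ge_2 by (simp add: zero_power)
  ultimately have "(\<lambda>n. dist (f n ^ CARD('a)) (x ^ CARD('a))) \<longlonglongrightarrow> 0" by (simp only:)
  then show ?thesis by (rule iffD2[OF tendsto_dist_iff])
qed

lemma Tate_zero: "(0 :: 'c fps) \<in> Tate_algebra" and Tate_one: "(1 :: 'c fps) \<in> Tate_algebra"
  and Tate_poly: "fps_of_poly p \<in> (Tate_algebra :: 'c fps set)"
proof -
  show *: "fps_of_poly p \<in> Tate_algebra" for p :: "'c poly"
    unfolding Tate_algebra_def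
    by (auto intro!: tendsto_eventually eventually_sequentiallyI[of "Suc (degree p)"] coeff_eq_0)
  show "(0 :: 'c fps) \<in> Tate_algebra" "(1 :: 'c fps) \<in> Tate_algebra"
    using *[of 0] *[of 1] by simp_all
qed

lemma Tate_add: "f \<in> Tate_algebra \<Longrightarrow> g \<in> Tate_algebra \<Longrightarrow> f + g \<in> (Tate_algebra :: 'c fps set)"
  unfolding Tate_algebra_def mem_Collect_eq fps_add_nth
  using tendsto_linear[of "fps_nth f" 0 "fps_nth g" 0 "-1"] by simp

text \<open>In a coefficient of index at least \<open>N1 + N2\<close>, every term has one factor
  below \<open>d\<close> and the other bounded by \<open>B\<close>; the ultrametric inequality
  passes this bound to the sum.\<close>

lemma Tate_mult:
  assumes "f \<in> Tate_algebra" "g \<in> Tate_algebra"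
  shows "f * g \<in> (Tate_algebra :: 'c fps set)"
proof -
  have lim: "(\<lambda>n. nrm (fps_nth f n)) \<longlonglongrightarrow> 0" "(\<lambda>n. nrm (fps_nth g n)) \<longlonglongrightarrow> 0"
    using assms unfolding Tate_algebra_def tendsto_zero_iff by auto
  obtain B1 where B1: "\<And>n. norm (nrm (fps_nth f n)) \<le> B1"
    using convergent_imp_Bseq[OF convergentI[OF lim(1)]] by (auto simp: Bseq_def)
  obtain B2 where B2: "\<And>n. norm (nrm (fps_nth g n)) \<le> B2"
    using convergent_imp_Bseq[OF convergentI[OF lim(2)]] by (auto simp: Bseq_def)
  define B where "B = max 1 (max B1 B2)"
  have B: "B > 0" "nrm (fps_nth f n) \<le> B" "nrm (fps_nth g n) \<le> B" for n
    using B1[of n] B2[of n] by (auto simp: B_def)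
  have "(\<lambda>n. nrm (fps_nth (f * g) n)) \<longlonglongrightarrow> 0"
  proof (rule LIMSEQ_I)
    fix e :: real assume e: "e > 0"
    define d where "d = e / (2 * B)"
    have d: "d > 0" "d * B < e" using e B(1) by (auto simp: d_def field_simps)
    obtain N1 where N1: "\<And>n. n \<ge> N1 \<Longrightarrow> norm (nrm (fps_nth f n) - 0) < d" using LIMSEQ_D[OF lim(1) d(1)] by blast
    obtain N2 where N2: "\<And>n. n \<ge> N2 \<Longrightarrow> norm (nrm (fps_nth g n) - 0) < d" using LIMSEQ_D[OF lim(2) d(1)] by blast
    have "norm (nrm (fps_nth (f * g) n) - 0) < e" if n: "n \<ge> N1 + N2" for n
    proof -
      have "nrm (fps_nth f i * fps_nth g (n - i)) \<le> d * B" if "i \<in> {0..n}" for i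
      proof (cases "i \<ge> N1")
        case True
        then have "nrm (fps_nth f i) \<le> d" using N1[of i] by simp
        then show ?thesis unfolding nrm_mult using B(3)[of "n - i"] d(1) by (intro mult_mono) auto
      next
        case False
        then have "N2 \<le> n - i" using n by linarith
        then have "nrm (fps_nth g (n - i)) \<le> d" using N2[of "n - i"] n by (simp add: less_imp_le)
        then have "nrm (fps_nth f i) * nrm (fps_nth g (n - i)) \<le> B * d" using B(1) B(2)[of i] by (intro mult_mono) auto
        then show ?thesis unfolding nrm_mult by (simp add: mult.commute)
      qed
      then have "nrm (fps_nth (f * g) n) \<le> d * B"
        unfolding fps_mult_nth using d(1) B(1) by (intro nrm_sum_le) auto
      then show ?thesis using d(2) by simp
    qed
    then show "\<exists>N. \<forall>n\<ge>N. norm (nrm (fps_nth (f * g) n) - 0) < e" by blast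
  qed
  then show ?thesis unfolding Tate_algebra_def tendsto_zero_iff by simp
qed

text \<open>The binomial coefficients are integers, so their absolute value is at most 1. No
  negative powers of \<open>t\<close> arise, since the binomial coefficient vanishes when
  \<open>0 \<le> i + n < n\<close>.\<close>

lemma Tate_hyperderiv:
  assumes "f \<in> Tate_algebra"
  shows "\<exists>g\<in>Tate_algebra. hyperderiv n (fps_to_fls f) = fps_to_fls (g :: 'c fps)"
proof (rule bexI)
  let ?g = "Abs_fps (\<lambda>i. of_int (int_choose (int i + int n) n) * fps_nth f (i + n))"
  show "hyperderiv n (fps_to_fls f) = fps_to_fls ?g"
    by (rule fls_eqI) (auto simp: int_choose_eq_0 nat_add_distrib)
  have le: "nrm (fps_nth ?g i) \<le> nrm (fps_nth f (i + n))" for i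
    using mult_right_mono[OF nrm_of_int, of "nrm (fps_nth f (i + n))"] by (simp add: nrm_mult)
  have lim: "(\<lambda>i. nrm (fps_nth f (i + n))) \<longlonglongrightarrow> 0"
    using assms LIMSEQ_ignore_initial_segment[of "\<lambda>i. nrm (fps_nth f i)" 0 n]
    unfolding Tate_algebra_def tendsto_zero_iff by simp
  have "(\<lambda>i. nrm (fps_nth ?g i)) \<longlonglongrightarrow> 0"
    by (rule tendsto_sandwich[OF always_eventually always_eventually tendsto_const lim]; intro allI zero_le_dist le)
  then show "?g \<in> Tate_algebra" unfolding Tate_algebra_def tendsto_zero_iff by simp
qed

abbreviation "TF \<equiv> Tate_frac :: 'c fls set"

lemma Tate_frac_subfield:
  shows Tate_frac_Tate: "f \<in> Tate_algebra \<Longrightarrow> fps_to_fls f \<in> TF"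
    and Tate_frac_add: "x \<in> Tate_frac \<Longrightarrow> y \<in> Tate_frac \<Longrightarrow> x + y \<in> TF"
    and Tate_frac_mult: "x \<in> Tate_frac \<Longrightarrow> y \<in> Tate_frac \<Longrightarrow> x * y \<in> TF"
    and Tate_frac_inverse: "x \<in> Tate_frac \<Longrightarrow> inverse x \<in> TF"
    and Tate_frac_rat: "rat_funs F \<subseteq> TF"
proof -
  have I: "fps_to_fls f / fps_to_fls g \<in> TF" if "f \<in> Tate_algebra" "g \<in> Tate_algebra" "g \<noteq> 0" for f g
    using that unfolding Tate_frac_def by blast
  show T: "fps_to_fls f \<in> TF" if "f \<in> Tate_algebra" for f
    using I[OF that Tate_one] by simp
  show "rat_funs F \<subseteq> TF"
    unfolding rat_funs_def using I[OF Tate_poly Tate_poly] by auto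
  { fix x y :: "'c fls" assume "x \<in> Tate_frac" "y \<in> Tate_frac"
    then obtain f g f' g' where *: "f \<in> Tate_algebra" "g \<in> Tate_algebra" "g \<noteq> 0" "f' \<in> Tate_algebra" "g' \<in> Tate_algebra" "g' \<noteq> 0"
      "x = fps_to_fls f / fps_to_fls g" "y = fps_to_fls f' / fps_to_fls g'" unfolding Tate_frac_def by blast
    have e: "x + y = fps_to_fls (f * g' + f' * g) / fps_to_fls (g * g')" "x * y = fps_to_fls (f * f') / fps_to_fls (g * g')"
      using * by (simp_all add: fls_times_fps_to_fls add_frac_eq)
    show "x + y \<in> Tate_frac" "x * y \<in> Tate_frac"
      unfolding e by (intro I Tate_add Tate_mult; use * in simp)+ }
  show "inverse x \<in> Tate_frac" if x: "x \<in> Tate_frac" for x :: "'c fls"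
  proof (cases "x = 0")
    case True
    then show ?thesis using T[OF Tate_zero] by simp
  next
    case False
    obtain f g where "f \<in> Tate_algebra" "g \<in> Tate_algebra" "g \<noteq> 0" "x = fps_to_fls f / fps_to_fls g"
      using x unfolding Tate_frac_def by blast
    then show ?thesis using False I[of g f] by auto
  qed
qed

end

section \<open>The Anderson--Thakur function\<close>

context carlitz
begin

text \<open>The reciprocal of the pole \<open>\<theta>^(q^i)\<close> of
  \<open>omega\<close>.\<close>

definition pole :: "nat \<Rightarrow> 'c" where "pole i = 1 / \<theta> ^ (CARD('a) ^ i)"

definition partial :: "nat \<Rightarrow> nat \<Rightarrow> 'c" where
  "partial m = fps_nth (\<Prod>i<m. inverse (1 - fps_const (pole i) * fps_X))"

definition om :: "nat \<Rightarrow> 'c" where "om n = lim (\<lambda>m. partial m n)"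

lemma partial_0: "partial 0 n = (if n = 0 then 1 else 0)"
  by (simp add: partial_def)

text \<open>The new factor is cleared by multiplying with \<open>1 - pole m * t\<close>. The product
  \<open>partial (Suc m)\<close> therefore occurs on both sides, and proofs about it use an
  induction on \<open>n\<close> inside the one on \<open>m\<close>.\<close>

lemma partial_Suc: "partial (Suc m) n = partial m n + pole m * shift (partial (Suc m)) n"
proof -
  define f where "f = (\<Prod>i<Suc m. inverse (1 - fps_const (pole i) * fps_X))"
  define u where "u = 1 - fps_const (pole m) * fps_X"
  have u: "inverse u * u = 1" unfolding u_def by (rule inverse_mult_eq_1) simp
  have "f * u = (\<Prod>i<m. inverse (1 - fps_const (pole i) * fps_X)) * (inverse u * u)"
    by (simp add: f_def u_def mult.assoc)
  then have "f * u = (\<Prod>i<m. inverse (1 - fps_const (pole i) * fps_X))" unfolding u by simp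
  moreover have "f * u = f - fps_const (pole m) * (fps_X * f)" by (simp add: u_def algebra_simps)
  ultimately have *: "(\<Prod>i<m. inverse (1 - fps_const (pole i) * fps_X)) = f - fps_const (pole m) * (fps_X * f)"
    by (rule trans[OF sym])
  have "partial m n = fps_nth f n - pole m * shift (fps_nth f) n"
    unfolding partial_def * by (simp add: fps_X_mult_nth)
  moreover have "partial (Suc m) = fps_nth f" by (simp only: partial_def f_def)
  ultimately show ?thesis by simp
qed

lemma pole_frob: "pole i ^ CARD('a) = pole (Suc i)"
  by (simp add: pole_def power_divide mult.commute flip: power_mult)

text \<open>The absolute value of \<open>pole 0\<close>, which bounds that of every
  \<open>pole i\<close>.\<close>

definition rad :: real where "rad = 1 / real CARD('a)"

lemma rad: "0 < rad" "rad < 1"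
  using q_ge_2[unfolded numeral_2_eq_2] by (simp_all add: rad_def)

lemma nrm_pole: "nrm (pole i) = rad ^ (CARD('a) ^ i)"
proof -
  have "nrm (pole i) * nrm (\<theta> ^ (CARD('a) ^ i)) = 1"
    unfolding nrm_mult[symmetric] using theta_nonzero by (simp add: pole_def)
  then show ?thesis
    unfolding nrm_power nrm_theta rad_def power_one_over by (simp add: field_simps)
qed

lemma nrm_pole_le: "nrm (pole i) \<le> rad" "nrm (pole i) \<le> rad ^ i"
proof -
  have "1 \<le> CARD('a) ^ i" using q_ge_2 by simp
  then show "nrm (pole i) \<le> rad" unfolding nrm_pole using power_decreasing[of 1 _ rad] rad by simp
  have "i \<le> CARD('a) ^ i" using self_le_ge2_pow[of "CARD('a)" i] q_ge_2 by simp
  then show "nrm (pole i) \<le> rad ^ i" unfolding nrm_pole using power_decreasing[of i _ rad] rad by simp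
qed

lemma nrm_partial: "nrm (partial m n) \<le> rad ^ n"
proof (induction m arbitrary: n)
  case 0
  then show ?case using rad by (simp add: partial_0)
next
  case (Suc m)
  show ?case
  proof (induction n)
    case 0
    then show ?case using Suc[of 0] by (simp add: partial_Suc[of m 0])
  next
    case (Suc n)
    have "nrm (pole m * partial (Suc m) n) \<le> rad * rad ^ n"
      unfolding nrm_mult using Suc nrm_pole_le(1)[of m] rad by (intro mult_mono) auto
    then have "nrm (pole m * partial (Suc m) n) \<le> rad ^ Suc n" by simp
    then show ?case
      using nrm_add[of "partial m (Suc n)" "pole m * partial (Suc m) n"] \<open>\<And>n. nrm (partial m n) \<le> rad ^ n\<close>[of "Suc n"]
      by (simp add: partial_Suc[of m "Suc n"])
  qed
qed

text \<open>Successive partial products of index at least \<open>m\<close> differ by at most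
  \<open>rad ^ m\<close> in each coefficient, and ultrametric telescoping does not enlarge this
  bound. It makes the coefficients Cauchy.\<close>

lemma partial_diff: "nrm (partial (m + j) n - partial m n) \<le> rad ^ m"
proof (induction j)
  case 0
  then show ?case using rad by simp
next
  case (Suc j)
  have "nrm (shift (partial (Suc (m + j))) n) \<le> 1"
    using order.trans[OF nrm_partial power_le_one[of rad]] rad by simp
  then have "nrm (pole (m + j) * shift (partial (Suc (m + j))) n) \<le> rad ^ (m + j) * 1"
    unfolding nrm_mult using nrm_pole_le(2)[of "m + j"] rad by (intro mult_mono) auto
  also have "\<dots> \<le> rad ^ m" using power_decreasing[of m "m + j" rad] rad by simp
  finally have "nrm (partial (Suc (m + j)) n - partial (m + j) n) \<le> rad ^ m"
    by (simp add: partial_Suc[of "m + j" n])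
  then show ?case
    using nrm_add[of "partial (Suc (m + j)) n - partial (m + j) n" "partial (m + j) n - partial m n"] Suc by simp
qed

lemma partial_tendsto: "(\<lambda>m. partial m n) \<longlonglongrightarrow> om n"
proof -
  have "Cauchy (\<lambda>m. partial m n)"
  proof (rule metric_CauchyI)
    fix e :: real assume "e > 0"
    then obtain M where M: "rad ^ M < e" using real_arch_pow_inv rad(2) by blast
    have "dist (partial m n) (partial k n) < e" if "m \<ge> M" "k \<ge> M" for m k
    proof -
      have "nrm (partial m n - partial M n) \<le> rad ^ M" "nrm (partial k n - partial M n) \<le> rad ^ M"
        using partial_diff[of M "m - M" n] partial_diff[of M "k - M" n] that by simp_all
      then have "nrm ((partial m n - partial M n) - (partial k n - partial M n)) \<le> rad ^ M"
        using nrm_diff[of "partial m n - partial M n" "partial k n - partial M n"] by linarith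
      then show ?thesis using M by (simp add: dist_diff[of "partial m n" "partial k n"])
    qed
    then show "\<exists>M. \<forall>m\<ge>M. \<forall>k\<ge>M. dist (partial m n) (partial k n) < e" by blast
  qed
  then have "convergent (\<lambda>m. partial m n)" by (rule Cauchy_convergent)
  then show ?thesis unfolding om_def by (rule iffD1[OF convergent_LIMSEQ_iff])
qed

lemma nrm_om: "nrm (om n) \<le> rad ^ n"
  by (rule LIMSEQ_le_const2[OF tendsto_dist[OF partial_tendsto tendsto_const]])
     (use nrm_partial in auto)

lemma om_0: "om 0 = 1"
proof -
  have "partial m 0 = 1" for m by (induction m) (simp_all add: partial_0 partial_Suc[of _ 0])
  then have "(\<lambda>m. 1) \<longlonglongrightarrow> om 0" using partial_tendsto[of 0] by simp
  then show ?thesis using LIMSEQ_unique tendsto_const by blast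
qed

text \<open>Frobenius on coefficients turns the factors of index \<open>0, ..., m - 1\<close> into
  those of index \<open>1, ..., m\<close>, which are also what remains of the next partial product
  after cancelling its factor of index 0. The identity is exact before passing to the limit.\<close>

lemma partial_frob: "partial (Suc m) n - pole 0 * shift (partial (Suc m)) n = partial m n ^ CARD('a)"
proof -
  define G where "G m n = partial (Suc m) n - pole 0 * shift (partial (Suc m)) n" for m n
  have G_Suc: "G (Suc m) n = G m n + pole (Suc m) * shift (G (Suc m)) n" for m n
    by (cases n) (simp_all add: G_def partial_Suc[of "Suc m"] algebra_simps)
  have "G m n = partial m n ^ CARD('a)" for m n
  proof (induction m arbitrary: n)
    case 0
    then show ?case using q_ge_2 by (simp add: G_def partial_Suc[of 0] partial_0 zero_power)
  next
    case (Suc m)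
    show ?case
    proof (induction n)
      case 0
      then show ?case using Suc[of 0] by (simp add: G_Suc[of m 0] partial_Suc[of m 0])
    next
      case (Suc n)
      have "partial (Suc m) (Suc n) ^ CARD('a) = partial m (Suc n) ^ CARD('a) + pole (Suc m) * partial (Suc m) n ^ CARD('a)"
        unfolding partial_Suc[of m "Suc n"] by (simp add: frobenius_add power_mult_distrib pole_frob)
      then show ?case
        using Suc \<open>\<And>n. G m n = partial m n ^ CARD('a)\<close> by (simp add: G_Suc[of m "Suc n"])
    qed
  qed
  then show ?thesis by (simp add: G_def)
qed

lemma om_frob: "om n ^ CARD('a) = om n - pole 0 * shift om n"
proof -
  have "(\<lambda>m. partial (Suc m) n - pole 0 * shift (partial (Suc m)) n) \<longlonglongrightarrow> om n - pole 0 * shift om n"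
    by (rule tendsto_linear) (auto intro: LIMSEQ_Suc partial_tendsto)
  moreover have "(\<lambda>m. partial m n ^ CARD('a)) \<longlonglongrightarrow> om n ^ CARD('a)"
    by (rule tendsto_frob[OF partial_tendsto])
  ultimately show ?thesis unfolding partial_frob using LIMSEQ_unique by blast
qed

lemma omega_nth: "fps_nth (omega \<iota> \<eta>) n = \<eta> * om n"
  by (simp add: omega_def om_def partial_def pole_def)

lemma eta_nonzero: "\<eta> \<noteq> 0"
  using eta theta_nonzero q_ge_2 by (auto simp: zero_power)

lemma omega_nonzero: "omega \<iota> \<eta> \<noteq> 0"
proof -
  have "fps_nth (omega \<iota> \<eta>) 0 \<noteq> 0" by (simp add: omega_nth om_0 eta_nonzero)
  then show ?thesis by auto
qed

text \<open>The equation \<open>tau omega = (t - \<theta>) omega\<close> on coefficients: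
  \<open>\<eta> ^ q = - \<theta> * \<eta>\<close>, and
  \<open>- \<theta> * (1 - t/\<theta>) = t - \<theta>\<close>.\<close>

lemma omega_frob: "fps_nth (omega \<iota> \<eta>) n ^ CARD('a) = shift (fps_nth (omega \<iota> \<eta>)) n - \<theta> * fps_nth (omega \<iota> \<eta>) n"
proof -
  have "\<eta> ^ CARD('a) = \<eta> ^ (CARD('a) - 1) * \<eta>" using power_minus_mult[of "CARD('a)" \<eta>] q_ge_2 by simp
  then have "\<eta> ^ CARD('a) = - \<theta> * \<eta>" unfolding eta .
  then have "(\<eta> * om n) ^ CARD('a) = - \<theta> * \<eta> * (om n - pole 0 * shift om n)"
    by (simp add: power_mult_distrib om_frob)
  also have "\<dots> = shift (\<lambda>n. \<eta> * om n) n - \<theta> * (\<eta> * om n)"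
    using theta_nonzero by (simp add: pole_def algebra_simps)
  finally show ?thesis by (simp add: omega_nth)
qed

lemma omega_Tate: "omega \<iota> \<eta> \<in> Tate_algebra"
proof -
  have lim: "(\<lambda>n. nrm \<eta> * rad ^ n) \<longlonglongrightarrow> 0"
    using tendsto_mult_left[OF LIMSEQ_power_zero[of rad], of "nrm \<eta>"] rad by simp
  have le: "nrm (fps_nth (omega \<iota> \<eta>) n) \<le> nrm \<eta> * rad ^ n" for n
    unfolding omega_nth nrm_mult by (intro mult_left_mono nrm_om zero_le_dist)
  have "(\<lambda>n. nrm (fps_nth (omega \<iota> \<eta>) n)) \<longlonglongrightarrow> 0"
    by (rule tendsto_sandwich[OF always_eventually always_eventually tendsto_const lim]; intro allI zero_le_dist le)
  then show ?thesis unfolding Tate_algebra_def tendsto_zero_iff by simp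
qed

definition Omega :: "'c fls" where
  "Omega = (fls_X - fls_const \<theta>) * fps_to_fls (omega \<iota> \<eta>)"

lemma fls_X_minus_const: "fls_X - fls_const x = poly_fls [:- x, 1:]"
  by (simp add: poly_fls_linear)

lemma Omega_nonzero: "Omega \<noteq> 0"
  unfolding Omega_def fls_X_minus_const using omega_nonzero by simp

lemma Omega_Tate: "\<exists>f\<in>Tate_algebra. Omega = fps_to_fls f"
proof -
  have "fps_of_poly [:- \<theta>, 1:] * omega \<iota> \<eta> \<in> Tate_algebra"
    by (intro Tate_mult Tate_poly omega_Tate)
  then show ?thesis
    unfolding Omega_def fls_X_minus_const fls_times_fps_to_fls[symmetric] by blast
qed

lemma Omega_hyperderiv_Tate: "hyperderiv n Omega \<in> Tate_frac"
  using Omega_Tate Tate_hyperderiv Tate_frac_Tate by metis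

lemma frob_uminus: "(- x :: 'c) ^ CARD('a) = - (x ^ CARD('a))"
  using frob.hom_minus[of 0 x] frob.hom_zero by simp

lemma Omega_frob_chain:
  obtains \<zeta> where "frob_chain (\<lambda>x :: 'c. x ^ CARD('a)) \<zeta>"
    "frob_chain.tau (\<lambda>x. x ^ CARD('a)) Omega = frob_chain.b \<zeta> * Omega"
proof -
  obtain \<zeta> where chain: "frob_chain (\<lambda>x :: 'c. x ^ CARD('a)) \<zeta>" and zeta0: "\<zeta> 0 = \<theta>"
    using frob_chain_exists by blast
  interpret Z: frob_chain "\<lambda>x :: 'c. x ^ CARD('a)" \<zeta> by fact
  let ?\<omega> = "fps_to_fls (omega \<iota> \<eta>)"
  have "Z.tau ?\<omega> = (fls_X - fls_const \<theta>) * ?\<omega>"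
  proof (rule fls_eqI)
    fix n
    consider "n < 0" | m where "n = int m" by (metis int_cases2 linorder_not_less nat_eq_iff2 nle_le)
    then show "fls_nth (Z.tau ?\<omega>) n = fls_nth ((fls_X - fls_const \<theta>) * ?\<omega>) n"
    proof cases
      case 1
      then show ?thesis using q_ge_2 by (simp add: left_diff_distrib fls_X_times_conv_shift zero_power)
    next
      case 2
      have "nat (int m - 1) = m - 1" by simp
      then show ?thesis using 2 by (auto simp: left_diff_distrib fls_X_times_conv_shift omega_frob)
    qed
  qed
  moreover have "Z.tau (fls_X - fls_const \<theta>) = Z.b"
    unfolding Z.b_poly fls_X_minus_const Z.tau_poly_fls
    using Z.s_zeta[of 0] zeta0 by (simp add: map_poly_pCons frob_uminus)
  ultimately have "Z.tau Omega = Z.b * Omega"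
    unfolding Omega_def by (simp add: Z.tau.hom_mult)
  then show ?thesis using that chain by blast
qed

end

section \<open>The Galois group\<close>

text \<open>Counterpart of \<open>toeplitz\<close> for matrices over a field type, where
  \<open>Psi\<close> is built with \<open>mat_inverse\<close>. Indexing by a power series turns the
  matrix inverse into the inverse series.\<close>

definition toep :: "nat \<Rightarrow> 'f::zero fps \<Rightarrow> 'f mat" where
  "toep n A = mat n n (\<lambda>(i, j). if i \<le> j then fps_nth A (j - i) else 0)"

lemma toep_carrier [simp]: "toep n A \<in> carrier_mat n n"
  by (simp add: toep_def)

lemma toep_mult: "toep n A * toep n B = toep n (A * B :: 'f::comm_ring_1 fps)"
proof (rule eq_matI)
  fix i j assume ij: "i < dim_row (toep n (A * B))" "j < dim_col (toep n (A * B))"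
  then have ij: "i < n" "j < n" by (simp_all add: toep_def)
  have "(toep n A * toep n B) $$ (i, j) = (\<Sum>l\<in>{0..<n}. toep n A $$ (i, l) * toep n B $$ (l, j))"
    using ij by (simp add: toep_def scalar_prod_def)
  also have "\<dots> = (\<Sum>l\<in>{i..j}. fps_nth A (l - i) * fps_nth B (j - l))"
    by (rule sum.mono_neutral_cong_right) (use ij in \<open>auto simp: toep_def\<close>)
  also have "\<dots> = toep n (A * B) $$ (i, j)"
  proof (cases "i \<le> j")
    case True
    have "(\<Sum>l\<in>{i..j}. fps_nth A (l - i) * fps_nth B (j - l)) = (\<Sum>l\<in>{0..j - i}. fps_nth A l * fps_nth B (j - i - l))"
      by (rule sum.reindex_bij_witness[of _ "\<lambda>l. l + i" "\<lambda>l. l - i"]) (use True in auto)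
    then show ?thesis using True ij by (simp add: toep_def fps_mult_nth)
  qed (use ij in \<open>simp add: toep_def\<close>)
  finally show "(toep n A * toep n B) $$ (i, j) = toep n (A * B) $$ (i, j)" .
qed (simp_all add: toep_def)

lemma toep_one: "toep n 1 = (1\<^sub>m n :: 'f::comm_ring_1 mat)"
  by (rule eq_matI) (auto simp: toep_def)

lemma mat_inverse_toep:
  fixes A :: "'f::field fps"
  assumes "fps_nth A 0 \<noteq> 0"
  shows "mat_inverse (toep n A) = Some (toep n (inverse A))"
proof -
  have inv: "toep n A * toep n (inverse A) = 1\<^sub>m n" "toep n (inverse A) * toep n A = 1\<^sub>m n"
    unfolding toep_mult toep_one[symmetric] using assms by (simp_all add: inverse_mult_eq_1 inverse_mult_eq_1')
  show ?thesis
  proof (cases "mat_inverse (toep n A)")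
    case None
    then have "toep n A \<notin> Units (ring_mat TYPE('f) n ())" by (rule mat_inverse(1)[OF toep_carrier])
    moreover have "toep n A \<in> Units (ring_mat TYPE('f) n ())"
      unfolding Units_def ring_mat_def using inv by (auto intro!: exI[of _ "toep n (inverse A)"])
    ultimately show ?thesis by blast
  next
    case (Some B)
    then have B: "toep n A * B = 1\<^sub>m n" "B * toep n A = 1\<^sub>m n" "B \<in> carrier_mat n n"
      using mat_inverse(2)[OF toep_carrier] by blast+
    have "B = B * (toep n A * toep n (inverse A))" unfolding inv using B(3) by simp
    also have "\<dots> = (B * toep n A) * toep n (inverse A)"
      by (rule assoc_mult_mat[symmetric, OF B(3) toep_carrier toep_carrier])
    also have "\<dots> = toep n (inverse A)" unfolding B(2) by (rule left_mult_one_mat[OF toep_carrier])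
    finally show ?thesis using Some by simp
  qed
qed

lemma rho_toep: "rho k f = toep (k + 1) (Abs_fps (\<lambda>j. hyperderiv j f))"
  by (simp add: rho_def toep_def cong: if_cong)

lemma hyperderiv_one: "hyperderiv n (1 :: 'c::comm_ring_1 fls) = (if n = 0 then 1 else 0)"
proof (cases "n = 0")
  case False
  then show ?thesis
    by (intro fls_eqI) (auto simp: int_choose_eq_0)
qed simp

context carlitz
begin

text \<open>The Taylor series of \<open>Omega\<close> at \<open>t + T\<close> in the variable
  \<open>T\<close>.\<close>

definition jet :: "'c fls fps" where "jet = Abs_fps (\<lambda>j. hyperderiv j Omega)"

lemma jet_0: "fps_nth jet 0 \<noteq> 0"
  by (simp add: jet_def Omega_nonzero)

text \<open>The jet of \<open>t - \<theta>\<close> is \<open>t - \<theta> + T\<close>, and by the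
  Leibniz rule its product with the jet of \<open>omega\<close> is the jet of
  \<open>Omega\<close>.\<close>

lemma Psi_toep: "Psi \<iota> \<eta> k = toep (k + 1) (inverse jet)"
proof -
  let ?d = "fls_X - fls_const \<theta>" and ?\<omega> = "fps_to_fls (omega \<iota> \<eta>)"
  define A where "A = Abs_fps (\<lambda>j. hyperderiv j ?d)"
  define B where "B = Abs_fps (\<lambda>j. hyperderiv j ?\<omega>)"
  have "?d \<noteq> 0" unfolding fls_X_minus_const by simp
  then have A0: "fps_nth A 0 \<noteq> 0" by (simp add: A_def)
  have B0: "fps_nth B 0 \<noteq> 0" using omega_nonzero by (simp add: B_def)
  have A: "A = fps_const ?d + fps_X"
  proof (rule fps_ext)
    fix n show "fps_nth A n = fps_nth (fps_const ?d + fps_X) n"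
      using hyperderiv_linear_mult[of n \<theta> 1] by (auto simp: A_def hyperderiv_one)
  qed
  have AB: "A * B = jet"
  proof (rule fps_ext)
    fix n show "fps_nth (A * B) n = fps_nth jet n"
      using hyperderiv_linear_mult[of n \<theta> ?\<omega>]
      by (simp add: A B_def jet_def Omega_def distrib_right fps_X_mult_nth)
  qed
  have "Psi \<iota> \<eta> k = toep (k + 1) (inverse A) * toep (k + 1) (inverse B)"
    by (simp add: Psi_def rho_toep mat_inverse_toep A0 B0 flip: A_def B_def)
  also have "\<dots> = toep (k + 1) (inverse jet)"
    unfolding toep_mult AB[symmetric] by (simp add: fps_inverse_mult)
  finally show ?thesis .
qed

section \<open>The base fields and the entries of the trivialization\<close>

lemma Fq_K_bar: "Fq \<iota> \<subseteq> K_bar \<iota>"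
proof
  have Fq: "const_hom a \<in> Fq \<iota>" for a by (auto simp: Fq_range)
  have zero: "0 \<in> Fq \<iota>" and one: "1 \<in> Fq \<iota>" using Fq[of 0] Fq[of 1] by simp_all
  have K: "z \<in> K_theta \<iota>" if "z \<in> Fq \<iota>" for z
  proof -
    have "\<forall>i. coeff [:z:] i \<in> Fq \<iota>" "\<forall>i. coeff [:1:] i \<in> Fq \<iota>"
      using that zero one by (auto simp: coeff_pCons split: nat.splits)
    moreover have "z = poly [:z:] \<theta> / poly [:1:] \<theta>" by simp
    moreover have "[:1 :: 'c:] \<noteq> 0" by simp
    ultimately show ?thesis unfolding K_theta_def by blast
  qed
  fix z assume "z \<in> Fq \<iota>"
  then obtain a where "z = const_hom a" by (auto simp: Fq_range)
  then have "- z \<in> Fq \<iota>" using Fq[of "- a"] const_hom.hom_uminus by simp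
  then have "\<forall>i. coeff [:- z, 1:] i \<in> K_theta \<iota>"
    using K zero one by (auto simp: coeff_pCons split: nat.splits)
  moreover have "poly [:- z, 1:] z = 0" "[:- z, 1:] \<noteq> 0" by simp_all
  ultimately show "z \<in> K_bar \<iota>" unfolding K_bar_def by blast
qed

abbreviation "FF \<equiv> rat_funs (K_bar \<iota>)"
abbreviation "KK \<equiv> rat_funs (Fq \<iota>)"

lemma rat_funs_mono: "F \<subseteq> G \<Longrightarrow> rat_funs F \<subseteq> rat_funs G"
  unfolding rat_funs_def by blast

lemma KK_FF: "KK \<subseteq> FF"
  by (rule rat_funs_mono[OF Fq_K_bar])

lemma KK_ring:
  shows KK_0: "0 \<in> KK" and KK_1: "1 \<in> KK" and KK_m1: "-1 \<in> KK"
    and KK_add: "x \<in> KK \<Longrightarrow> y \<in> KK \<Longrightarrow> x + y \<in> KK"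
proof -
  have mem: "z \<in> Fq \<iota> \<longleftrightarrow> (\<exists>a. z = const_hom a)" for z by (auto simp: Fq_range)
  have zero: "0 \<in> Fq \<iota>" and one: "1 \<in> Fq \<iota>" and m1: "-1 \<in> Fq \<iota>"
    unfolding mem using const_hom.hom_zero const_hom.hom_one const_hom.hom_uminus[of 1] by metis+
  have add: "u + w \<in> Fq \<iota>" and mult: "u * w \<in> Fq \<iota>" if "u \<in> Fq \<iota>" "w \<in> Fq \<iota>" for u w
    using that unfolding mem by (metis const_hom.hom_add, metis const_hom.hom_mult)
  have sum: "sum f A \<in> Fq \<iota>" if "\<And>i. i \<in> A \<Longrightarrow> f i \<in> Fq \<iota>" for f :: "nat \<Rightarrow> 'c" and A
    using that by (induction A rule: infinite_finite_induct) (auto intro: zero add)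
  have I: "poly_fls p / poly_fls r \<in> KK" if "\<forall>i. coeff p i \<in> Fq \<iota>" "\<forall>i. coeff r i \<in> Fq \<iota>" "r \<noteq> 0" for p r
    using that unfolding rat_funs_def by blast
  have c: "\<forall>i. coeff [:z:] i \<in> Fq \<iota>" if "z \<in> Fq \<iota>" for z
    using that zero by (auto simp: coeff_pCons split: nat.splits)
  have "poly_fls [:z:] / poly_fls [:1:] \<in> KK" if "z \<in> Fq \<iota>" for z
    by (rule I[OF c[OF that] c[OF one]]) simp
  from this[OF zero] this[OF one] this[OF m1] show "0 \<in> KK" "1 \<in> KK" "-1 \<in> KK"
    by (simp_all add: fps_of_poly_const)
  assume "x \<in> KK" "y \<in> KK"
  then obtain p r p' r' where *: "\<forall>i. coeff p i \<in> Fq \<iota>" "\<forall>i. coeff r i \<in> Fq \<iota>" "r \<noteq> 0"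
    "\<forall>i. coeff p' i \<in> Fq \<iota>" "\<forall>i. coeff r' i \<in> Fq \<iota>" "r' \<noteq> 0"
    "x = poly_fls p / poly_fls r" "y = poly_fls p' / poly_fls r'" unfolding rat_funs_def by blast
  have e: "x + y = poly_fls (p * r' + p' * r) / poly_fls (r * r')"
    using * by (simp add: fps_of_poly_add fps_of_poly_mult fls_times_fps_to_fls add_frac_eq)
  show "x + y \<in> KK"
    unfolding e using * by (intro I) (auto simp: coeff_mult intro!: add sum mult)
qed

lemma one_Tate_frac: "1 \<in> TF"
  using Tate_frac_Tate[OF Tate_one] by simp

sublocale S: subring_pair FF TF
  by unfold_locales (auto intro: one_Tate_frac Tate_frac_add Tate_frac_mult Tate_frac_rat[THEN subsetD])

lemma Tate_frac_0: "0 \<in> TF"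
  using Tate_frac_Tate[OF Tate_zero] by simp

lemma Tate_frac_uminus: "x \<in> Tate_frac \<Longrightarrow> - x \<in> TF"
  using Tate_frac_mult[of "-1" x] Tate_frac_rat[THEN subsetD, OF KK_m1] by simp

lemma Tate_frac_sum: "(\<And>i. i \<in> A \<Longrightarrow> f i \<in> Tate_frac) \<Longrightarrow> sum f A \<in> TF"
  by (induction A rule: infinite_finite_induct) (auto intro: Tate_frac_0 Tate_frac_add)

abbreviation "v \<equiv> fps_nth jet"
abbreviation "u \<equiv> fps_nth (inverse jet)"

lemma v_Tate: "v i \<in> Tate_frac"
  by (simp add: jet_def Omega_hyperderiv_Tate)

lemma v_u: "(\<Sum>i\<le>m. v i * u (m - i)) = (if m = 0 then 1 else 0)"
proof -
  have "jet * inverse jet = 1" by (rule inverse_mult_eq_1'[OF jet_0])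
  then have "fps_nth (jet * inverse jet) m = fps_nth 1 m" by simp
  then show ?thesis by (simp add: fps_mult_nth atMost_atLeast0)
qed

text \<open>The recursion for the coefficients of the inverse series stays in the field
  \<open>TF\<close>.\<close>

lemma u_Tate: "u m \<in> Tate_frac"
proof (induction m rule: less_induct)
  case (less m)
  have "{..m} = insert 0 {1..m}" by auto
  then have "v 0 * u m + (\<Sum>i\<in>{1..m}. v i * u (m - i)) = (if m = 0 then 1 else 0)"
    using v_u[of m] by simp
  then have "u m = inverse (v 0) * ((if m = 0 then 1 else 0) + - (\<Sum>i\<in>{1..m}. v i * u (m - i)))"
    using jet_0 by (simp add: field_simps)
  moreover have "(\<Sum>i\<in>{1..m}. v i * u (m - i)) \<in> Tate_frac"
    by (intro Tate_frac_sum Tate_frac_mult v_Tate less.IH) auto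
  ultimately show ?case
    by (auto intro!: Tate_frac_mult Tate_frac_inverse v_Tate Tate_frac_add Tate_frac_uminus Tate_frac_0 one_Tate_frac)
qed

abbreviation "TR \<equiv> tensor_ring FF TF"
abbreviation "pt \<equiv> pure_tensor FF TF"

lemma pt_zero: "b \<in> Tate_frac \<Longrightarrow> pt 0 b = \<zero>\<^bsub>TR\<^esub>"
  using S.pt_add_left[of 0 0 b] Tate_frac_0 S.T.add.r_cancel_one'[of "pt 0 b" "pt 0 b"] by simp

lemma pt_zero_right: "b \<in> Tate_frac \<Longrightarrow> pt b 0 = \<zero>\<^bsub>TR\<^esub>"
  using S.pt_add_right[of b 0 0] Tate_frac_0 S.T.add.r_cancel_one'[of "pt b 0" "pt b 0"] by simp

lemma pt_sum:
  assumes "finite A" "\<And>i. i \<in> A \<Longrightarrow> f i \<in> Tate_frac"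
  shows "(\<Oplus>\<^bsub>TR\<^esub>i\<in>A. pt (f i) 1) = pt (\<Sum>i\<in>A. f i) 1"
  using assms
  by (induction A rule: finite_induct)
     (auto simp: pt_zero one_Tate_frac S.pt_add_left Tate_frac_sum S.T.finsum_insert Pi_def)

text \<open>Coefficients of the series \<open>jet \<otimes> 1\<close> times
  \<open>1 \<otimes> inverse jet\<close>.\<close>

definition psi :: "nat \<Rightarrow> (('c fls \<times> 'c fls) \<Rightarrow>\<^sub>0 int) set" where
  "psi m = (\<Oplus>\<^bsub>TR\<^esub>i\<in>{..m}. pt (v i) (u (m - i)))"

lemma psi_closed: "psi m \<in> carrier TR"
  unfolding psi_def by (rule S.T.finsum_closed) (auto simp: v_Tate u_Tate)

lemma psi_0_unit: "psi 0 \<in> Units TR"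
proof -
  have "pt (v 0) (u 0) \<in> carrier TR" by (rule S.pt_closed[OF v_Tate u_Tate])
  then have "psi 0 = pt (v 0) (u 0)" by (simp add: psi_def)
  moreover have e: "v 0 * u 0 = 1" "u 0 * v 0 = 1" using v_u[of 0] by (simp_all add: mult.commute)
  have "pt (v 0) (u 0) \<otimes>\<^bsub>TR\<^esub> pt (u 0) (v 0) = \<one>\<^bsub>TR\<^esub>" "pt (u 0) (v 0) \<otimes>\<^bsub>TR\<^esub> pt (v 0) (u 0) = \<one>\<^bsub>TR\<^esub>"
    by (simp_all only: S.pt_mult[OF v_Tate u_Tate u_Tate v_Tate] S.pt_mult[OF u_Tate v_Tate v_Tate u_Tate] e S.pt_one)
  ultimately show ?thesis unfolding Units_def using S.pt_closed[OF v_Tate[of 0] u_Tate[of 0]] S.pt_closed[OF u_Tate[of 0] v_Tate[of 0]] by auto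
qed

text \<open>Since \<open>Psi\<close> comes from \<open>inverse jet\<close>, the inverse of its left
  copy is the Toeplitz matrix of the \<open>v j \<otimes> 1\<close>.\<close>

lemma Psi_tilde_toeplitz: "Psi_tilde \<iota> (k + 1) (Psi \<iota> \<eta> k) = toeplitz TR (k + 1) psi"
proof -
  let ?n = "k + 1"
  have LL: "LL \<iota> = TR" by (simp add: LL_def)
  have m1: "map_mat (\<lambda>a. pt a 1) (Psi \<iota> \<eta> k) = toeplitz TR ?n (\<lambda>j. pt (u j) 1)"
    unfolding Psi_toep by (rule eq_matI) (auto simp: toep_def toeplitz_def pt_zero one_Tate_frac)
  have m2: "map_mat (\<lambda>a. pt 1 a) (Psi \<iota> \<eta> k) = toeplitz TR ?n (\<lambda>j. pt 1 (u j))"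
    unfolding Psi_toep by (rule eq_matI) (auto simp: toep_def toeplitz_def pt_zero_right one_Tate_frac)
  have closed: "pt (u j) 1 \<in> carrier TR" "pt (v j) 1 \<in> carrier TR" "pt 1 (u j) \<in> carrier TR" for j
    by (simp_all add: u_Tate v_Tate one_Tate_frac)
  have "conv TR (\<lambda>j. pt (v j) 1) (\<lambda>j. pt (u j) 1) m = (if m = 0 then \<one>\<^bsub>TR\<^esub> else \<zero>\<^bsub>TR\<^esub>)" for m
  proof -
    have "conv TR (\<lambda>j. pt (v j) 1) (\<lambda>j. pt (u j) 1) m = (\<Oplus>\<^bsub>TR\<^esub>i\<in>{..m}. pt (v i * u (m - i)) 1)"
      unfolding conv_def by (simp add: S.pt_mult u_Tate v_Tate one_Tate_frac)
    also have "\<dots> = pt (if m = 0 then 1 else 0) 1"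
      unfolding v_u[symmetric] by (rule pt_sum) (auto intro: Tate_frac_mult u_Tate v_Tate)
    finally show ?thesis by (simp add: S.pt_one pt_zero one_Tate_frac)
  qed
  then have "conv TR (\<lambda>j. pt (u j) 1) (\<lambda>j. pt (v j) 1) m = (if m = 0 then \<one>\<^bsub>TR\<^esub> else \<zero>\<^bsub>TR\<^esub>)" for m
    using S.T.conv_commute[of m "\<lambda>j. pt (u j) 1" "\<lambda>j. pt (v j) 1"] closed by simp
  then have inv: "inv\<^bsub>GL TR ?n\<^esub> (toeplitz TR ?n (\<lambda>j. pt (u j) 1)) = toeplitz TR ?n (\<lambda>j. pt (v j) 1)"
    by (intro S.T.toeplitz_inverse(2)) (simp_all add: closed)
  have "toeplitz TR ?n (\<lambda>j. pt (v j) 1) \<otimes>\<^bsub>GL TR ?n\<^esub> toeplitz TR ?n (\<lambda>j. pt 1 (u j)) =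
      toeplitz TR ?n (conv TR (\<lambda>j. pt (v j) 1) (\<lambda>j. pt 1 (u j)))"
    unfolding GL_def units_of_mult by (rule S.T.toeplitz_mult) (simp_all add: closed)
  also have "conv TR (\<lambda>j. pt (v j) 1) (\<lambda>j. pt 1 (u j)) = psi"
    by (rule ext) (simp add: conv_def psi_def S.pt_mult u_Tate v_Tate one_Tate_frac)
  finally show ?thesis unfolding Psi_tilde_def LL m1 m2 inv .
qed

text \<open>For every point \<open>z\<close> some functional maps each monomial in
  \<open>psi\<close> to its value at \<open>z\<close>. The relation then vanishes at every
  \<open>z\<close> as a polynomial over the infinite field of Laurent series, so its coefficients
  are 0.\<close>

lemma tensor_alg_independent:
  assumes M: "finite M" and c: "\<And>\<mu>. \<mu> \<in> M \<Longrightarrow> c \<mu> \<in> KK"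
    and rel: "(\<Oplus>\<^bsub>TR\<^esub>\<mu>\<in>M. pt (c \<mu>) 1 \<otimes>\<^bsub>TR\<^esub> mset_prod TR psi \<mu>) = \<zero>\<^bsub>TR\<^esub>" and "\<mu> \<in> M"
  shows "c \<mu> = 0"
proof -
  define d where "d \<mu> = (if \<mu> \<in> M then c \<mu> else 0)" for \<mu>
  have supp: "{\<mu>. d \<mu> \<noteq> 0} \<subseteq> M" by (auto simp: d_def)
  have "peval d z = 0" for z
  proof -
    \<comment> \<open>\<open>\<Theta> (psi j)\<close> will be the \<open>j\<close>-th coefficient of
      \<open>Y * inverse jet\<close>; this choice of \<open>Y\<close> makes it
      \<open>z j\<close>.\<close>
    define Y where "Y = Abs_fps z * jet"
    obtain \<zeta> where "frob_chain (\<lambda>x :: 'c. x ^ CARD('a)) \<zeta>"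
      and tau: "frob_chain.tau (\<lambda>x. x ^ CARD('a)) Omega = frob_chain.b \<zeta> * Omega" by (rule Omega_frob_chain)
    then interpret Z: frob_chain "\<lambda>x :: 'c. x ^ CARD('a)" \<zeta> by simp
    obtain \<phi> :: "'c fls \<Rightarrow> 'c fls" where \<phi>: "\<And>x y. \<phi> (x + y) = \<phi> x + \<phi> y"
      "\<And>c x. c \<in> rat_funs UNIV \<Longrightarrow> \<phi> (c * x) = c * \<phi> x"
      "\<And>m. \<phi> (\<Prod>j\<in>#m. hyperderiv j Omega) = (\<Prod>j\<in>#m. fps_nth Y j)"
      by (rule Z.multiplicative_functional_exists[OF Omega_nonzero tau, where y = "fps_nth Y"]) (rule that, assumption+)
    interpret \<phi>: multiplicative_functional FF TF \<phi> v "fps_nth Y"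
    proof
      show "\<phi> (c * x) = c * \<phi> x" if "c \<in> FF" for c x
        using \<phi>(2) that rat_funs_mono[of "K_bar \<iota>" UNIV] by blast
    qed (use \<phi> v_Tate in \<open>auto simp: jet_def\<close>)
    have z: "(\<Sum>i\<le>j. fps_nth Y i * u (j - i)) = z j" for j
    proof -
      have "Y * inverse jet = Abs_fps z" using inverse_mult_eq_1'[OF jet_0] by (simp add: Y_def mult.assoc)
      then have "fps_nth (Y * inverse jet) j = z j" by simp
      then show ?thesis by (simp add: fps_mult_nth atMost_atLeast0)
    qed
    have mon: "mset_prod TR psi \<mu> \<in> carrier TR" for \<mu> by (rule S.T.mset_prod_closed) (rule psi_closed)
    have theta_term: "\<phi>.\<Theta> (pt (c \<mu>) 1 \<otimes>\<^bsub>TR\<^esub> mset_prod TR psi \<mu>) = c \<mu> * (\<Prod>j\<in>#\<mu>. z j)" if "\<mu> \<in> M" for \<mu>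
    proof -
      have cF: "c \<mu> \<in> FF" "c \<mu> \<in> Tate_frac" using c[OF that] KK_FF Tate_frac_rat by blast+
      \<comment> \<open>The coefficient lies in the field over which the tensor product is balanced,
        so it moves to the right factor, where \<open>\<Theta>\<close> is linear.\<close>
      have "pt (c \<mu>) 1 = pt 1 (c \<mu>)" using S.pt_balanced[OF cF(1), of 1 1] one_Tate_frac by simp
      then have "\<phi>.\<Theta> (pt (c \<mu>) 1 \<otimes>\<^bsub>TR\<^esub> mset_prod TR psi \<mu>) = c \<mu> * \<phi>.\<Theta> (mset_prod TR psi \<mu>)"
        using \<phi>.Theta_pt_right[OF cF(2) mon] by simp
      also have "\<phi>.\<Theta> (mset_prod TR psi \<mu>) = (\<Prod>j\<in>set_mset \<mu>. z j ^ count \<mu> j)"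
        unfolding mset_prod_def
        using \<phi>.Theta_monomial[of u psi "set_mset \<mu>" "count \<mu>", OF u_Tate psi_def] by (simp add: z)
      also have "\<dots> = (\<Prod>j\<in>#\<mu>. z j)" by (simp add: image_prod_mset_multiplicity)
      finally show ?thesis .
    qed
    have "0 = \<phi>.\<Theta> (\<Oplus>\<^bsub>TR\<^esub>\<mu>\<in>M. pt (c \<mu>) 1 \<otimes>\<^bsub>TR\<^esub> mset_prod TR psi \<mu>)"
      unfolding rel \<phi>.Theta_zero ..
    also have "\<dots> = (\<Sum>\<mu>\<in>M. \<phi>.\<Theta> (pt (c \<mu>) 1 \<otimes>\<^bsub>TR\<^esub> mset_prod TR psi \<mu>))"
    proof (rule \<phi>.Theta_sum[OF M])
      fix \<mu> assume "\<mu> \<in> M"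
      then have "c \<mu> \<in> Tate_frac" using c Tate_frac_rat by blast
      then show "pt (c \<mu>) 1 \<otimes>\<^bsub>TR\<^esub> mset_prod TR psi \<mu> \<in> carrier TR"
        using mon one_Tate_frac by simp
    qed
    also have "\<dots> = peval d z"
      unfolding peval_superset[OF M supp] by (intro sum.cong) (simp_all add: theta_term d_def)
    finally show ?thesis by simp
  qed
  then have "d \<mu> = 0"
    by (intro peval_eq_0_imp_zero[OF infinite_fls finite_subset[OF supp M]])
  then show ?thesis using \<open>\<mu> \<in> M\<close> by (simp add: d_def)
qed

lemma pt_hom:
  "c \<in> KK \<Longrightarrow> pt c 1 \<in> carrier TR" "pt 0 1 = \<zero>\<^bsub>TR\<^esub>" "pt 1 1 = \<one>\<^bsub>TR\<^esub>"
  "c \<in> KK \<Longrightarrow> d \<in> KK \<Longrightarrow> c + d \<in> KK \<and> pt (c + d) 1 = pt c 1 \<oplus>\<^bsub>TR\<^esub> pt d 1"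
  using Tate_frac_rat[of "Fq \<iota>"] one_Tate_frac by (auto simp: pt_zero S.pt_one S.pt_add_left KK_add subset_iff)

lemma gl_coeff_KK:
  assumes "f \<in> gl_polys KK n"
  shows "gl_coeff n f \<mu> \<in> KK"
proof -
  have "sum g A \<in> KK" if "\<And>i. i \<in> A \<Longrightarrow> g i \<in> KK" for g :: "(gl_var \<Rightarrow>\<^sub>0 nat) \<Rightarrow> 'c fls" and A
    using that by (induction A rule: infinite_finite_induct) (auto intro: KK_0 KK_add)
  then show ?thesis unfolding gl_coeff_def using assms by (auto simp: gl_polys_def)
qed

text \<open>The monomials containing \<open>k + 1\<close> stand for products with an entry below the
  diagonal and vanish at \<open>psi\<close> extended by 0, so their coefficients stay undetermined.
  The others form a relation between the \<open>psi j\<close>, after multiplication by a power of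
  \<open>psi 0\<close>.\<close>

lemma galois_ideal_coeff:
  assumes f: "f \<in> galois_ideal \<iota> (k + 1) (Psi \<iota> \<eta> k)"
    and \<mu>: "\<mu> \<in> gl_mset (k + 1) (gl_deg f) ` Poly_Mapping.keys f" "k + 1 \<notin># \<mu>"
  shows "gl_coeff (k + 1) f \<mu> = 0"
proof -
  let ?n = "k + 1"
  define M where "M = gl_mset ?n (gl_deg f) ` Poly_Mapping.keys f"
  have f1: "f \<in> gl_polys KK ?n" and f2: "gl_eval TR (\<lambda>c. pt c 1) ?n (toeplitz TR ?n psi) f = \<zero>\<^bsub>TR\<^esub>"
    using f by (simp_all add: galois_ideal_def Fqt_def LL_def Psi_tilde_toeplitz del: One_nat_def add_Suc_right)
  have coeff: "gl_coeff ?n f \<mu> \<in> KK" for \<mu> by (rule gl_coeff_KK[OF f1])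
  let ?t = "\<lambda>\<mu>. pt (gl_coeff ?n f \<mu>) 1 \<otimes>\<^bsub>TR\<^esub> mset_prod TR psi \<mu>"
  let ?psi = "psi(?n := \<zero>\<^bsub>TR\<^esub>)"
  have psi': "?psi j \<in> carrier TR" for j using psi_closed by simp
  have t_closed: "?t \<mu> \<in> carrier TR" for \<mu>
    using pt_hom(1)[OF coeff] psi_closed by (intro S.T.m_closed S.T.mset_prod_closed) auto
  have "(\<Oplus>\<^bsub>TR\<^esub>\<mu>\<in>M. pt (gl_coeff ?n f \<mu>) 1 \<otimes>\<^bsub>TR\<^esub> mset_prod TR ?psi \<mu>) =
      gl_eval TR (\<lambda>c. pt c 1) ?n (toeplitz TR ?n psi) f \<otimes>\<^bsub>TR\<^esub> psi 0 [^]\<^bsub>TR\<^esub> (?n * gl_deg f)"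
    unfolding M_def
    by (rule S.T.gl_eval_toeplitz(2)[symmetric, where F = KK])
       (use psi_closed psi_0_unit f1 pt_hom KK_0 in auto)
  also have "\<dots> = \<zero>\<^bsub>TR\<^esub>" unfolding f2 using psi_closed by simp
  also have "(\<Oplus>\<^bsub>TR\<^esub>\<mu>\<in>M. pt (gl_coeff ?n f \<mu>) 1 \<otimes>\<^bsub>TR\<^esub> mset_prod TR ?psi \<mu>) =
      (\<Oplus>\<^bsub>TR\<^esub>\<mu>\<in>{\<mu>\<in>M. ?n \<notin># \<mu>}. ?t \<mu>)"
  proof (rule S.T.add.finprod_mono_neutral_cong_right)
    show "pt (gl_coeff ?n f \<mu>) 1 \<otimes>\<^bsub>TR\<^esub> mset_prod TR ?psi \<mu> = \<zero>\<^bsub>TR\<^esub>" if "\<mu> \<in> M - {\<mu>\<in>M. ?n \<notin># \<mu>}" for \<mu>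
      using that pt_hom(1)[OF coeff] S.T.mset_prod_zero[of ?n \<mu> ?psi] psi' by auto
    show "pt (gl_coeff ?n f \<mu>) 1 \<otimes>\<^bsub>TR\<^esub> mset_prod TR ?psi \<mu> = ?t \<mu>" if "\<mu> \<in> {\<mu>\<in>M. ?n \<notin># \<mu>}" for \<mu>
    proof -
      have "mset_prod TR ?psi \<mu> = mset_prod TR psi \<mu>"
        unfolding mset_prod_def by (rule S.T.finprod_cong') (use that psi_closed in auto)
      then show ?thesis by simp
    qed
    show "(\<lambda>\<mu>. pt (gl_coeff ?n f \<mu>) 1 \<otimes>\<^bsub>TR\<^esub> mset_prod TR ?psi \<mu>) \<in> M \<rightarrow> carrier TR"
      using pt_hom(1)[OF coeff] psi' by (auto intro!: S.T.m_closed S.T.mset_prod_closed)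
  qed (auto simp: M_def)
  finally show ?thesis
    by (intro tensor_alg_independent[of "{\<mu>\<in>M. ?n \<notin># \<mu>}" "gl_coeff ?n f"]) (use \<mu> coeff in \<open>auto simp: M_def\<close>)
qed

section \<open>The points of the group\<close>

lemma entry_in_gl_polys:
  assumes "c \<in> KK" "i < n" "j < n"
  shows "entry i j c \<in> gl_polys KK n"
  using assms KK_0 by (auto simp: gl_polys_def lookup_single when_def split: if_splits)

lemma gl_polys_add: "f \<in> gl_polys KK n \<Longrightarrow> g \<in> gl_polys KK n \<Longrightarrow> f + g \<in> gl_polys KK n"
  using keys_add[of f g] unfolding gl_polys_def by (auto simp: lookup_add KK_add) blast

text \<open>A point is Toeplitz because the linear equations of Toeplitz matrices hold for
  \<open>Psi_tilde\<close> and so lie in the ideal. Conversely, every other equation in the ideal is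
  trivial on Toeplitz matrices by \<open>galois_ideal_coeff\<close>.\<close>

theorem Gamma_prolongation_eq:
  fixes R :: "('r, 'm) ring_scheme"
  assumes R: "cring R" and h: "h \<in> Ring.ring_hom (Fqt \<iota>) R"
  shows "Gamma_prolongation \<iota> \<eta> k R h = {toeplitz R (k + 1) a | a. a 0 \<in> Units R \<and> (\<forall>i<k + 1. a i \<in> carrier R)}"
proof -
  interpret R: cring R by fact
  let ?n = "k + 1"
  have Fqt: "carrier (Fqt \<iota>) = KK" "x \<oplus>\<^bsub>Fqt \<iota>\<^esub> y = x + y" "\<one>\<^bsub>Fqt \<iota>\<^esub> = 1" for x y
    by (simp_all add: Fqt_def ring_of_type_algebra_def)
  have hc: "h c \<in> carrier R" if "c \<in> KK" for c using ring_hom_closed[OF h] that by (simp add: Fqt)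
  have h_add: "h (c + d) = h c \<oplus>\<^bsub>R\<^esub> h d" if "c \<in> KK" "d \<in> KK" for c d
    using ring_hom_add[OF h] that by (simp add: Fqt)
  have h1: "h 1 = \<one>\<^bsub>R\<^esub>" using ring_hom_one[OF h] by (simp add: Fqt)
  have h0: "h 0 = \<zero>\<^bsub>R\<^esub>"
    using h_add[OF KK_0 KK_0] R.add.r_cancel_one'[of "h 0" "h 0"] hc[OF KK_0] by simp
  have hm1: "h (- 1) = \<ominus>\<^bsub>R\<^esub> \<one>\<^bsub>R\<^esub>"
  proof -
    have "h (- 1) \<oplus>\<^bsub>R\<^esub> \<one>\<^bsub>R\<^esub> = \<zero>\<^bsub>R\<^esub>" using h_add[OF KK_m1 KK_1] h0 h1 by simp
    then show ?thesis using R.minus_equality hc[OF KK_m1] by simp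
  qed
  have ideal: "f \<in> galois_ideal \<iota> ?n (Psi \<iota> \<eta> k) \<longleftrightarrow> f \<in> gl_polys KK ?n \<and>
      gl_eval TR (\<lambda>c. pt c 1) ?n (toeplitz TR ?n psi) f = \<zero>\<^bsub>TR\<^esub>" for f
    unfolding galois_ideal_def Psi_tilde_toeplitz by (simp add: Fqt LL_def)
  have Tt: "toeplitz TR ?n psi $$ (i, j) \<in> carrier TR" if "i < ?n" "j < ?n" for i j
    using that psi_closed by auto
  note T1 = pt_hom(1)[OF KK_1] pt_hom(1)[OF KK_m1]
  have Tm1: "pt 1 1 \<oplus>\<^bsub>TR\<^esub> pt (- 1) 1 = \<zero>\<^bsub>TR\<^esub>" using pt_hom(4)[OF KK_1 KK_m1] pt_hom(2) by simp
  show ?thesis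
  proof (intro equalityI subsetI)
    fix A assume "A \<in> Gamma_prolongation \<iota> \<eta> k R h"
    then have A: "A \<in> carrier (GL R ?n)" and van: "\<And>f. f \<in> galois_ideal \<iota> ?n (Psi \<iota> \<eta> k) \<Longrightarrow> gl_eval R h ?n A f = \<zero>\<^bsub>R\<^esub>"
      by (auto simp: Gamma_prolongation_def motivic_galois_points_def)
    have AM: "A \<in> carrier (mat_monoid R ?n)" using A by (auto simp: GL_def units_of_carrier Units_def)
    note AR = R.mat_monoid_carrierD(2)[OF AM]
    have lower: "A $$ (i, j) = \<zero>\<^bsub>R\<^esub>" if ij: "j < i" "i < ?n" for i j
    proof -
      let ?f = "entry i j (1 :: 'c fls)"
      have "?f \<in> gl_polys KK ?n" using ij KK_1 by (intro entry_in_gl_polys) auto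
      moreover have "gl_eval TR (\<lambda>c. pt c 1) ?n (toeplitz TR ?n psi) ?f = pt 1 1 \<otimes>\<^bsub>TR\<^esub> toeplitz TR ?n psi $$ (i, j)"
        by (rule S.T.gl_eval_single) (use T1 psi_closed ij in auto)
      moreover have "toeplitz TR ?n psi $$ (i, j) = \<zero>\<^bsub>TR\<^esub>" using ij by simp
      ultimately have "?f \<in> galois_ideal \<iota> ?n (Psi \<iota> \<eta> k)" unfolding ideal using T1 by simp
      then have "gl_eval R h ?n A ?f = \<zero>\<^bsub>R\<^esub>" by (rule van)
      moreover have "gl_eval R h ?n A ?f = h 1 \<otimes>\<^bsub>R\<^esub> A $$ (i, j)"
        by (rule R.gl_eval_single) (use hc[OF KK_1] AR ij in auto)
      ultimately show ?thesis using AR ij by (simp add: h1)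
    qed
    have diag: "A $$ (i, j) = A $$ (Suc i, Suc j)" if ij: "Suc i < ?n" "Suc j < ?n" for i j
    proof -
      let ?f = "entry i j (1 :: 'c fls) +
        entry (Suc i) (Suc j) (-1)"
      have "?f \<in> gl_polys KK ?n" using ij KK_1 KK_m1 by (intro gl_polys_add entry_in_gl_polys) auto
      moreover have "gl_eval TR (\<lambda>c. pt c 1) ?n (toeplitz TR ?n psi) ?f =
          pt 1 1 \<otimes>\<^bsub>TR\<^esub> toeplitz TR ?n psi $$ (i, j) \<oplus>\<^bsub>TR\<^esub> pt (-1) 1 \<otimes>\<^bsub>TR\<^esub> toeplitz TR ?n psi $$ (Suc i, Suc j)"
        by (rule S.T.gl_eval_two) (use T1 psi_closed ij in auto)
      moreover have "toeplitz TR ?n psi $$ (Suc i, Suc j) = toeplitz TR ?n psi $$ (i, j)" using ij by simp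
      moreover have "pt 1 1 \<otimes>\<^bsub>TR\<^esub> toeplitz TR ?n psi $$ (i, j) \<oplus>\<^bsub>TR\<^esub> pt (-1) 1 \<otimes>\<^bsub>TR\<^esub> toeplitz TR ?n psi $$ (i, j) =
          (pt 1 1 \<oplus>\<^bsub>TR\<^esub> pt (-1) 1) \<otimes>\<^bsub>TR\<^esub> toeplitz TR ?n psi $$ (i, j)"
        by (rule S.T.l_distr[symmetric]) (use T1 Tt[of i j] ij in auto)
      moreover have "toeplitz TR ?n psi $$ (i, j) \<in> carrier TR" by (rule Tt) (use ij in auto)
      ultimately have "?f \<in> galois_ideal \<iota> ?n (Psi \<iota> \<eta> k)" unfolding ideal Tm1 by (simp only: S.T.l_null)
      then have "gl_eval R h ?n A ?f = \<zero>\<^bsub>R\<^esub>" by (rule van)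
      moreover have "gl_eval R h ?n A ?f = h 1 \<otimes>\<^bsub>R\<^esub> A $$ (i, j) \<oplus>\<^bsub>R\<^esub> h (-1) \<otimes>\<^bsub>R\<^esub> A $$ (Suc i, Suc j)"
        by (rule R.gl_eval_two) (use hc[OF KK_1] hc[OF KK_m1] AR ij in auto)
      moreover have R2: "A $$ (i, j) \<in> carrier R" "A $$ (Suc i, Suc j) \<in> carrier R" using AR ij by auto
      ultimately have "A $$ (i, j) \<oplus>\<^bsub>R\<^esub> \<ominus>\<^bsub>R\<^esub> A $$ (Suc i, Suc j) = \<zero>\<^bsub>R\<^esub>"
        by (simp add: h1 hm1 R.l_minus)
      then show ?thesis using R.minus_equality[of "A $$ (i, j)" "\<ominus>\<^bsub>R\<^esub> A $$ (Suc i, Suc j)"] R2 by simp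
    qed
    have upper: "A $$ (i, i + m) = A $$ (0, m)" if "i + m < ?n" for i m
      using that by (induction i) (use diag in auto)
    have eq: "A = toeplitz R ?n (\<lambda>m. A $$ (0, m))"
    proof (rule R.mat_monoid_eqI[OF AM])
      show "toeplitz R ?n (\<lambda>m. A $$ (0, m)) \<in> carrier (mat_monoid R ?n)"
        using AR by (intro R.toeplitz_closed) auto
      fix i j assume ij: "i < ?n" "j < ?n"
      show "A $$ (i, j) = toeplitz R ?n (\<lambda>m. A $$ (0, m)) $$ (i, j)"
        using ij lower[of j i] upper[of i "j - i"] by (cases "i \<le> j") auto
    qed
    have "toeplitz R ?n (\<lambda>m. A $$ (0, m)) \<in> carrier (GL R ?n)" by (subst eq[symmetric]) (rule A)
    then have "A $$ (0, 0) \<in> Units R" by (rule R.toeplitz_unit_diagonal[rotated]) simp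
    moreover have "\<forall>i<?n. A $$ (0, i) \<in> carrier R" using AR by simp
    ultimately show "A \<in> {toeplitz R ?n a | a. a 0 \<in> Units R \<and> (\<forall>i<?n. a i \<in> carrier R)}"
      using eq by blast
  next
    fix A assume "A \<in> {toeplitz R ?n a | a. a 0 \<in> Units R \<and> (\<forall>i<?n. a i \<in> carrier R)}"
    then obtain a where a: "A = toeplitz R ?n a" "a 0 \<in> Units R" "\<And>i. i < ?n \<Longrightarrow> a i \<in> carrier R" by blast
    have A: "A \<in> carrier (GL R ?n)"
    proof -
      have "A \<in> {toeplitz R ?n a | a. a 0 \<in> Units R \<and> (\<forall>i<?n. a i \<in> carrier R)}" using a by blast
      moreover have "?n > 0" by simp
      ultimately show ?thesis using subgroup.subset[OF R.toeplitz_GL_subgroup[of ?n]] by (meson subsetD)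
    qed
    have "gl_eval R h ?n A f = \<zero>\<^bsub>R\<^esub>" if f: "f \<in> galois_ideal \<iota> ?n (Psi \<iota> \<eta> k)" for f
    proof -
      have fp: "f \<in> gl_polys KK ?n" using f ideal by blast
      have hadd: "c + d \<in> KK \<and> h (c + d) = h c \<oplus>\<^bsub>R\<^esub> h d" if "c \<in> KK" "d \<in> KK" for c d
        using KK_add[OF that] h_add[OF that] by simp
      note ev = R.gl_eval_toeplitz[where F = KK and h = h and n = ?n and a = a and f = f, OF _ a(3,2) fp hc h0 KK_0 hadd]
      let ?M = "gl_mset ?n (gl_deg f) ` Poly_Mapping.keys f"
      have a': "(a(?n := \<zero>\<^bsub>R\<^esub>)) j \<in> carrier R" if "j \<le> ?n" for j using a(3) that by simp
      have "(\<Oplus>\<^bsub>R\<^esub>\<mu>\<in>?M. h (gl_coeff ?n f \<mu>) \<otimes>\<^bsub>R\<^esub> mset_prod R (a(?n := \<zero>\<^bsub>R\<^esub>)) \<mu>) = \<zero>\<^bsub>R\<^esub>"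
      proof (rule R.add.finprod_one_eqI)
        fix \<mu> assume \<mu>: "\<mu> \<in> ?M"
        then have \<mu>_le: "j \<le> ?n" if "j \<in># \<mu>" for j
          using that \<mu> gl_mset_le[OF fp] by blast
        have coeff: "gl_coeff ?n f \<mu> \<in> KK" by (rule gl_coeff_KK[OF fp])
        have mR: "mset_prod R (a(?n := \<zero>\<^bsub>R\<^esub>)) \<mu> \<in> carrier R"
          by (rule R.mset_prod_closed) (rule a'[OF \<mu>_le])
        show "h (gl_coeff ?n f \<mu>) \<otimes>\<^bsub>R\<^esub> mset_prod R (a(?n := \<zero>\<^bsub>R\<^esub>)) \<mu> = \<zero>\<^bsub>R\<^esub>"
        \<comment> \<open>In a monomial containing \<open>k + 1\<close> the variable has value 0; in
          any other monomial the coefficient is 0.\<close>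
        proof (cases "?n \<in># \<mu>")
          case True
          then have "mset_prod R (a(?n := \<zero>\<^bsub>R\<^esub>)) \<mu> = \<zero>\<^bsub>R\<^esub>"
            by (rule R.mset_prod_zero) (use a'[OF \<mu>_le] in auto)
          then show ?thesis using hc[OF coeff] by simp
        next
          case False
          then have "gl_coeff ?n f \<mu> = 0" by (rule galois_ideal_coeff[OF f \<mu>])
          then show ?thesis using h0 mR by simp
        qed
      qed
      then have zero: "gl_eval R h ?n A f \<otimes>\<^bsub>R\<^esub> a 0 [^]\<^bsub>R\<^esub> (?n * gl_deg f) = \<zero>\<^bsub>R\<^esub>"
        unfolding a(1) using ev(2) by simp
      have unit: "a 0 [^]\<^bsub>R\<^esub> (?n * gl_deg f) \<in> Units R" using a(2) by (rule R.Units_pow_closed)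
      have gR: "gl_eval R h ?n A f \<in> carrier R" unfolding a(1) using ev(1) by simp
      \<comment> \<open>The power of \<open>a 0\<close> introduced to clear the determinant is a
        unit and cancels.\<close>
      have "gl_eval R h ?n A f =
          gl_eval R h ?n A f \<otimes>\<^bsub>R\<^esub> a 0 [^]\<^bsub>R\<^esub> (?n * gl_deg f) \<otimes>\<^bsub>R\<^esub> inv\<^bsub>R\<^esub> (a 0 [^]\<^bsub>R\<^esub> (?n * gl_deg f))"
        using R.Units_r_inv[OF unit] R.Units_closed[OF unit] R.Units_inv_closed[OF unit] gR
        by (simp only: R.m_assoc R.r_one)
      also have "\<dots> = \<zero>\<^bsub>R\<^esub>" unfolding zero using R.Units_inv_closed[OF unit] by simp
      finally show ?thesis .
    qed
    then show "A \<in> Gamma_prolongation \<iota> \<eta> k R h"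
      using A by (simp add: Gamma_prolongation_def motivic_galois_points_def)
  qed
qed

end

theorem theorem5p1:
  fixes \<iota> :: "'a::{field,finite} fls alg_closure \<Rightarrow> 'c::{field,complete_space}"
    and \<eta> :: 'c
    and k :: nat
    and R :: "('r, 'm) ring_scheme"
    and h :: "'c fls \<Rightarrow> 'r"
  assumes "completed_alg_closure \<iota>"
    and "\<eta> ^ (CARD('a) - 1) = - theta \<iota>"
    and "k \<ge> 1"
    and "cring R"
    and "h \<in> Ring.ring_hom (Fqt \<iota>) R"
  shows "subgroup (Gamma_prolongation \<iota> \<eta> k R h) (GL R (k + 1)) \<and>
    Gamma_prolongation \<iota> \<eta> k R h =
      {mat (k + 1) (k + 1) (\<lambda>(i, j). if i \<le> j then a (j - i) else \<zero>\<^bsub>R\<^esub>) | a.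
         a 0 \<in> Units R \<and> (\<forall>i\<in>{1..k}. a i \<in> carrier R)}"
proof -
  interpret carlitz \<iota> \<eta> by unfold_locales fact+
  interpret R: cring R by fact
  have "(\<forall>i<k + 1. a i \<in> carrier R) \<longleftrightarrow> (\<forall>i\<in>{1..k}. a i \<in> carrier R)" if "a 0 \<in> Units R" for a :: "nat \<Rightarrow> 'r"
  proof -
    have "{..<k + 1} = insert 0 {1..k}" by auto
    then show ?thesis using R.Units_closed[OF that] by (metis insert_iff lessThan_iff)
  qed
  then have "{toeplitz R (k + 1) a | a. a 0 \<in> Units R \<and> (\<forall>i<k + 1. a i \<in> carrier R)} =
    {toeplitz R (k + 1) a | a. a 0 \<in> Units R \<and> (\<forall>i\<in>{1..k}. a i \<in> carrier R)}" by blast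
  then show ?thesis
    using R.toeplitz_GL_subgroup[of "k + 1"] Gamma_prolongation_eq[OF assms(4,5), of k]
    by (simp add: toeplitz_def)
qed

end
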